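(* Let $\widetilde\Omega,\Omega\subset\mathbb C$ be bounded simply connected domains, let $A\in M^{2\times2}(\widetilde\Omega)$, and let $\varphi:\widetilde\Omega\to\Omega$ be an $A$-quasiconformal mapping with $|J(w,\varphi)|=1$ for almost all $w\in\widetilde\Omega$. Then the Dirichlet eigenvalues of the divergence form elliptic operator $-\mathrm{div}[A(w)\nabla g(w)]$ in $\widetilde\Omega$ are equal to the Dirichlet eigenvalues of the Laplace operator in $\Omega$: $\lambda_n[A,\widetilde\Omega]=\lambda_n[\Omega]$ for every $n\in\mathbb N$.
   Context: Identify $\mathbb C$ with $\mathbb R^2$, $w=u+iv\in\widetilde\Omega$. $M^{2\times2}(\widetilde\Omega)$ is the class of real symmetric $2\times2$ matrix functions $A(w)=\{a_{kl}(w)\}$ on $\widetilde\Omega$ with measurable entries, $\det A=1$, satisfying the uniform ellipticity condition: for some $1\le K<\infty$, $\frac1K|\xi|^2\le\langle A(w)\xi,\xi\rangle\le K|\xi|^2$ for a.e. $w\in\widetilde\Omega$ and every $\xi\in\mathbb C$. A homeomorphism $\varphi:\widetilde\Omega\to\Omega$ is called $A$-quasiconformal if it is quasiconformal (i.e. $\varphi\in W^{1,2}_{\rm loc}(\widetilde\Omega)$ and $|D\varphi(w)|^2\le K|J(w,\varphi)|$ a.e. for some constant $1\le K<\infty$, where $J(w,\varphi)$ is the Jacobian) and satisfies the Beltrami equation $\varphi_{\overline w}=\mu\,\varphi_w$ a.e. in $\widetilde\Omega$ with $\mu(w)=\dfrac{a_{22}(w)-a_{11}(w)-2ia_{12}(w)}{\det(I+A(w))}$,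 where $\varphi_w=\frac12(\partial_u\varphi-i\partial_v\varphi)$ and $\varphi_{\overline w}=\frac12(\partial_u\varphi+i\partial_v\varphi)$. $0<\lambda_1[A,\widetilde\Omega]\le\lambda_2[A,\widetilde\Omega]\le\dots$ are the Dirichlet eigenvalues, repeated according to multiplicity, of $-\mathrm{div}[A(w)\nabla g(w)]=\lambda g$ in $\widetilde\Omega$, in the weak sense: $g\in W_0^{1,2}(\widetilde\Omega)$ and $\iint_{\widetilde\Omega}\langle A\nabla g,\nabla\overline f\rangle\,du\,dv=\lambda\iint_{\widetilde\Omega}g\overline f\,du\,dv$ for all $f\in W_0^{1,2}(\widetilde\Omega)$. $\lambda_n[\Omega]$ denotes the $n$-th Dirichlet eigenvalue (with multiplicity) of $-\Delta$ in $\Omega$. *)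

theory Defs
  imports "HOL-Analysis.Analysis" "HOL-Library.Extended_Nat"
begin

section \<open>Smooth functions and weak derivatives\<close>

text \<open>
  The plane is the type \<^typ>\<open>complex\<close>, regarded as a two-dimensional real space; derivatives are
  real derivatives.  Directions are elements of \<^typ>\<open>complex\<close>: direction \<open>1\<close> is \<open>\<partial>/\<partial>u\<close>
  and direction \<open>\<i>\<close> is \<open>\<partial>/\<partial>v\<close>.
\<close>

primrec Ck :: "nat \<Rightarrow> (complex \<Rightarrow> complex) \<Rightarrow> bool" where
  "Ck 0 f \<longleftrightarrow> continuous_on UNIV f"
| "Ck (Suc k) f \<longleftrightarrow>
     (\<forall>w. f differentiable (at w)) \<and> (\<forall>e. Ck k (\<lambda>w. frechet_derivative f (at w) e))"

definition test_function :: "complex set \<Rightarrow> (complex \<Rightarrow> complex) \<Rightarrow> bool" where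
  "test_function U \<eta> \<longleftrightarrow>
     (\<forall>k. Ck k \<eta>) \<and> compact (closure {w. \<eta> w \<noteq> 0}) \<and> closure {w. \<eta> w \<noteq> 0} \<subseteq> U"

definition locally_integrable :: "complex set \<Rightarrow> (complex \<Rightarrow> complex) \<Rightarrow> bool" where
  "locally_integrable U f \<longleftrightarrow>
     (\<forall>C. compact C \<and> C \<subseteq> U \<longrightarrow> integrable (lebesgue_on C) f)"

definition has_weak_derivative ::
    "complex set \<Rightarrow> complex \<Rightarrow> (complex \<Rightarrow> complex) \<Rightarrow> (complex \<Rightarrow> complex) \<Rightarrow> bool" where
  "has_weak_derivative U e f g \<longleftrightarrow>
     locally_integrable U f \<and> locally_integrable U g \<and>
     (\<forall>\<eta>. test_function U \<eta> \<longrightarrow>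
        (LINT w|lebesgue_on U. f w * frechet_derivative \<eta> (at w) e)
          = - (LINT w|lebesgue_on U. g w * \<eta> w))"

text \<open>
  Weak derivatives are unique up to null sets; a representative is chosen, and it is only ever used
  under integrals and in almost-everywhere statements.
\<close>

definition weak_derivative ::
    "complex set \<Rightarrow> complex \<Rightarrow> (complex \<Rightarrow> complex) \<Rightarrow> complex \<Rightarrow> complex" where
  "weak_derivative U e f = (SOME g. has_weak_derivative U e f g)"

abbreviation weak_du :: "complex set \<Rightarrow> (complex \<Rightarrow> complex) \<Rightarrow> complex \<Rightarrow> complex" where
  "weak_du U \<equiv> weak_derivative U 1"

abbreviation weak_dv :: "complex set \<Rightarrow> (complex \<Rightarrow> complex) \<Rightarrow> complex \<Rightarrow> complex" where
  "weak_dv U \<equiv> weak_derivative U \<i>"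

definition weak_gradient ::
    "complex set \<Rightarrow> (complex \<Rightarrow> complex) \<Rightarrow> complex \<Rightarrow> complex ^ 2" where
  "weak_gradient U f w = vector [weak_du U f w, weak_dv U f w]"


section \<open>Sobolev spaces\<close>

definition square_integrable :: "complex set \<Rightarrow> (complex \<Rightarrow> complex) \<Rightarrow> bool" where
  "square_integrable U f \<longleftrightarrow>
     f \<in> borel_measurable (lebesgue_on U) \<and> integrable (lebesgue_on U) (\<lambda>w. (cmod (f w))\<^sup>2)"

definition locally_square_integrable :: "complex set \<Rightarrow> (complex \<Rightarrow> complex) \<Rightarrow> bool" where
  "locally_square_integrable U f \<longleftrightarrow>
     (\<forall>C. compact C \<and> C \<subseteq> U \<longrightarrow> square_integrable C f)"

definition W12 :: "complex set \<Rightarrow> (complex \<Rightarrow> complex) set" where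
  "W12 U = {f. square_integrable U f \<and>
     (\<forall>e\<in>{1, \<i>}. \<exists>g. has_weak_derivative U e f g \<and> square_integrable U g)}"

definition W12_loc :: "complex set \<Rightarrow> (complex \<Rightarrow> complex) set" where
  "W12_loc U = {f. locally_square_integrable U f \<and>
     (\<forall>e\<in>{1, \<i>}. \<exists>g. has_weak_derivative U e f g \<and> locally_square_integrable U g)}"

definition W12_norm :: "complex set \<Rightarrow> (complex \<Rightarrow> complex) \<Rightarrow> real" where
  "W12_norm U f = sqrt ((LINT w|lebesgue_on U. (cmod (f w))\<^sup>2)
                      + (LINT w|lebesgue_on U. (norm (weak_gradient U f w))\<^sup>2))"

text \<open>The closure of the test functions in the \<open>W12\<close> norm.\<close>

definition W12_0 :: "complex set \<Rightarrow> (complex \<Rightarrow> complex) set" where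
  "W12_0 U = {f \<in> W12 U. \<exists>\<eta> :: nat \<Rightarrow> complex \<Rightarrow> complex.
     (\<forall>j. test_function U (\<eta> j)) \<and> (\<lambda>j. W12_norm U (\<lambda>w. f w - \<eta> j w)) \<longlonglongrightarrow> 0}"


section \<open>Coefficient matrices and quasiconformal maps\<close>

definition elliptic_matrices :: "complex set \<Rightarrow> (complex \<Rightarrow> real ^ 2 ^ 2) set" where
  "elliptic_matrices U = {A.
     (\<forall>k l. (\<lambda>w. A w $ k $ l) \<in> borel_measurable (lebesgue_on U)) \<and>
     (AE w in lebesgue_on U. transpose (A w) = A w \<and> det (A w) = 1) \<and>
     (\<exists>K\<ge>1. AE w in lebesgue_on U. \<forall>\<xi> :: real ^ 2.
        (1 / K) * (norm \<xi>)\<^sup>2 \<le> (A w *v \<xi>) \<bullet> \<xi> \<and> (A w *v \<xi>) \<bullet> \<xi> \<le> K * (norm \<xi>)\<^sup>2)}"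

definition weak_jacobian :: "complex set \<Rightarrow> (complex \<Rightarrow> complex) \<Rightarrow> complex \<Rightarrow> real" where
  "weak_jacobian U \<phi> w = Re (weak_du U \<phi> w) * Im (weak_dv U \<phi> w)
                  - Re (weak_dv U \<phi> w) * Im (weak_du U \<phi> w)"

text \<open>The operator norm of the differential \<open>D\<phi>(w)\<close>.\<close>

definition differential_norm :: "complex set \<Rightarrow> (complex \<Rightarrow> complex) \<Rightarrow> complex \<Rightarrow> real" where
  "differential_norm U \<phi> w =
     onorm (\<lambda>h :: complex. of_real (Re h) * weak_du U \<phi> w + of_real (Im h) * weak_dv U \<phi> w)"

definition weak_dw :: "complex set \<Rightarrow> (complex \<Rightarrow> complex) \<Rightarrow> complex \<Rightarrow> complex" where
  "weak_dw U \<phi> w = (weak_du U \<phi> w - \<i> * weak_dv U \<phi> w) / 2"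

definition weak_dwbar :: "complex set \<Rightarrow> (complex \<Rightarrow> complex) \<Rightarrow> complex \<Rightarrow> complex" where
  "weak_dwbar U \<phi> w = (weak_du U \<phi> w + \<i> * weak_dv U \<phi> w) / 2"

definition quasiconformal :: "complex set \<Rightarrow> complex set \<Rightarrow> (complex \<Rightarrow> complex) \<Rightarrow> bool" where
  "quasiconformal U V \<phi> \<longleftrightarrow>
     (\<exists>\<psi>. homeomorphism U V \<phi> \<psi>) \<and> \<phi> \<in> W12_loc U \<and>
     (\<exists>K\<ge>1. AE w in lebesgue_on U. (differential_norm U \<phi> w)\<^sup>2 \<le> K * \<bar>weak_jacobian U \<phi> w\<bar>)"

definition beltrami_coefficient :: "(complex \<Rightarrow> real ^ 2 ^ 2) \<Rightarrow> complex \<Rightarrow> complex" where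
  "beltrami_coefficient A w =
     (of_real (A w $ 2 $ 2) - of_real (A w $ 1 $ 1) - 2 * \<i> * of_real (A w $ 1 $ 2))
       / of_real (det (mat 1 + A w))"

definition A_quasiconformal ::
    "(complex \<Rightarrow> real ^ 2 ^ 2) \<Rightarrow> complex set \<Rightarrow> complex set \<Rightarrow> (complex \<Rightarrow> complex) \<Rightarrow> bool" where
  "A_quasiconformal A U V \<phi> \<longleftrightarrow> quasiconformal U V \<phi> \<and>
     (AE w in lebesgue_on U. weak_dwbar U \<phi> w = beltrami_coefficient A w * weak_dw U \<phi> w)"


section \<open>Dirichlet eigenvalues\<close>

text \<open>
  Gradients of complex functions lie in \<open>\<complex>\<^sup>2\<close>.  The product of gradients is the complex bilinear
  one: the conjugation is already carried by the second function in the weak equation.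
\<close>

definition energy ::
    "(complex \<Rightarrow> real ^ 2 ^ 2) \<Rightarrow> complex set \<Rightarrow> (complex \<Rightarrow> complex) \<Rightarrow> (complex \<Rightarrow> complex) \<Rightarrow> complex"
  where
  "energy A U g h = (LINT w|lebesgue_on U. (\<Sum>k\<in>UNIV. \<Sum>l\<in>UNIV.
     of_real (A w $ k $ l) * weak_gradient U g w $ l * weak_gradient U h w $ k))"

definition eigenspace :: "(complex \<Rightarrow> real ^ 2 ^ 2) \<Rightarrow> complex set \<Rightarrow> real \<Rightarrow> (complex \<Rightarrow> complex) set"
  where
  "eigenspace A U t = {g \<in> W12_0 U. \<forall>f \<in> W12_0 U.
     energy A U g (\<lambda>w. cnj (f w)) = of_real t * (LINT w|lebesgue_on U. g w * cnj (f w))}"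

definition independent_ae :: "complex set \<Rightarrow> nat \<Rightarrow> (nat \<Rightarrow> complex \<Rightarrow> complex) \<Rightarrow> bool" where
  "independent_ae U m g \<longleftrightarrow>
     (\<forall>c :: nat \<Rightarrow> complex. (AE w in lebesgue_on U. (\<Sum>i<m. c i * g i w) = 0) \<longrightarrow> (\<forall>i<m. c i = 0))"

text \<open>
  The complex dimension of the eigenspace modulo functions vanishing almost everywhere;
  it is \<open>0\<close> if \<open>t\<close> is not an eigenvalue.
\<close>

definition eigenvalue_mult :: "(complex \<Rightarrow> real ^ 2 ^ 2) \<Rightarrow> complex set \<Rightarrow> real \<Rightarrow> enat" where
  "eigenvalue_mult A U t =
     Sup {enat m |m. \<exists>g. (\<forall>i<m. g i \<in> eigenspace A U t) \<and> independent_ae U m g}"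

text \<open>
  \<open>s 0, s 1, \<dots>\<close> lists the positive eigenvalues in nondecreasing order, each real \<open>t\<close> occurring
  exactly as often as its multiplicity says.
\<close>

definition eigenvalue_sequence ::
    "(complex \<Rightarrow> real ^ 2 ^ 2) \<Rightarrow> complex set \<Rightarrow> (nat \<Rightarrow> real) \<Rightarrow> bool" where
  "eigenvalue_sequence A U s \<longleftrightarrow> (\<forall>j. 0 < s j) \<and> mono s \<and>
     (\<forall>t. finite {j. s j = t} \<and> eigenvalue_mult A U t = enat (card {j. s j = t}))"

text \<open>Eigenvalues are numbered from \<open>n = 1\<close>.\<close>

definition dirichlet_eigenvalue :: "(complex \<Rightarrow> real ^ 2 ^ 2) \<Rightarrow> complex set \<Rightarrow> nat \<Rightarrow> real" where
  "dirichlet_eigenvalue A U n = (THE s. eigenvalue_sequence A U s) (n - 1)"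

definition laplace_eigenvalue :: "complex set \<Rightarrow> nat \<Rightarrow> real" where
  "laplace_eigenvalue U n = dirichlet_eigenvalue (\<lambda>w. mat 1) U n"

lemma eigenvalue_sequence_le:
  assumes s: "eigenvalue_sequence A U s" and t: "eigenvalue_sequence A U t"
    and eq: "\<And>m. m < n \<Longrightarrow> s m = t m"
  shows "t n \<le> s n"
proof (rule ccontr)
  assume "\<not> t n \<le> s n"
  then have less: "s n < t n" by simp
  have sub: "{j. t j = s n} \<subseteq> {j. s j = s n}"
  proof
    fix j assume "j \<in> {j. t j = s n}"
    then have j: "t j = s n" by simp
    have "j < n"
    proof (rule ccontr)
      assume "\<not> j < n"
      then have "t n \<le> t j"
        using t by (auto simp: eigenvalue_sequence_def intro: monoD)
      with j less show False by simp
    qed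
    with eq j show "j \<in> {j. s j = s n}" by simp
  qed
  have "n \<in> {j. s j = s n} - {j. t j = s n}" using less by simp
  with sub have "{j. t j = s n} \<subset> {j. s j = s n}" by blast
  moreover have "finite {j. s j = s n}" using s by (simp add: eigenvalue_sequence_def)
  ultimately have "card {j. t j = s n} < card {j. s j = s n}"
    by (rule psubset_card_mono[rotated])
  moreover have "enat (card {j. t j = s n}) = enat (card {j. s j = s n})"
    using s t unfolding eigenvalue_sequence_def by metis
  ultimately show False by simp
qed

lemma eigenvalue_sequence_unique:
  assumes "eigenvalue_sequence A U s" "eigenvalue_sequence A U t"
  shows "s = t"
proof
  fix n show "s n = t n"
  proof (induction n rule: less_induct)
    case (less n)
    then show ?case
      using eigenvalue_sequence_le[OF assms, of n] eigenvalue_sequence_le[OF assms(2,1), of n]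
      by (metis order_antisym)
  qed
qed

lemma dirichlet_eigenvalue_eq:
  assumes "eigenvalue_sequence A U s"
  shows "dirichlet_eigenvalue A U n = s (n - 1)"
  unfolding dirichlet_eigenvalue_def
  using assms eigenvalue_sequence_unique by (metis the_equality)

end

theory Submission
  imports Defs
begin

text \<open>
  The Dirichlet eigenvalues depend only on the multiplicities of the reals as eigenvalues, so it
  suffices that \<open>g \<mapsto> g \<circ> \<phi>\<close> maps the eigenspaces for \<open>\<Omega>\<close> onto those for \<open>\<Omega>'\<close>.
  The Beltrami equation and \<open>|J| = 1\<close> give \<open>J = 1\<close> and \<open>D\<phi> A D\<phi>\<^sup>T = I\<close> almost everywhere, and
  quasiconformality makes \<open>D\<phi>\<close> bounded.  Since Jacobians are null Lagrangians,
  \<open>\<integral> (\<nabla>\<zeta>)(\<phi>) = \<integral> (\<nabla>\<zeta>)(\<phi>) J = 0\<close> for every test function \<open>\<zeta>\<close> on \<open>\<Omega>\<close>: the image of Lebesgue measure under \<open>\<phi>\<close> has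
  vanishing distributional gradient, hence is a constant \<open>c > 0\<close> times Lebesgue measure.  The same integration by
  parts shows that \<open>\<eta> \<circ> \<phi>\<^sup>-\<^sup>1\<close> has bounded weak derivatives, given by the adjugate of \<open>D\<phi>\<close>.
  Composition therefore maps \<open>W\<^sub>0\<close> onto \<open>W\<^sub>0\<close>, and it multiplies both sides of the weak equation by \<open>c\<close>.
\<close>

section \<open>Smooth bump functions\<close>

text \<open>The map is only a continuous Sobolev homeomorphism, so neither a change of variables for
  \<phi> nor weak differentiability of its inverse \<psi> is given. Both are extracted from one
  identity. With \<phi> = p + i q, d(\<zeta> \<circ> \<phi>) \<and> dq = (d_1 \<zeta>)(\<phi>) dp
  \<and> dq, where dp \<and> dq has density J = 1. The left side is exact, so when it is paired with
  a test function \<eta> the derivative falls on \<eta>. If \<eta> is 1 near the support of \<zeta>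
  \<circ> \<phi>, the outcome is 0 and determines the image measure; if \<eta> is arbitrary, the
  outcome is the weak derivative of \<eta> \<circ> \<psi>. The sign in J = 1 comes from ellipticity.
  With D the matrix of the differential, the Beltrami equation amounts to the linear system A D^T =
  adj D. Hence D A D^T = J I, and positivity of A forces J \<ge> 0. The bound |D|^2 \<le> K |J| = K
  gives \<zeta> \<circ> \<phi> a bounded weak gradient. Mollified derivatives converge in L1 only,
  and a bounded factor is what lets their products pass to the limit.\<close>

abbreviation fderiv :: "('a::real_normed_vector \<Rightarrow> 'b::real_normed_vector) \<Rightarrow> 'a \<Rightarrow> 'a \<Rightarrow> 'b" where
  "fderiv f w \<equiv> frechet_derivative f (at w)"

section \<open>Closure properties of the classes \<open>Ck\<close>\<close>

lemma Ck_Suc_imp: "Ck (Suc k) f \<Longrightarrow> Ck k f"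
proof (induction k arbitrary: f)
  case 0
  then show ?case
    by (auto simp: continuous_on_eq_continuous_at intro: differentiable_imp_continuous_within)
next
  case (Suc k)
  then show ?case by auto
qed

lemma Ck_differentiable: "Ck (Suc k) f \<Longrightarrow> (f has_derivative fderiv f w) (at w)"
  by (simp add: frechet_derivative_works[symmetric])

text \<open>Lets an induction on the order run with an explicit derivative in place of the chosen
  \<open>frechet_derivative\<close>.\<close>

lemma Ck_SucI:
  assumes "\<And>w. (f has_derivative f' w) (at w)" "\<And>e. Ck k (\<lambda>w. f' w e)"
  shows "Ck (Suc k) f"
proof -
  have "fderiv f w = f' w" for w
    using frechet_derivative_at[OF assms(1)] by simp
  then show ?thesis using assms by (auto simp: differentiable_def)
qed

lemma Ck_const [simp]: "Ck k (\<lambda>w. c)"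
  by (induction k arbitrary: c) simp_all

lemma Ck_add: "Ck k f \<Longrightarrow> Ck k g \<Longrightarrow> Ck k (\<lambda>w. f w + g w)"
proof (induction k arbitrary: f g)
  case 0
  then show ?case by (auto intro: continuous_intros)
next
  case (Suc k)
  show ?case
    by (rule Ck_SucI[OF has_derivative_add[OF Suc.prems[THEN Ck_differentiable]]])
      (use Suc in auto)
qed

lemma Ck_mult: "Ck k f \<Longrightarrow> Ck k g \<Longrightarrow> Ck k (\<lambda>w. f w * g w)"
proof (induction k arbitrary: f g)
  case 0
  then show ?case by (auto intro: continuous_intros)
next
  case (Suc k)
  show ?case
    by (rule Ck_SucI[OF has_derivative_mult[OF Suc.prems[THEN Ck_differentiable]]])
      (use Suc Ck_Suc_imp in \<open>auto intro!: Ck_add Suc.IH\<close>)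
qed

lemma Ck_bounded_linear_compose: "bounded_linear L \<Longrightarrow> Ck k f \<Longrightarrow> Ck k (\<lambda>w. L (f w))"
proof (induction k arbitrary: f)
  case 0
  then show ?case by (auto intro: bounded_linear.continuous_on)
next
  case (Suc k)
  show ?case
    by (rule Ck_SucI[OF bounded_linear.has_derivative[OF Suc.prems(1) Ck_differentiable[OF Suc.prems(2)]]])
      (use Suc in auto)
qed

lemma Ck_affine_compose: "Ck k f \<Longrightarrow> Ck k (\<lambda>w. f (a *\<^sub>R w + b))"
proof (induction k arbitrary: f)
  case 0
  then have "continuous_on UNIV f" by simp
  then have "continuous_on UNIV (\<lambda>w. f (a *\<^sub>R w + b))"
    by (rule continuous_on_compose2) (auto intro!: continuous_intros)
  then show ?case by simp
next
  case (Suc k)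
  have d: "((\<lambda>w. f (a *\<^sub>R w + b)) has_derivative (\<lambda>e. fderiv f (a *\<^sub>R w + b) (a *\<^sub>R e))) (at w)" for w
  proof -
    have "((\<lambda>w. a *\<^sub>R w + b) has_derivative (\<lambda>e. a *\<^sub>R e)) (at w)"
      by (auto intro!: derivative_eq_intros)
    from has_derivative_compose[OF this Ck_differentiable[OF Suc.prems]] show ?thesis .
  qed
  show ?case by (rule Ck_SucI[OF d]) (use Suc in auto)
qed

lemma Ck_minus: "Ck k f \<Longrightarrow> Ck k (\<lambda>w. - f w)"
  using Ck_mult[of k "\<lambda>_. -1" f] by simp

lemma Ck_diff: "Ck k f \<Longrightarrow> Ck k g \<Longrightarrow> Ck k (\<lambda>w. f w - g w)"
  using Ck_add[OF _ Ck_minus, of k f g] by simp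

lemma Ck_linear: "bounded_linear L \<Longrightarrow> Ck k L"
proof (cases k)
  case 0
  assume "bounded_linear L" then show ?thesis using 0 by (auto intro: linear_continuous_on)
next
  case (Suc m)
  assume L: "bounded_linear L"
  show ?thesis unfolding Suc
    by (rule Ck_SucI[OF bounded_linear_imp_has_derivative[OF L]]) simp
qed

section \<open>An exponentially flat function and the radial bump built from it\<close>

definition flat_exp :: "nat \<Rightarrow> real \<Rightarrow> real" where
  "flat_exp k x = (if x > 0 then exp (- (1 / x)) / x ^ k else 0)"

lemma power_le_fact_exp:
  fixes x :: real
  assumes "0 \<le> x"
  shows "x ^ n \<le> fact n * exp x"
proof -
  have "(\<Sum>m\<in>{n}. x ^ m /\<^sub>R fact m) \<le> (\<Sum>m. x ^ m /\<^sub>R fact m)"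
    by (rule sum_le_suminf[OF summable_exp_generic]) (use assms in auto)
  then have "x ^ n / fact n \<le> exp x" by (simp add: exp_def divide_inverse mult.commute)
  then show ?thesis by (simp add: field_simps)
qed

text \<open>One term of the exponential series at \<open>1 / x\<close>, of order
  \<open>k + 2\<close>: the first \<open>k\<close> powers absorb the denominator, and the two left
  over give the square. This is the flatness at 0 that makes the derivative there vanish.\<close>

lemma flat_exp_le: "\<bar>flat_exp k x\<bar> \<le> fact (k + 2) * x\<^sup>2"
proof (cases "x > 0")
  case True
  have "(1 / x) ^ (k + 2) \<le> fact (k + 2) * exp (1 / x)"
    using True by (intro power_le_fact_exp) auto
  then show ?thesis using True
    by (simp add: flat_exp_def exp_minus divide_simps power_add power2_eq_square mult_ac del: fact_Suc)
qed (simp add: flat_exp_def)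

text \<open>The denominators \<open>x ^ k\<close> are built into \<open>flat_exp\<close> so that the
  family is closed under differentiation: member \<open>k\<close> is sent to a combination of
  members \<open>k + 1\<close> and \<open>k + 2\<close>. Smoothness of all orders then needs only
  one induction, with \<open>k\<close> arbitrary.\<close>

lemma flat_exp_derivative:
  "(flat_exp k has_real_derivative flat_exp (k + 2) x - real k * flat_exp (k + 1) x) (at x)"
proof (cases "x = 0")
  case True
  \<comment> \<open>At the gluing point the difference quotient is at most a constant times |h|, by
    the quadratic bound.\<close>
  have "((\<lambda>h. (flat_exp k (0 + h) - flat_exp k 0) / h) \<longlongrightarrow> 0) (at 0)"
  proof (rule Lim_null_comparison)
    show "\<forall>\<^sub>F h in at 0. norm ((flat_exp k (0 + h) - flat_exp k 0) / h) \<le> fact (k + 2) * \<bar>h\<bar>"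
    proof (intro always_eventually allI)
      fix h
      show "norm ((flat_exp k (0 + h) - flat_exp k 0) / h) \<le> fact (k + 2) * \<bar>h\<bar>"
        using flat_exp_le[of k h]
        by (cases "h = 0") (auto simp: flat_exp_def[of k 0] divide_simps power2_eq_square abs_mult_self_eq mult.assoc)
    qed
    show "((\<lambda>h. fact (k + 2) * \<bar>h\<bar>) \<longlongrightarrow> 0) (at (0::real))"
      by (auto intro!: tendsto_eq_intros)
  qed
  then show ?thesis using True by (simp add: DERIV_def flat_exp_def)
next
  case False
  show ?thesis
  proof (cases "x > 0")
    case True
    have "((\<lambda>x. exp (- (1 / x)) / x ^ k) has_real_derivative flat_exp (k + 2) x - real k * flat_exp (k + 1) x) (at x)"
      using True
      apply (auto intro!: derivative_eq_intros simp: flat_exp_def)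
      apply (cases k)
       apply (auto simp: field_simps power2_eq_square)
      done
    then show ?thesis
      by (rule has_field_derivative_transform_within_open[where S = "{0<..}"])
        (use True in \<open>auto simp: flat_exp_def\<close>)
  next
    case False
    then have "x < 0" using \<open>x \<noteq> 0\<close> by simp
    have "((\<lambda>_. 0) has_real_derivative flat_exp (k + 2) x - real k * flat_exp (k + 1) x) (at x)"
      using \<open>x < 0\<close> by (simp add: flat_exp_def)
    then show ?thesis
      by (rule has_field_derivative_transform_within_open[where S = "{..<0}"])
        (use \<open>x < 0\<close> in \<open>auto simp: flat_exp_def\<close>)
  qed
qed

text \<open>The argument is \<open>w \<bullet> w\<close> rather than the norm, so that the inner
  function is a polynomial and smooth at the origin as well.\<close>

definition bump :: "complex \<Rightarrow> real" where
  "bump w = flat_exp 0 (1 - w \<bullet> w)"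

lemma Ck_flat_exp: "Ck n (\<lambda>w. of_real (flat_exp k (1 - w \<bullet> w)))"
proof (induction n arbitrary: k)
  case 0
  have "continuous_on UNIV (flat_exp k)"
    using flat_exp_derivative DERIV_isCont by (metis continuous_at_imp_continuous_on)
  then have "continuous_on UNIV (\<lambda>w::complex. flat_exp k (1 - w \<bullet> w))"
    by (rule continuous_on_compose2) (auto intro!: continuous_intros)
  then show ?case by (auto intro: continuous_intros)
next
  case (Suc n)
  let ?d = "\<lambda>x. flat_exp (k + 2) x - real k * flat_exp (k + 1) x"
  have d: "((\<lambda>w::complex. complex_of_real (flat_exp k (1 - w \<bullet> w))) has_derivative
      (\<lambda>e. of_real (?d (1 - w \<bullet> w) * (- 2 * (w \<bullet> e))))) (at w)" for w
  proof -
    have "((\<lambda>w::complex. 1 - w \<bullet> w) has_derivative (\<lambda>e. - 2 * (w \<bullet> e))) (at w)"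
      by (auto intro!: derivative_eq_intros simp: inner_commute)
    from has_derivative_compose[OF this flat_exp_derivative[unfolded has_field_derivative_def]]
    have "((\<lambda>w::complex. flat_exp k (1 - w \<bullet> w)) has_derivative (\<lambda>e. ?d (1 - w \<bullet> w) * (- 2 * (w \<bullet> e)))) (at w)" .
    then show ?thesis by (rule has_derivative_of_real)
  qed
  show ?case
  proof (rule Ck_SucI[OF d])
    fix e
    have *: "Ck n (\<lambda>w. complex_of_real (- 2 * (w \<bullet> e)))"
      by (intro Ck_linear bounded_linear_compose[OF bounded_linear_of_real]
          bounded_linear_const_mult bounded_linear_inner_left)
    have "Ck n (\<lambda>w. (of_real (flat_exp (k + 2) (1 - w \<bullet> w)) - of_real k * of_real (flat_exp (k + 1) (1 - w \<bullet> w)))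
       * of_real (- 2 * (w \<bullet> e)))"
      by (intro Ck_mult Ck_diff Suc Ck_const *)
    then show "Ck n (\<lambda>w. complex_of_real (?d (1 - w \<bullet> w) * (- 2 * (w \<bullet> e))))" by simp
  qed
qed

lemma Ck_bump: "Ck n (\<lambda>w. of_real (bump w))"
  unfolding bump_def by (rule Ck_flat_exp)

lemma bump_nonneg: "0 \<le> bump w"
  by (simp add: bump_def flat_exp_def)

lemma bump_pos_iff: "0 < bump w \<longleftrightarrow> norm w < 1"
  by (simp add: bump_def flat_exp_def dot_square_norm power_less_one_iff abs_square_less_1)

lemma bump_eq_0: "1 \<le> norm w \<Longrightarrow> bump w = 0"
  using bump_nonneg[of w] bump_pos_iff[of w] by simp

lemma bump_minus: "bump (- w) = bump w"
  by (simp add: bump_def)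

section \<open>Convolution with a smooth kernel\<close>

lemma integrable_continuous_compact_support:
  fixes f :: "complex \<Rightarrow> 'b::{banach, second_countable_topology}"
  assumes "continuous_on UNIV f" "compact K" "\<And>w. w \<notin> K \<Longrightarrow> f w = 0"
  shows "integrable lborel f" "integrable lebesgue f"
proof -
  have "integrable lborel (\<lambda>x. indicator K x *\<^sub>R f x)"
    using assms by (intro borel_integrable_compact) (auto intro: continuous_on_subset)
  moreover have "(\<lambda>x. indicator K x *\<^sub>R f x) = f"
    using assms(3) by (auto simp: indicator_def)
  ultimately show "integrable lborel f" by simp
  then show "integrable lebesgue f"
    using integrable_completion[of f lborel] by auto
qed

text \<open>Bridge between two integrals: differentiation under the integral sign is available for
  the gauge integral over a box, whereas weak derivatives are stated with the Bochner integral over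
  \<open>lebesgue\<close>.\<close>

lemma integral_continuous_cbox_support:
  fixes f :: "complex \<Rightarrow> complex"
  assumes "continuous_on UNIV f" "\<And>w. w \<notin> cbox a b \<Longrightarrow> f w = 0"
  shows "(LINT w|lebesgue. f w) = integral (cbox a b) f"
proof -
  have "integrable lebesgue f"
    using integrable_continuous_compact_support[OF assms(1) compact_cbox assms(2)] by blast
  then have "(LINT w|lebesgue. f w) = integral UNIV f"
    by (rule integral_lebesgue[symmetric])
  also have "\<dots> = integral UNIV (\<lambda>w. if w \<in> cbox a b then f w else 0)"
    using assms(2) by (intro arg_cong[where f = "integral UNIV"]) auto
  also have "\<dots> = integral (cbox a b) f" by (rule Henstock_Kurzweil_Integration.integral_restrict_UNIV)
  finally show ?thesis .
qed

section \<open>The mollifier of radius \<delta> and mass one\<close>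

definition kern :: "real \<Rightarrow> complex \<Rightarrow> real" where
  "kern \<delta> w = bump (w /\<^sub>R \<delta>) / (LINT z|lborel. bump (z /\<^sub>R \<delta>))"

lemma continuous_bump: "continuous_on UNIV bump"
  using Ck_bump[of 0] continuous_on_Re[of UNIV "\<lambda>w. complex_of_real (bump w)"] by simp

lemma continuous_bump_scale: "continuous_on UNIV (\<lambda>w. bump (w /\<^sub>R \<delta>))"
  by (rule continuous_on_compose2[OF continuous_bump]) (auto intro!: continuous_intros)

lemma bump_scale_eq_0: "0 < \<delta> \<Longrightarrow> \<delta> \<le> norm w \<Longrightarrow> bump (w /\<^sub>R \<delta>) = 0"
  by (rule bump_eq_0) (simp add: field_simps)

lemma integrable_bump_scale: "0 < \<delta> \<Longrightarrow> integrable lborel (\<lambda>w. bump (w /\<^sub>R \<delta>))"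
  by (rule integrable_continuous_compact_support[OF continuous_bump_scale compact_cball[of 0 \<delta>]])
    (auto intro: bump_scale_eq_0)

lemma integral_bump_pos:
  assumes "0 < \<delta>"
  shows "0 < (LINT z|lborel. bump (z /\<^sub>R \<delta>))"
proof -
  have "0 \<le> (LINT z|lborel. bump (z /\<^sub>R \<delta>))"
    by (simp add: bump_nonneg)
  moreover have "(LINT z|lborel. bump (z /\<^sub>R \<delta>)) \<noteq> 0"
  proof
    assume "(LINT z|lborel. bump (z /\<^sub>R \<delta>)) = 0"
    then have "AE z in lborel. bump (z /\<^sub>R \<delta>) = 0"
      using integral_nonneg_eq_0_iff_AE[OF integrable_bump_scale[OF assms]] by (simp add: bump_nonneg)
    then have "AE z in lborel. z \<notin> ball (0::complex) \<delta>"
    proof eventually_elim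
      case (elim z)
      then show ?case using assms bump_pos_iff[of "z /\<^sub>R \<delta>"] by (auto simp: field_simps)
    qed
    then have "emeasure lborel (ball (0::complex) \<delta>) = 0"
      by (subst (asm) AE_iff_measurable[OF _ refl]) (auto simp: ball_def dist_norm)
    moreover have "emeasure lborel (ball (0::complex) \<delta>) \<noteq> 0"
      using emeasure_lborel_ball_finite assms open_not_negligible[of "ball (0::complex) \<delta>"]
      by (auto simp: negligible_iff_emeasure0 )
    ultimately show False by simp
  qed
  ultimately show ?thesis by simp
qed

lemma kern_nonneg: "0 < \<delta> \<Longrightarrow> 0 \<le> kern \<delta> w"
  using integral_bump_pos[of \<delta>] by (simp add: kern_def bump_nonneg)

lemma kern_eq_0: "0 < \<delta> \<Longrightarrow> \<delta> \<le> norm w \<Longrightarrow> kern \<delta> w = 0"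
  by (simp add: kern_def bump_scale_eq_0)

lemma continuous_kern: "continuous_on UNIV (kern \<delta>)"
  unfolding kern_def[abs_def] divide_inverse
  by (intro continuous_intros continuous_bump_scale)

lemma borel_measurable_kern [measurable]: "kern \<delta> \<in> borel_measurable borel"
  by (rule borel_measurable_continuous_onI[OF continuous_kern])

lemma kern_minus: "kern \<delta> (- w) = kern \<delta> w"
  by (simp add: kern_def bump_minus)

lemma Ck_kern: "Ck n (\<lambda>w. of_real (kern \<delta> w))"
proof -
  have "Ck n (\<lambda>w. of_real (bump (inverse \<delta> *\<^sub>R w + 0)) * of_real (inverse (LINT z|lborel. bump (z /\<^sub>R \<delta>))))"
    by (intro Ck_mult Ck_const Ck_affine_compose[where f = "\<lambda>w. of_real (bump w)"] Ck_bump)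
  then show ?thesis by (simp add: kern_def divide_inverse)
qed

lemma Ck_kern_shift: "Ck n (\<lambda>z. of_real (kern \<delta> (w - z)))"
  using Ck_affine_compose[OF Ck_kern[of n \<delta>], of "-1" w] by simp

lemma integrable_kern: "0 < \<delta> \<Longrightarrow> integrable lborel (kern \<delta>)"
  using integrable_bump_scale[of \<delta>] by (simp add: kern_def[abs_def])

lemma integral_kern: "0 < \<delta> \<Longrightarrow> (LINT w|lborel. kern \<delta> w) = 1"
  using integral_bump_pos[of \<delta>] by (simp add: kern_def[abs_def])

lemma lborel_integral_reflect_shift:
  fixes f :: "complex \<Rightarrow> 'b::{banach, second_countable_topology}"
  assumes [measurable]: "f \<in> borel_measurable borel"
  shows "(LINT z|lborel. f (w - z)) = (LINT z|lborel. f z)"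
    and "integrable lborel (\<lambda>z. f (w - z)) \<longleftrightarrow> integrable lborel f"
proof -
  have *: "distr lborel borel (\<lambda>z. w - z) = (lborel :: complex measure)"
    by (subst (2) lborel_affine[of "-1" w]) (auto simp: density_1)
  show "(LINT z|lborel. f (w - z)) = (LINT z|lborel. f z)"
    by (subst (2) *[symmetric]) (simp add: integral_distr)
  show "integrable lborel (\<lambda>z. f (w - z)) \<longleftrightarrow> integrable lborel f"
    by (subst (2) *[symmetric]) (simp add: integrable_distr_eq)
qed

text \<open>The translation sits on the second factor, so every derivative falls on the smooth
  kernel. The integral is taken over the completed measure, since \<open>f\<close> may be only
  Lebesgue measurable.\<close>

definition conv :: "(complex \<Rightarrow> complex) \<Rightarrow> (complex \<Rightarrow> complex) \<Rightarrow> complex \<Rightarrow> complex" where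
  "conv f \<rho> w = (LINT z|lebesgue. f z * \<rho> (w - z))"

lemma conv_eq_cbox:
  assumes "continuous_on UNIV f" "continuous_on UNIV \<rho>" "\<And>w. w \<notin> cbox a b \<Longrightarrow> f w = 0"
  shows "conv f \<rho> w = integral (cbox a b) (\<lambda>z. f z * \<rho> (w - z))"
  unfolding conv_def
  by (rule integral_continuous_cbox_support)
    (use assms in \<open>auto intro!: continuous_intros continuous_on_compose2[OF assms(2)]\<close>)

text \<open>The Leibniz rule on a box containing the support of \<open>f\<close>; the integrand is
  continuously differentiable in the parameter because \<open>\<rho>\<close> is.\<close>

lemma conv_has_derivative:
  assumes f: "continuous_on UNIV f" "compact K" "\<And>w. w \<notin> K \<Longrightarrow> f w = 0"
    and \<rho>: "Ck 1 \<rho>"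
  shows "(conv f \<rho> has_derivative (\<lambda>e. conv f (\<lambda>w. fderiv \<rho> w e) w)) (at w)"
proof -
  obtain a b where ab: "K \<subseteq> cbox a b"
    using bounded_subset_cbox_symmetric[OF compact_imp_bounded[OF f(2)]] by blast
  have f0: "w \<notin> cbox a b \<Longrightarrow> f w = 0" for w using ab f(3) by auto
  have \<rho>d: "(\<rho> has_derivative fderiv \<rho> w) (at w)" for w
    using \<rho> Ck_differentiable[of 0] by simp
  have \<rho>c: "continuous_on UNIV \<rho>" using \<rho> Ck_Suc_imp[of 0] by simp
  have \<rho>'c: "continuous_on UNIV (\<lambda>w. fderiv \<rho> w e)" for e
    using \<rho> by simp
  \<comment> \<open>The Leibniz rule asks for the derivative as a continuous map into the bounded
    linear functions; continuity is then tested direction by direction.\<close>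
  define D where "D x t = Blinfun (\<lambda>e. f t * fderiv \<rho> (x - t) e)" for x t
  have D: "blinfun_apply (D x t) = (\<lambda>e. f t * fderiv \<rho> (x - t) e)" for x t
    unfolding D_def
    by (rule bounded_linear_Blinfun_apply) (intro bounded_linear_const_mult has_derivative_bounded_linear[OF \<rho>d])
  have deriv: "((\<lambda>x. integral (cbox a b) (\<lambda>t. f t * \<rho> (x - t))) has_derivative integral (cbox a b) (D w)) (at w within UNIV)"
  proof (rule leibniz_rule[where fx = D])
    show "((\<lambda>x. f t * \<rho> (x - t)) has_derivative blinfun_apply (D x t)) (at x within UNIV)" for x t
      unfolding D
      by (rule has_derivative_mult_right, rule has_derivative_eq_rhs, rule has_derivative_compose[OF _ \<rho>d])
        (auto intro!: derivative_eq_intros)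
    show "(\<lambda>t. f t * \<rho> (x - t)) integrable_on cbox a b" for x
      by (intro integrable_continuous continuous_intros continuous_on_compose2[OF \<rho>c] continuous_on_subset[OF f(1)]) auto
    show "continuous_on (UNIV \<times> cbox a b) (\<lambda>(x, t). D x t)"
      unfolding split_beta
      by (rule continuous_on_blinfun_componentwise, unfold D)
        (intro continuous_intros continuous_on_compose2[OF \<rho>'c] continuous_on_compose2[OF f(1)]; auto)
  qed auto
  moreover have "integral (cbox a b) (D w) e = integral (cbox a b) (\<lambda>t. D w t e)" for e
  proof (rule blinfun_apply_integral)
    have "continuous_on (cbox a b) (D w)"
      by (rule continuous_on_blinfun_componentwise, unfold D)
        (intro continuous_intros continuous_on_compose2[OF \<rho>'c] continuous_on_compose2[OF f(1)]; auto)
    then show "D w integrable_on cbox a b" by (rule integrable_continuous)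
  qed
  moreover have fs: "conv f \<rho> = (\<lambda>x. integral (cbox a b) (\<lambda>t. f t * \<rho> (x - t)))"
    by (rule ext) (rule conv_eq_cbox[OF f(1) \<rho>c f0])
  moreover have "conv f (\<lambda>w. fderiv \<rho> w e) w
      = integral (cbox a b) (\<lambda>t. f t * fderiv \<rho> (w - t) e)" for e
    by (rule conv_eq_cbox[OF f(1) \<rho>'c f0])
  ultimately have "blinfun_apply (integral (cbox a b) (D w)) = (\<lambda>e. conv f (\<lambda>w. fderiv \<rho> w e) w)"
    and "((conv f \<rho>) has_derivative blinfun_apply (integral (cbox a b) (D w))) (at w)"
    by (simp add: D fun_eq_iff, unfold fs) (rule deriv)
  then show ?thesis by simp
qed

lemma Ck_conv:
  assumes f: "continuous_on UNIV f" "compact K" "\<And>w. w \<notin> K \<Longrightarrow> f w = 0"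
  shows "Ck n \<rho> \<Longrightarrow> Ck n (conv f \<rho>)"
proof (induction n arbitrary: \<rho>)
  case 0
  obtain a b where ab: "K \<subseteq> cbox a b"
    using bounded_subset_cbox_symmetric[OF compact_imp_bounded[OF f(2)]] by blast
  have f0: "w \<notin> cbox a b \<Longrightarrow> f w = 0" for w using ab f(3) by auto
  have c: "continuous_on UNIV \<rho>" using 0 by simp
  have "continuous_on UNIV (\<lambda>w. integral (cbox a b) (\<lambda>z. f z * \<rho> (w - z)))"
    by (rule integral_continuous_on_param)
      (unfold split_beta, intro continuous_intros continuous_on_compose2[OF c] continuous_on_compose2[OF f(1)]; auto)
  then show ?case by (simp add: conv_eq_cbox[OF f(1) c f0])
next
  case (Suc n)
  have "Ck 1 \<rho>" using Suc.prems by (induction n) (use Ck_Suc_imp in auto)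
  from conv_has_derivative[OF f this] show ?case
    by (rule Ck_SucI) (use Suc in auto)
qed

text \<open>The integral of \<open>F\<close> is invariant under translation by
  \<open>t *\<^sub>R e\<close>, so it is constant in \<open>t\<close>; its derivative at
  \<open>t = 0\<close> is the integral of \<open>F' w e\<close>. All later integrations by parts
  rest on this.\<close>

lemma integral_derivative_compact_support:
  fixes F :: "complex \<Rightarrow> complex"
  assumes d: "\<And>w. (F has_derivative F' w) (at w)" and c: "continuous_on UNIV (\<lambda>w. F' w e)"
    and K: "compact K" "\<And>w. w \<notin> K \<Longrightarrow> F w = 0"
  shows "(LINT w|lebesgue. F' w e) = 0"
proof -
  have cF: "continuous_on UNIV F"
    using d has_derivative_continuous continuous_at_imp_continuous_on by blast
  \<comment> \<open>The set swept out by the support under translations with |t| \<le> 1: one box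
    around it serves for all these translates at once.\<close>
  define K' where "K' = {x - t *\<^sub>R e | x t. x \<in> K \<and> t \<in> {-1..1::real}}"
  have "compact ((\<lambda>(x, t). x - t *\<^sub>R e) ` (K \<times> {-1..1::real}))"
    by (intro compact_continuous_image compact_Times K) (auto intro!: continuous_intros simp: split_beta)
  moreover have "K' = (\<lambda>(x, t). x - t *\<^sub>R e) ` (K \<times> {-1..1::real})"
    by (force simp: K'_def)
  ultimately have "bounded K'" by (simp add: compact_imp_bounded)
  then obtain a b where ab: "K' \<subseteq> cbox a b"
    using bounded_subset_cbox_symmetric by blast
  have out: "F (w + t *\<^sub>R e) = 0" if "w \<notin> cbox a b" "t \<in> {-1..1}" for w t
  proof (rule K(2), rule)
    assume "w + t *\<^sub>R e \<in> K"
    then have "(w + t *\<^sub>R e) - t *\<^sub>R e \<in> K'" unfolding K'_def using that by blast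
    then show False using that ab by auto
  qed
  let ?G = "\<lambda>t. integral (cbox a b) (\<lambda>w. F (w + t *\<^sub>R e))"
  have "(?G has_vector_derivative integral (cbox a b) (\<lambda>w. F' (w + 0 *\<^sub>R e) e)) (at 0 within {-1..1})"
  proof (rule leibniz_rule_vector_derivative)
    show "((\<lambda>x. F (t + x *\<^sub>R e)) has_vector_derivative F' (t + x *\<^sub>R e) e) (at x within {-1..1})" for x t
    proof -
      have "((\<lambda>x. t + x *\<^sub>R e) has_derivative (\<lambda>h. h *\<^sub>R e)) (at x within {-1..1})"
        by (auto intro!: derivative_eq_intros)
      from has_derivative_compose[OF this d]
      show ?thesis
        unfolding has_vector_derivative_def
        by (rule has_derivative_eq_rhs)
          (simp add: linear_cmul has_derivative_linear[OF d])
    qed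
    show "(\<lambda>w. F (w + x *\<^sub>R e)) integrable_on cbox a b" for x
      by (intro integrable_continuous continuous_intros continuous_on_compose2[OF cF]) auto
    show "continuous_on ({-1..1} \<times> cbox a b) (\<lambda>(x, t). F' (t + x *\<^sub>R e) e)"
      unfolding split_beta
      by (intro continuous_intros continuous_on_compose2[OF c]) auto
  qed auto
  moreover have "?G t = (LINT w|lborel. F w)" if t: "t \<in> {-1..1}" for t
  proof -
    have "?G t = (LINT w|lebesgue. F (w + t *\<^sub>R e))"
      by (rule integral_continuous_cbox_support[symmetric])
        (auto intro!: continuous_intros continuous_on_compose2[OF cF] out[OF _ t])
    also have "\<dots> = (LINT w|lborel. F (w + t *\<^sub>R e))"
      by (rule integral_completion)
        (auto intro!: borel_measurable_continuous_onI continuous_intros continuous_on_compose2[OF cF])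
    also have "\<dots> = (LINT w|lborel. F w)"
      by (subst (2) lborel_distr_plus[of "t *\<^sub>R e", symmetric], subst integral_distr)
        (auto simp: add.commute intro!: borel_measurable_continuous_onI cF)
    finally show ?thesis .
  qed
  then have "(?G has_vector_derivative 0) (at 0 within {-1..1})"
    by (intro has_vector_derivative_transform[OF _ _ has_vector_derivative_const]) auto
  ultimately have "integral (cbox a b) (\<lambda>w. F' w e) = 0"
    using vector_derivative_unique_within[of 0 "{-1..1}"] by (force simp: trivial_limit_within)
  moreover have "(LINT w|lebesgue. F' w e) = integral (cbox a b) (\<lambda>w. F' w e)"
  proof (rule integral_continuous_cbox_support[OF c])
    fix w assume w: "w \<notin> cbox a b"
    have "((\<lambda>_. 0) has_derivative F' w) (at w)"
    proof (rule has_derivative_transform_within_open[OF d])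
      show "open (- cbox a b)" "w \<in> - cbox a b" using w by (auto simp: closed_cbox)
      show "\<And>x. x \<in> - cbox a b \<Longrightarrow> F x = 0" using out[of _ 0] by auto
    qed
    then show "F' w e = 0"
      using has_derivative_unique[OF _ has_derivative_const] by metis
  qed
  ultimately show ?thesis by simp
qed

section \<open>Approximation in the mean\<close>

abbreviation ckern :: "real \<Rightarrow> complex \<Rightarrow> complex" where
  "ckern \<delta> \<equiv> \<lambda>w. of_real (kern \<delta> w)"

lemma continuous_measurable_lebesgue:
  fixes f :: "complex \<Rightarrow> 'b::topological_space"
  assumes "continuous_on UNIV f"
  shows "f \<in> borel_measurable lebesgue"
proof -
  have "f \<in> borel_measurable lborel" using borel_measurable_continuous_onI[OF assms] by simp
  then show ?thesis by (rule measurable_completion)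
qed

lemma integrable_lborel_lebesgue:
  fixes f :: "complex \<Rightarrow> 'b::{banach, second_countable_topology}"
  assumes "integrable lborel f"
  shows "integrable lebesgue f"
  using assms integrable_completion[of f lborel] borel_measurable_integrable by blast

lemma continuous_ckern: "continuous_on UNIV (ckern \<delta>)"
  by (intro continuous_intros continuous_kern)

text \<open>The Fubini argument for convolutions runs on products of Borel measures, so a Lebesgue
  integrable function is first replaced by a Borel function that agrees with it almost
  everywhere.\<close>

lemma integrable_lebesgue_borel_rep:
  fixes r :: "complex \<Rightarrow> complex"
  assumes "integrable lebesgue r"
  obtains r' where "integrable lborel r'" "AE w in lebesgue. r w = r' w"
proof -
  have "r \<in> borel_measurable lebesgue" using assms by auto
  then have "(\<lambda>w. Re (r w)) \<in> borel_measurable lebesgue" "(\<lambda>w. Im (r w)) \<in> borel_measurable lebesgue"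
    by measurable
  then obtain a b where ab [measurable]: "a \<in> borel_measurable lborel" "b \<in> borel_measurable lborel"
    and ae: "AE w in lborel. Re (r w) = a w" "AE w in lborel. Im (r w) = b w"
    using completion_ex_borel_measurable_real by metis
  define r' where "r' w = Complex (a w) (b w)" for w
  have "r' = (\<lambda>w. of_real (a w) + \<i> * of_real (b w))"
    by (auto simp: r'_def complex_eq_iff)
  then have m [measurable]: "r' \<in> borel_measurable lborel" by simp
  have "AE w in lborel. r w = r' w"
    using ae by eventually_elim (simp add: r'_def complex_eq_iff)
  then have ae': "AE w in lebesgue. r w = r' w" by (rule AE_completion)
  have "integrable lebesgue r'"
    by (rule integrable_cong_AE_imp[OF assms]) (use ae' in \<open>auto intro: measurable_completion simp: eq_commute\<close>)
  then have "integrable lborel r'" using integrable_completion[OF m] by simp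
  with ae' show ?thesis using that by blast
qed

lemma conv_cong_AE:
  assumes "f \<in> borel_measurable lebesgue" "g \<in> borel_measurable lebesgue" "AE w in lebesgue. f w = g w"
    and "continuous_on UNIV \<rho>"
  shows "conv f \<rho> = conv g \<rho>"
proof
  fix w
  have "(\<lambda>z. \<rho> (w - z)) \<in> borel_measurable borel"
    by (intro borel_measurable_continuous_onI continuous_on_compose2[OF assms(4)]) (auto intro!: continuous_intros)
  then have "(\<lambda>z. \<rho> (w - z)) \<in> borel_measurable lebesgue" by (auto intro: measurable_completion)
  then show "conv f \<rho> w = conv g \<rho> w"
    unfolding conv_def using assms by (intro integral_cong_AE) auto
qed

section \<open>Contraction, locality and support properties of mollification\<close>

lemma kern_commute: "kern \<delta> (w - z) = kern \<delta> (z - w)"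
  using kern_minus[of \<delta> "w - z"] by simp

lemma integral_kern_shift: "0 < \<delta> \<Longrightarrow> (LINT z|lborel. kern \<delta> (w - z)) = 1"
  "0 < \<delta> \<Longrightarrow> integrable lborel (\<lambda>z. kern \<delta> (w - z))"
  using lborel_integral_reflect_shift[of "\<lambda>z. kern \<delta> z" w] integral_kern[of \<delta>] integrable_kern[of \<delta>]
  by auto

text \<open>Young's inequality for a kernel of mass one: in the iterated integral of the absolute
  values the inner integral over \<open>w\<close> returns \<open>norm (r' z)\<close>, and exchanging
  the order gives both claims.\<close>

lemma integrable_conv_kern:
  assumes r: "integrable lebesgue r" and \<delta>: "0 < \<delta>"
  shows "integrable lebesgue (conv r (ckern \<delta>))"
    and "(LINT w|lebesgue. norm (conv r (ckern \<delta>) w)) \<le> (LINT w|lebesgue. norm (r w))"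
proof -
  obtain r' where r': "integrable lborel r'" and ae: "AE w in lebesgue. r w = r' w"
    using integrable_lebesgue_borel_rep[OF r] .
  have [measurable]: "r' \<in> borel_measurable borel" using r' by auto
  have rm: "r' \<in> borel_measurable lebesgue" by (auto intro: measurable_completion)
  have eq: "conv r (ckern \<delta>) = conv r' (ckern \<delta>)"
    by (rule conv_cong_AE) (use r rm ae continuous_ckern in auto)
  have eq': "conv r' (ckern \<delta>) w = (LINT z|lborel. r' z * ckern \<delta> (w - z))" for w
    unfolding conv_def by (rule integral_completion) simp
  define F where "F = (\<lambda>z w. r' z * ckern \<delta> (w - z))"
  have [measurable]: "case_prod F \<in> borel_measurable (lborel \<Otimes>\<^sub>M lborel)"
    unfolding F_def by measurable
  have nF: "norm (F z w) = norm (r' z) * kern \<delta> (z - w)" for z w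
    using kern_nonneg[OF \<delta>] by (simp add: F_def norm_mult kern_commute[of \<delta> w])
  have I: "(LINT w|lborel. norm (F z w)) = norm (r' z)" for z
    by (simp add: nF integral_kern_shift[OF \<delta>])
  have int: "integrable (lborel \<Otimes>\<^sub>M lborel) (case_prod F)"
  proof (rule lborel_pair.Fubini_integrable)
    show "integrable lborel (\<lambda>x. LINT y|lborel. norm (case (x, y) of (z, w) \<Rightarrow> F z w))"
      using r' by (simp add: I)
    show "AE x in lborel. integrable lborel (\<lambda>y. case (x, y) of (z, w) \<Rightarrow> F z w)"
    proof (intro AE_I2)
      fix x
      have "integrable lborel (\<lambda>y. norm (F x y))"
        by (simp add: nF integral_kern_shift[OF \<delta>])
      then show "integrable lborel (\<lambda>y. case (x, y) of (z, w) \<Rightarrow> F z w)"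
        by (subst (asm) integrable_norm_iff) auto
    qed
  qed simp
  have int': "integrable lborel (\<lambda>w. LINT z|lborel. F z w)"
    using lborel_pair.integrable_snd[OF int] .
  moreover have fe: "conv r' (ckern \<delta>) = (\<lambda>w. LINT z|lborel. F z w)" by (simp add: eq' F_def fun_eq_iff)
  ultimately have i1: "integrable lborel (conv r' (ckern \<delta>))" by simp
  then show "integrable lebesgue (conv r (ckern \<delta>))"
    unfolding eq by (rule integrable_lborel_lebesgue)
  have intn: "integrable (lborel \<Otimes>\<^sub>M lborel) (\<lambda>(z, w). norm (F z w))"
    using integrable_norm[OF int] by (simp add: split_beta')
  have "(LINT w|lebesgue. norm (conv r (ckern \<delta>) w)) = (LINT w|lborel. norm (LINT z|lborel. F z w))"
    unfolding eq using i1 by (subst integral_completion) (auto simp: fe)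
  also have "\<dots> \<le> (LINT w|lborel. LINT z|lborel. norm (F z w))"
    by (rule integral_mono) (use int' lborel_pair.integrable_snd[OF intn] in auto)
  also have "\<dots> = (LINT z|lborel. LINT w|lborel. norm (F z w))"
    by (rule lborel_pair.Fubini_integral[OF intn])
  also have "\<dots> = (LINT z|lborel. norm (r' z))" by (simp add: I)
  also have "\<dots> = (LINT z|lebesgue. norm (r' z))" by (rule integral_completion[symmetric]) simp
  also have "\<dots> = (LINT z|lebesgue. norm (r z))"
    by (rule integral_cong_AE) (use ae r rm in auto)
  finally show "(LINT w|lebesgue. norm (conv r (ckern \<delta>) w)) \<le> (LINT w|lebesgue. norm (r w))" .
qed

lemma integrable_shift_mult:
  assumes r: "integrable lebesgue r" and \<delta>: "0 < \<delta>"
  shows "integrable lebesgue (\<lambda>z. r z * ckern \<delta> (w - z))"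
proof -
  have "compact (kern \<delta> ` cball 0 \<delta>)"
    by (intro compact_continuous_image) (auto intro: continuous_on_subset[OF continuous_kern])
  then have "bounded (insert 0 (kern \<delta> ` cball 0 \<delta>))" by (simp add: compact_imp_bounded)
  then have "bounded (range (kern \<delta>))"
    by (rule bounded_subset) (use kern_eq_0[OF \<delta>] in \<open>force simp: not_le\<close>)
  then obtain M where M: "\<And>z. \<bar>kern \<delta> z\<bar> \<le> M" by (auto simp: bounded_iff)
  have m: "(\<lambda>z. ckern \<delta> (w - z)) \<in> borel_measurable lebesgue"
    by (auto intro: measurable_completion)
  show ?thesis
  proof (rule Bochner_Integration.integrable_bound[OF integrable_mult_right[of M, OF integrable_norm[OF r]]])
    have "norm (r z * ckern \<delta> (w - z)) \<le> norm (M * norm (r z))" for z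
      using mult_left_mono[OF M[of "w - z"] norm_ge_zero[of "r z"]]
      by (simp add: norm_mult mult.commute order_trans[OF _ abs_ge_self])
    then show "AE z in lebesgue. norm (r z * ckern \<delta> (w - z)) \<le> norm (M * norm (r z))" by simp
  qed (use r m in auto)
qed

lemma conv_diff:
  assumes "integrable lebesgue f" "integrable lebesgue g" "0 < \<delta>"
  shows "conv (\<lambda>w. f w - g w) (ckern \<delta>) w = conv f (ckern \<delta>) w - conv g (ckern \<delta>) w"
  unfolding conv_def
  by (subst Bochner_Integration.integral_diff[symmetric])
    (use assms integrable_shift_mult in \<open>auto simp: algebra_simps\<close>)

lemma uniformly_continuous_compact_support:
  fixes f :: "complex \<Rightarrow> complex"
  assumes f: "continuous_on UNIV f" "compact K" "\<And>w. w \<notin> K \<Longrightarrow> f w = 0" and "0 < e"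
  obtains d where "0 < d" "\<And>w z. dist w z < d \<Longrightarrow> dist (f w) (f z) < e"
proof -
  obtain R where R: "K \<subseteq> cball 0 R"
    using compact_imp_bounded[OF f(2)] by (fastforce simp: bounded_iff)
  \<comment> \<open>The margin 1 around the support matters: two points at distance less than 1, not
    both in the larger ball, both lie outside \<open>cball 0 R\<close>, where \<open>f\<close>
    vanishes.\<close>
  have "uniformly_continuous_on (cball 0 (R + 1)) f"
    by (rule compact_uniformly_continuous) (auto intro: continuous_on_subset[OF f(1)])
  then obtain d where d: "0 < d" "\<And>w z. w \<in> cball 0 (R + 1) \<Longrightarrow> z \<in> cball 0 (R + 1) \<Longrightarrow> dist w z < d \<Longrightarrow> dist (f w) (f z) < e"
    unfolding uniformly_continuous_on_def using \<open>0 < e\<close> by (metis dist_commute)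
  show ?thesis
  proof (rule that[of "min d 1"])
    show "0 < min d 1" using d by simp
    fix w z :: complex assume wz: "dist w z < min d 1"
    show "dist (f w) (f z) < e"
    proof (cases "w \<in> cball 0 (R + 1) \<and> z \<in> cball 0 (R + 1)")
      case True
      then show ?thesis using d wz by simp
    next
      case False
      have "norm w \<le> norm z + dist w z" "norm z \<le> norm w + dist w z"
        using norm_triangle_ineq[of z "w - z"] norm_triangle_ineq[of w "z - w"]
        by (auto simp: dist_norm norm_minus_commute)
      then have "w \<notin> cball 0 R" "z \<notin> cball 0 R" using False wz by auto
      then show ?thesis using f(3) R \<open>0 < e\<close> by (metis dist_self subsetD)
    qed
  qed
qed

text \<open>The kernel is a probability density on the \<delta>-ball, so the mollified value is an
  average of nearby values. The inequality in the hypothesis is weak so that \<open>e = 0\<close> is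
  allowed: where \<open>f\<close> is constant near \<open>w\<close>, mollification reproduces it
  exactly. The construction of cutoffs uses this case.\<close>

lemma conv_kern_dist_le:
  assumes f: "continuous_on UNIV f" "compact K" "\<And>w. w \<notin> K \<Longrightarrow> f w = 0"
    and \<delta>: "0 < \<delta>" and e: "\<And>z. dist w z < \<delta> \<Longrightarrow> dist (f w) (f z) \<le> e"
  shows "norm (conv f (ckern \<delta>) w - f w) \<le> e"
proof -
  have [measurable]: "f \<in> borel_measurable borel" using f(1) by (rule borel_measurable_continuous_onI)
  have fi: "integrable lebesgue f" using integrable_continuous_compact_support[OF f(1,2)] f(3) by blast
  have i1: "integrable lborel (\<lambda>z. f z * ckern \<delta> (w - z))"
    using integrable_shift_mult[OF fi \<delta>] by (subst (asm) integrable_completion) auto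
  have i2: "integrable lborel (\<lambda>z. f w * ckern \<delta> (w - z))"
    using integral_kern_shift[OF \<delta>] by (intro integrable_mult_right integrable_of_real) auto
  have "conv f (ckern \<delta>) w - f w = (LINT z|lborel. f z * ckern \<delta> (w - z)) - f w * of_real (LINT z|lborel. kern \<delta> (w - z))"
    unfolding conv_def by (subst integral_completion) (auto simp: integral_kern_shift[OF \<delta>])
  also have "\<dots> = (LINT z|lborel. f z * ckern \<delta> (w - z) - f w * ckern \<delta> (w - z))"
    by (subst Bochner_Integration.integral_diff[OF i1 i2]) (simp add: integral_complex_of_real)
  finally have "norm (conv f (ckern \<delta>) w - f w) = norm (LINT z|lborel. f z * ckern \<delta> (w - z) - f w * ckern \<delta> (w - z))"
    by simp
  also have "\<dots> \<le> (LINT z|lborel. e * kern \<delta> (w - z))"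
  proof (rule order_trans[OF integral_norm_bound integral_mono])
    show "integrable lborel (\<lambda>z. norm (f z * ckern \<delta> (w - z) - f w * ckern \<delta> (w - z)))" using i1 i2 by simp
    show "integrable lborel (\<lambda>z. e * kern \<delta> (w - z))" using integral_kern_shift[OF \<delta>] by simp
    fix z
    show "norm (f z * ckern \<delta> (w - z) - f w * ckern \<delta> (w - z)) \<le> e * kern \<delta> (w - z)"
    proof (cases "dist w z < \<delta>")
      case True
      have "norm (f z * ckern \<delta> (w - z) - f w * ckern \<delta> (w - z)) = dist (f w) (f z) * kern \<delta> (w - z)"
        using kern_nonneg[OF \<delta>] by (simp add: left_diff_distrib[symmetric] norm_mult dist_norm norm_minus_commute)
      then show ?thesis using e[OF True] kern_nonneg[OF \<delta>] by (simp add: mult_right_mono)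
    next
      case False
      then show ?thesis using kern_eq_0[OF \<delta>, of "w - z"] by (simp add: dist_norm)
    qed
  qed
  also have "\<dots> = e" by (simp add: integral_kern_shift[OF \<delta>])
  finally show ?thesis .
qed

lemma conv_kern_support:
  assumes f: "\<And>w. w \<notin> K \<Longrightarrow> f w = 0" and \<delta>: "0 < \<delta>" and w: "\<And>z. z \<in> K \<Longrightarrow> \<delta> \<le> dist w z"
  shows "conv f (ckern \<delta>) w = 0"
proof -
  have "(\<lambda>z. f z * ckern \<delta> (w - z)) = (\<lambda>z. 0)"
  proof
    fix z show "f z * ckern \<delta> (w - z) = 0"
      using f[of z] w[of z] kern_eq_0[OF \<delta>, of "w - z"] by (cases "z \<in> K") (auto simp: dist_norm)
  qed
  then show ?thesis unfolding conv_def by (simp only: Bochner_Integration.integral_zero)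
qed

section \<open>Density of the compactly supported continuous functions in L1\<close>

definition clampc :: "real \<Rightarrow> complex \<Rightarrow> complex" where
  "clampc m z = (m / max m (norm z)) *\<^sub>R z"

definition cutr :: "real \<Rightarrow> complex \<Rightarrow> real" where
  "cutr m w = max 0 (min 1 (m + 1 - norm w))"

lemma clampc_bounds:
  assumes "0 < m"
  shows "norm (clampc m z) \<le> m" "norm (clampc m z) \<le> norm z" "norm z \<le> m \<Longrightarrow> clampc m z = z"
  using assms by (auto simp: clampc_def max_def divide_simps mult_right_mono)

lemma continuous_clampc: "0 < m \<Longrightarrow> continuous_on UNIV (clampc m)"
  unfolding clampc_def by (intro continuous_intros) (auto simp: max_def)

lemma cutr_bounds: "0 \<le> cutr m w" "cutr m w \<le> 1" "norm w \<le> m \<Longrightarrow> cutr m w = 1" "m + 1 \<le> norm w \<Longrightarrow> cutr m w = 0"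
  by (auto simp: cutr_def)

lemma continuous_cutr: "continuous_on UNIV (cutr m)"
  unfolding cutr_def by (intro continuous_intros)

text \<open>Two truncated approximations, each by dominated convergence. Cutting \<open>H\<close>
  off in value and in space costs little, with majorant \<open>2 * norm (H w)\<close>. The same
  truncation applied to continuous functions that converge almost everywhere to \<open>H\<close>
  then has a bounded, compactly supported majorant. Truncation in value is the continuous map
  \<open>clampc\<close>, so it respects the pointwise limit.\<close>

lemma L1_dense_continuous:
  fixes H :: "complex \<Rightarrow> complex"
  assumes H: "integrable lebesgue H" and e: "0 < (e::real)"
  obtains k K where "continuous_on UNIV k" "compact K" "\<And>w. w \<notin> K \<Longrightarrow> k w = (0::complex)"
    "(LINT w|lebesgue. norm (H w - k w :: complex)) < e"
proof -
  have Hm [measurable]: "H \<in> borel_measurable lebesgue" using H by auto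
  define u where "u m w = cutr (real (Suc m)) w *\<^sub>R clampc (real (Suc m)) (H w)" for m w
  have cm: "cutr m \<in> borel_measurable lebesgue" for m
    by (intro continuous_measurable_lebesgue continuous_cutr)
  have clm: "clampc (real (Suc m)) \<in> borel_measurable borel" for m
    by (intro borel_measurable_continuous_onI continuous_clampc) simp
  have um [measurable]: "u m \<in> borel_measurable lebesgue" for m
    unfolding u_def using cm measurable_compose[OF Hm clm] by (intro borel_measurable_scaleR)
  have un: "norm (u m w) \<le> norm (H w)" for m w
    using cutr_bounds[where m = "real (Suc m)" and w = w] clampc_bounds[where m = "real (Suc m)" and z = "H w"]
    by (simp add: u_def) (metis abs_of_nonneg mult_left_le_one_le norm_ge_zero order_trans)
  have "(\<lambda>m. LINT w|lebesgue. norm (H w - u m w)) \<longlonglongrightarrow> (LINT w|lebesgue. (\<lambda>_. 0) (w::complex))"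
  proof (rule integral_dominated_convergence[where w = "\<lambda>w. 2 * norm (H w)"])
    show "AE w in lebesgue. (\<lambda>m. norm (H w - u m w)) \<longlonglongrightarrow> 0"
    proof (intro AE_I2 tendsto_eventually)
      fix w
      obtain N where N: "norm w \<le> real N" "norm (H w) \<le> real N"
        using real_arch_simple[of "max (norm w) (norm (H w))"] by auto
      show "\<forall>\<^sub>F m in sequentially. norm (H w - u m w) = 0"
        using eventually_ge_at_top[of N]
      proof eventually_elim
        case (elim m)
        then show ?case using N by (simp add: u_def cutr_bounds(3) clampc_bounds(3))
      qed
    qed
    show "AE w in lebesgue. norm (norm (H w - u m w)) \<le> 2 * norm (H w)" for m
      using norm_triangle_ineq4[of "H w" "u m w" for w] un[of m]
      by (intro AE_I2) (smt (verit) norm_ge_zero real_norm_def)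
  qed (use H in auto)
  then have "(\<lambda>m. LINT w|lebesgue. norm (H w - u m w)) \<longlonglongrightarrow> 0" by simp
  then obtain m where m: "(LINT w|lebesgue. norm (H w - u m w)) < e / 2"
    using order_tendstoD(2)[of _ 0 sequentially "e/2"] e by (auto simp: eventually_sequentially)
  define M where "M = real (Suc m)"
  have M: "0 < M" by (simp add: M_def)
  \<comment> \<open>Gauge measurability supplies the continuous functions \<open>g n\<close>
    converging to \<open>H\<close> off a null set, with no control of their size; the truncation to
    level \<open>M\<close> provides the control.\<close>
  have "H measurable_on UNIV"
    using lebesgue_measurable_imp_measurable_on[OF Hm] by simp
  then obtain N g where N: "negligible N" and g: "\<And>n. continuous_on UNIV (g n)"
    and lim: "\<And>w. w \<notin> N \<Longrightarrow> (\<lambda>n. g n w) \<longlonglongrightarrow> H w"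
    unfolding measurable_on_def by auto
  define v where "v n w = cutr M w *\<^sub>R clampc M (g n w)" for n w
  have cv: "continuous_on UNIV (v n)" for n
    unfolding v_def
    by (intro continuous_intros continuous_cutr continuous_on_compose2[OF continuous_clampc[OF M] g]) auto
  have v0: "w \<notin> cball 0 (M + 1) \<Longrightarrow> v n w = 0" for n w
    using cutr_bounds(4)[where m = M and w = w] by (simp add: v_def)
  have vm [measurable]: "v n \<in> borel_measurable lebesgue" for n
    by (intro continuous_measurable_lebesgue cv)
  have aeN: "AE w in lebesgue. w \<notin> N"
    using N by (auto simp: negligible_iff_null_sets intro: AE_not_in)
  have bd: "norm (u m w - v n w) \<le> 2 * M * indicator (cball 0 (M + 1)) w" for n w
  proof (cases "w \<in> cball 0 (M + 1)")
    case True
    have "cutr M w * norm (clampc M z) \<le> 1 * M" for z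
      using cutr_bounds[where m = M and w = w] clampc_bounds[OF M] by (intro mult_mono) auto
    then have "norm (u m w) \<le> 1 * M" "norm (v n w) \<le> 1 * M"
      using cutr_bounds(1)[where m = M and w = w]
      by (simp_all only: u_def v_def M_def[symmetric] norm_scaleR abs_of_nonneg)
    then show ?thesis using True norm_triangle_ineq4[of "u m w" "v n w"] by simp
  next
    case False
    then have "cutr M w = 0" using cutr_bounds(4)[where m = M and w = w] by simp
    then show ?thesis using False by (simp add: u_def v_def M_def[symmetric] del: of_nat_Suc)
  qed
  have "(\<lambda>n. LINT w|lebesgue. norm (u m w - v n w)) \<longlonglongrightarrow> (LINT w|lebesgue. (\<lambda>_. 0) (w::complex))"
  proof (rule integral_dominated_convergence[where w = "\<lambda>w. 2 * M * indicator (cball 0 (M + 1)) w"])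
    show "AE w in lebesgue. (\<lambda>n. norm (u m w - v n w)) \<longlonglongrightarrow> 0"
      using aeN
    proof eventually_elim
      case (elim w)
      have "(\<lambda>n. clampc M (g n w)) \<longlonglongrightarrow> clampc M (H w)"
        by (rule continuous_on_tendsto_compose[OF continuous_clampc[OF M] lim[OF elim]]) auto
      then have "(\<lambda>n. norm (u m w - v n w)) \<longlonglongrightarrow> norm (u m w - cutr M w *\<^sub>R clampc M (H w))"
        unfolding v_def by (intro tendsto_intros)
      then show ?case by (simp add: u_def M_def[symmetric] del: of_nat_Suc)
    qed
    show "integrable lebesgue (\<lambda>w::complex. 2 * M * indicator (cball 0 (M + 1)) w :: real)"
      using emeasure_lborel_cball_finite[of "0::complex" "M + 1"]
      by (intro integrable_mult_right integrable_real_indicator) auto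
    show "AE w in lebesgue. norm (norm (u m w - v n w)) \<le> 2 * M * indicator (cball 0 (M + 1)) w" for n
      using bd by simp
  qed auto
  then have "(\<lambda>n. LINT w|lebesgue. norm (u m w - v n w)) \<longlonglongrightarrow> 0" by simp
  then obtain n where n: "(LINT w|lebesgue. norm (u m w - v n w)) < e / 2"
    using order_tendstoD(2)[of _ 0 sequentially "e/2"] e by (auto simp: eventually_sequentially)
  have iu: "integrable lebesgue (u m)"
    by (rule Bochner_Integration.integrable_bound[OF integrable_norm[OF H] um]) (use un in auto)
  have iv: "integrable lebesgue (v n)"
    using integrable_continuous_compact_support[OF cv compact_cball v0] by blast
  have "(LINT w|lebesgue. norm (H w - v n w)) \<le> (LINT w|lebesgue. norm (H w - u m w) + norm (u m w - v n w))"
    by (rule integral_mono) (use H iu iv norm_triangle_ineq[of "H w - u m w" "u m w - v n w" for w] in auto)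
  also have "\<dots> < e" using m n H iu iv by simp
  finally show ?thesis using that[OF cv compact_cball v0] by blast
qed

text \<open>The usual three-term estimate: mollification is an L1 contraction, so replacing
  \<open>H\<close> by a continuous \<open>k\<close> costs the same small amount before and after,
  and for \<open>k\<close> uniform continuity decides.\<close>

lemma conv_kern_L1:
  assumes H: "integrable lebesgue H" and e: "0 < e"
  obtains d where "0 < d" "\<And>\<delta>. 0 < \<delta> \<Longrightarrow> \<delta> < d \<Longrightarrow> (LINT w|lebesgue. norm (conv H (ckern \<delta>) w - H w)) < e"
proof -
  obtain k K where k: "continuous_on UNIV k" "compact K" "\<And>w. w \<notin> K \<Longrightarrow> k w = 0"
    and kH: "(LINT w|lebesgue. norm (H w - k w)) < e / 3"
    using L1_dense_continuous[OF H, of "e/3"] e by auto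
  have ik: "integrable lebesgue k" using integrable_continuous_compact_support[OF k(1,2)] k(3) by blast
  obtain R where R: "K \<subseteq> cball 0 R"
    using compact_imp_bounded[OF k(2)] by (fastforce simp: bounded_iff)
  define B where "B = cball (0::complex) (R + 1)"
  \<comment> \<open>The uniform error for \<open>k\<close> lives on \<open>B\<close>, so
    \<open>e'\<close> is chosen to make its integral at most \<open>e / 3\<close>; the summand 1
    keeps the denominator positive.\<close>
  define e' where "e' = e / (3 * (1 + measure lebesgue B))"
  have e': "0 < e'" using e by (simp add: e'_def add_pos_nonneg)
  obtain d where d: "0 < d" "\<And>w z. dist w z < d \<Longrightarrow> dist (k w) (k z) < e'"
    using uniformly_continuous_compact_support[OF k(1,2) _ e'] k(3) by blast
  show ?thesis
  proof (rule that[of "min d 1"])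
    show "0 < min d 1" using d by simp
    fix \<delta> :: real assume \<delta>: "0 < \<delta>" "\<delta> < min d 1"
    let ?c = "\<lambda>f. conv f (ckern \<delta>)"
    have kb: "norm (?c k w - k w) \<le> e' * indicator B w" for w
    proof (cases "w \<in> B")
      case True
      then show ?thesis
        using conv_kern_dist_le[OF k \<delta>(1), of w e'] d(2)[of w] \<delta> by (force simp: less_imp_le)
    next
      case False
      have far: "\<delta> \<le> dist w z" if "z \<in> K" for z
      proof -
        have "norm w \<le> norm z + dist w z"
          using norm_triangle_ineq[of z "w - z"] by (simp add: dist_norm)
        then show ?thesis using that R False \<delta> by (force simp: B_def)
      qed
      have "?c k w = 0" by (rule conv_kern_support[OF k(3) \<delta>(1) far])
      moreover have "k w = 0" using k(3) far[of w] \<delta> by auto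
      ultimately show ?thesis using False by simp
    qed
    have r: "integrable lebesgue (\<lambda>w. H w - k w)" using H ik by simp
    have le: "norm (?c H w - H w) \<le> norm (?c k w - k w) + norm (?c (\<lambda>w. H w - k w) w) + norm (H w - k w)" for w
    proof -
      have "?c H w - H w = (?c k w - k w) + ?c (\<lambda>w. H w - k w) w - (H w - k w)"
        by (simp add: conv_diff[OF H ik \<delta>(1)])
      then have "norm (?c H w - H w) = norm ((?c k w - k w) + ?c (\<lambda>w. H w - k w) w - (H w - k w))" by (rule arg_cong)
      then show ?thesis
        using norm_triangle_ineq4[of "(?c k w - k w) + ?c (\<lambda>w. H w - k w) w" "H w - k w"]
          norm_triangle_ineq[of "?c k w - k w" "?c (\<lambda>w. H w - k w) w"] by linarith
    qed
    have Bf: "integrable lebesgue (indicator B :: complex \<Rightarrow> real)"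
      unfolding B_def using emeasure_lborel_cball_finite[of "0::complex" "R + 1"]
      by (intro integrable_real_indicator) auto
    have ick: "integrable lebesgue (?c k)" "integrable lebesgue (?c H)" "integrable lebesgue (?c (\<lambda>w. H w - k w))"
      using integrable_conv_kern(1)[OF _ \<delta>(1)] ik H r by auto
    have "(LINT w|lebesgue. norm (?c H w - H w)) \<le>
        (LINT w|lebesgue. norm (?c k w - k w) + norm (?c (\<lambda>w. H w - k w) w) + norm (H w - k w))"
      by (rule integral_mono) (use le ick H ik r in auto)
    also have "\<dots> = (LINT w|lebesgue. norm (?c k w - k w)) + (LINT w|lebesgue. norm (?c (\<lambda>w. H w - k w) w)) + (LINT w|lebesgue. norm (H w - k w))"
      using ick H ik r by simp
    also have "\<dots> \<le> (LINT w|lebesgue. e' * indicator B w) + (LINT w|lebesgue. norm (H w - k w)) + (LINT w|lebesgue. norm (H w - k w))"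
    proof (intro add_mono)
      show "(LINT w|lebesgue. norm (?c k w - k w)) \<le> (LINT w|lebesgue. e' * indicator B w)"
        by (rule integral_mono) (use kb ick ik Bf in auto)
    qed (use integrable_conv_kern(2)[OF r \<delta>(1)] in auto)
    also have "(LINT w|lebesgue. e' * indicator B w) = e' * measure lebesgue B"
      by (simp add: B_def)
    also have "e' * measure lebesgue B + (LINT w|lebesgue. norm (H w - k w)) + (LINT w|lebesgue. norm (H w - k w)) < e"
    proof -
      have "e' * measure lebesgue B \<le> e' * (1 + measure lebesgue B)" using e' by simp
      also have "\<dots> = e / 3" using measure_nonneg[of lebesgue B] by (simp add: e'_def field_simps add_nonneg_eq_0_iff)
      finally show ?thesis using kH by simp
    qed
    finally show "(LINT w|lebesgue. norm (?c H w - H w)) < e" .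
  qed
qed

section \<open>Calculus of weak derivatives\<close>

lemma integral_lebesgue_on_eq:
  fixes F :: "complex \<Rightarrow> 'b::{banach, second_countable_topology}"
  assumes "U \<in> sets lebesgue" "\<And>w. w \<notin> U \<Longrightarrow> F w = 0"
  shows "(LINT w|lebesgue_on U. F w) = (LINT w|lebesgue. F w)"
    and "integrable (lebesgue_on U) F \<longleftrightarrow> integrable lebesgue F"
proof -
  have "(\<lambda>w. indicator U w *\<^sub>R F w) = F" using assms(2) by (auto simp: indicator_def fun_eq_iff)
  then show "(LINT w|lebesgue_on U. F w) = (LINT w|lebesgue. F w)"
    "integrable (lebesgue_on U) F \<longleftrightarrow> integrable lebesgue F"
    using assms(1) by (simp_all add: Bochner_Integration.integral_restrict_space integrable_restrict_space)
qed

lemma open_lebesgue [simp, intro]: "open (U :: complex set) \<Longrightarrow> U \<in> sets lebesgue"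
  by auto

section \<open>Test functions\<close>

lemma test_functionI:
  assumes "\<And>k. Ck k \<eta>" "compact K" "K \<subseteq> U" "\<And>w. w \<notin> K \<Longrightarrow> \<eta> w = 0"
  shows "test_function U \<eta>"
proof -
  have "closure {w. \<eta> w \<noteq> 0} \<subseteq> K"
    by (rule closure_minimal[OF _ compact_imp_closed[OF assms(2)]]) (use assms(4) in blast)
  moreover from this have "compact (closure {w. \<eta> w \<noteq> 0})"
    using compact_Int_closed[OF assms(2) closed_closure, of "{w. \<eta> w \<noteq> 0}"] by (simp add: Int_absorb1)
  ultimately show ?thesis
    unfolding test_function_def using assms(1) order_trans[OF _ assms(3)] by (intro conjI allI)
qed

lemma test_functionE:
  assumes "test_function U \<eta>"
  obtains K where "compact K" "K \<subseteq> U" "\<And>w. w \<notin> K \<Longrightarrow> \<eta> w = 0"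
proof -
  have "\<eta> w = 0" if "w \<notin> closure {w. \<eta> w \<noteq> 0}" for w
    using that closure_subset[of "{w. \<eta> w \<noteq> 0}"] by auto
  moreover have "compact (closure {w. \<eta> w \<noteq> 0})" "closure {w. \<eta> w \<noteq> 0} \<subseteq> U"
    using assms by (simp_all add: test_function_def)
  ultimately show ?thesis by (intro that)
qed

lemma test_function_Ck: "test_function U \<eta> \<Longrightarrow> Ck k \<eta>"
  by (simp add: test_function_def)

lemma test_function_outside: "test_function U \<eta> \<Longrightarrow> w \<notin> U \<Longrightarrow> \<eta> w = 0"
  by (metis test_functionE subsetD)

lemma test_function_mono: "test_function U \<eta> \<Longrightarrow> U \<subseteq> V \<Longrightarrow> test_function V \<eta>"
  by (auto simp: test_function_def)

lemma test_function_continuous: "test_function U \<eta> \<Longrightarrow> continuous_on UNIV \<eta>"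
  using test_function_Ck[of U \<eta> 0] by simp

lemma test_function_has_derivative: "test_function U \<eta> \<Longrightarrow> (\<eta> has_derivative fderiv \<eta> w) (at w)"
  using test_function_Ck[of U \<eta> "Suc 0"] Ck_differentiable by blast

text \<open>Stated with a constant \<open>c\<close> to serve two purposes: \<open>c = 0\<close>
  outside the support of a test function, and \<open>c = 1\<close> on the set where a cutoff is
  identically 1.\<close>

lemma frechet_derivative_outside:
  fixes \<eta> :: "complex \<Rightarrow> complex"
  assumes "closed K" "\<And>w. w \<notin> K \<Longrightarrow> \<eta> w = c" "w \<notin> K"
  shows "fderiv \<eta> w e = 0"
proof -
  have "(\<eta> has_derivative (\<lambda>_. 0)) (at w)"
  proof (rule has_derivative_transform_within_open[OF has_derivative_const])
    show "open (- K)" "w \<in> - K" using assms by auto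
    show "\<And>x. x \<in> - K \<Longrightarrow> c = \<eta> x" using assms(2) by auto
  qed
  then show ?thesis using frechet_derivative_at by metis
qed

lemma test_function_frechet_derivative:
  assumes "test_function U \<eta>"
  shows "test_function U (\<lambda>w. fderiv \<eta> w e)"
proof -
  obtain K where K: "compact K" "K \<subseteq> U" "\<And>w. w \<notin> K \<Longrightarrow> \<eta> w = 0"
    using test_functionE[OF assms] by blast
  show ?thesis
  proof (rule test_functionI[OF _ K(1,2)])
    show "Ck k (\<lambda>w. fderiv \<eta> w e)" for k
      using test_function_Ck[OF assms, of "Suc k"] by simp
    show "w \<notin> K \<Longrightarrow> fderiv \<eta> w e = 0" for w
      using frechet_derivative_outside[OF compact_imp_closed[OF K(1)] K(3)] .
  qed
qed

lemma test_function_mult: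
  assumes "test_function U \<eta>" "\<And>k. Ck k g"
  shows "test_function U (\<lambda>w. g w * \<eta> w)"
proof -
  obtain K where K: "compact K" "K \<subseteq> U" "\<And>w. w \<notin> K \<Longrightarrow> \<eta> w = 0"
    using test_functionE[OF assms(1)] by blast
  show ?thesis
    by (rule test_functionI[OF _ K(1,2)]) (use Ck_mult assms test_function_Ck K in auto)
qed

lemma test_function_cnj:
  assumes "test_function U \<eta>"
  shows "test_function U (\<lambda>w. cnj (\<eta> w))"
proof -
  obtain K where K: "compact K" "K \<subseteq> U" "\<And>w. w \<notin> K \<Longrightarrow> \<eta> w = 0"
    using test_functionE[OF assms(1)] by blast
  show ?thesis
    by (rule test_functionI[OF _ K(1,2)])
      (use Ck_bounded_linear_compose[OF bounded_linear_cnj] assms test_function_Ck K in auto)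
qed

lemma frechet_derivative_mult:
  fixes f g :: "complex \<Rightarrow> complex"
  assumes "f differentiable (at w)" "g differentiable (at w)"
  shows "fderiv (\<lambda>w. f w * g w) w e
    = f w * fderiv g w e + fderiv f w e * g w"
  using frechet_derivative_at[OF has_derivative_mult[OF assms[unfolded frechet_derivative_works]]]
  by metis

lemma frechet_derivative_cnj:
  fixes f :: "complex \<Rightarrow> complex"
  assumes "f differentiable (at w)"
  shows "fderiv (\<lambda>w. cnj (f w)) w e = cnj (fderiv f w e)"
  using frechet_derivative_at[OF bounded_linear.has_derivative[OF bounded_linear_cnj assms[unfolded frechet_derivative_works]]]
  by metis

lemma test_function_differentiable: "test_function U \<eta> \<Longrightarrow> \<eta> differentiable (at w)"
  using test_function_has_derivative differentiable_def by blast

lemma continuous_compact_support_bounded: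
  fixes \<eta> :: "complex \<Rightarrow> complex"
  assumes "continuous_on UNIV \<eta>" "compact K" "\<And>w. w \<notin> K \<Longrightarrow> \<eta> w = 0"
  obtains M where "0 \<le> M" "\<And>w. norm (\<eta> w) \<le> M"
proof -
  have "bounded (\<eta> ` K)"
    by (intro compact_imp_bounded compact_continuous_image continuous_on_subset[OF assms(1)] assms) auto
  then obtain M where M: "\<And>w. w \<in> K \<Longrightarrow> norm (\<eta> w) \<le> M" by (auto simp: bounded_iff)
  have "norm (\<eta> w) \<le> max 0 M" for w
    using M[of w] assms(3)[of w] by (cases "w \<in> K") (auto simp: le_max_iff_disj)
  then show ?thesis using that[of "max 0 M"] by simp
qed

lemma test_function_bounded:
  assumes "test_function U \<eta>"
  obtains M where "0 \<le> M" "\<And>w. norm (\<eta> w) \<le> M"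
  using test_functionE[OF assms] continuous_compact_support_bounded[OF test_function_continuous[OF assms]] by metis

lemma integrable_mult_bounded:
  fixes f g :: "'x \<Rightarrow> complex"
  assumes "integrable M f" "g \<in> borel_measurable M" "AE w in M. norm (g w) \<le> B"
  shows "integrable M (\<lambda>w. f w * g w)"
proof (rule Bochner_Integration.integrable_bound[OF integrable_mult_right[of B, OF integrable_norm[OF assms(1)]]])
  show "AE w in M. norm (f w * g w) \<le> norm (B * norm (f w))"
    using assms(3)
  proof eventually_elim
    case (elim w)
    then have "norm (f w * g w) \<le> norm (f w) * B" by (simp add: norm_mult mult_left_mono)
    then show ?case by (simp add: mult.commute)
  qed
qed (use assms in auto)

lemma locally_integrable_mult_test:
  assumes "locally_integrable U f" "test_function U \<eta>" and U: "open U"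
  shows "integrable lebesgue (\<lambda>w. f w * \<eta> w)" "integrable (lebesgue_on U) (\<lambda>w. f w * \<eta> w)"
proof -
  obtain K where K: "compact K" "K \<subseteq> U" "\<And>w. w \<notin> K \<Longrightarrow> \<eta> w = 0"
    using test_functionE[OF assms(2)] by blast
  obtain M where M: "\<And>w. norm (\<eta> w) \<le> M" using test_function_bounded[OF assms(2)] by blast
  have Km: "K \<in> sets lebesgue" using K(1) by (auto simp: borel_compact)
  have "integrable (lebesgue_on K) f" using assms(1) K by (auto simp: locally_integrable_def)
  then have "integrable lebesgue (\<lambda>w. if w \<in> K then f w else 0)"
    using Lebesgue_Measure.integrable_restrict_UNIV[OF Km] by blast
  then have "integrable lebesgue (\<lambda>w. (if w \<in> K then f w else 0) * \<eta> w)"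
    by (rule integrable_mult_bounded[where B = M])
      (use M continuous_measurable_lebesgue[OF test_function_continuous[OF assms(2)]] in auto)
  also have "(\<lambda>w. (if w \<in> K then f w else 0) * \<eta> w) = (\<lambda>w. f w * \<eta> w)"
    using K(3) by auto
  finally show *: "integrable lebesgue (\<lambda>w. f w * \<eta> w)" .
  then show "integrable (lebesgue_on U) (\<lambda>w. f w * \<eta> w)"
    using test_function_outside[OF assms(2)] U by (subst integral_lebesgue_on_eq(2)) auto
qed

section \<open>Local integrability and the fundamental lemma of the calculus of variations\<close>

lemma compact_exhaustion_AE:
  assumes "open U" "\<And>C. compact C \<Longrightarrow> C \<subseteq> U \<Longrightarrow> AE w in lebesgue_on C. P w"
  shows "AE w in lebesgue_on (U :: complex set). P w"
proof -
  obtain C :: "nat \<Rightarrow> complex set" where C: "\<And>n. compact (C n)" "\<And>n. C n \<subseteq> U" "\<Union>(range C) = U"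
    using open_Union_compact_subsets[OF assms(1)] by metis
  have Cm: "C n \<in> sets lebesgue" for n using C(1) by (auto simp: borel_compact)
  have "AE w in lebesgue. w \<in> C n \<longrightarrow> P w" for n
    using assms(2)[OF C(1,2), of n] Cm by (simp add: AE_restrict_space_iff)
  then have "AE w in lebesgue. \<forall>n. w \<in> C n \<longrightarrow> P w" by (subst AE_all_countable) blast
  then have "AE w in lebesgue. w \<in> U \<longrightarrow> P w" by eventually_elim (use C(3) in blast)
  then show ?thesis using assms(1) by (simp add: AE_restrict_space_iff)
qed

lemma locally_integrable_measurable:
  assumes "open U" "locally_integrable U f"
  shows "f \<in> borel_measurable (lebesgue_on U)"
proof -
  obtain C :: "nat \<Rightarrow> complex set" where C: "\<And>n. compact (C n)" "\<And>n. C n \<subseteq> U" "\<Union>(range C) = U"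
    using open_Union_compact_subsets[OF assms(1)] by metis
  have Cm: "C n \<in> sets lebesgue" for n using C(1) by (auto simp: borel_compact)
  show ?thesis
  proof (rule measurable_piecewise_restrict[where C = "range C"])
    fix X assume "X \<in> range C"
    then obtain n where X: "X = C n" by auto
    show "X \<inter> space (lebesgue_on U) \<in> sets (lebesgue_on U)"
      using Cm[of n] C(2)[of n] assms(1) by (simp add: X sets_restrict_space_iff Int_absorb2)
    have "restrict_space (lebesgue_on U) X = lebesgue_on (C n)"
      using Cm[of n] C(2)[of n] assms(1) by (simp add: X restrict_restrict_space Int_absorb1)
    moreover have "integrable (lebesgue_on (C n)) f"
      using assms(2) C(1,2) by (simp add: locally_integrable_def)
    ultimately show "f \<in> borel_measurable (restrict_space (lebesgue_on U) X)"
      by (simp add: borel_measurable_integrable)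
  qed (use C in auto)
qed

text \<open>Reflected and shifted mollifiers are test functions, so the hypothesis says that the
  mollifications of \<open>h\<close> vanish on \<open>C\<close> for small radii. They also converge
  to \<open>h\<close> in L1 there, and the limit can only be 0.\<close>

lemma locally_integrable_zero_AE:
  assumes U: "open U" and h: "locally_integrable U h"
    and z: "\<And>\<eta>. test_function U \<eta> \<Longrightarrow> (LINT w|lebesgue_on U. h w * \<eta> w) = 0"
  shows "AE w in lebesgue_on U. h w = 0"
proof (rule compact_exhaustion_AE[OF U])
  fix C assume C: "compact C" "C \<subseteq> U"
  obtain r where r: "0 < r" "(\<Union>x\<in>C. cball x r) \<subseteq> U"
    using compact_subset_open_imp_cball_epsilon_subset[OF C(1) U C(2)] by blast
  \<comment> \<open>A compact neighbourhood of \<open>C\<close> inside \<open>U\<close> holding the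
    supports of all kernels centred in \<open>C\<close> with radius below \<open>r\<close>. Cutting
    \<open>h\<close> off outside it gives a globally integrable \<open>H\<close> without changing
    the mollifications on \<open>C\<close>.\<close>
  define C' where "C' = {x + y | x y. x \<in> C \<and> y \<in> cball 0 r}"
  have C': "compact C'" unfolding C'_def by (rule compact_sums) (use C in auto)
  have C'U: "C' \<subseteq> U"
    using r(2) by (force simp: C'_def dist_norm)
  have near: "z \<in> C'" if "w \<in> C" "dist w z \<le> r" for w z
  proof -
    have "z = w + (z - w) \<and> w \<in> C \<and> z - w \<in> cball 0 r"
      using that by (simp add: dist_norm norm_minus_commute)
    then show ?thesis unfolding C'_def by blast
  qed
  have Cm: "C \<in> sets lebesgue" "C' \<in> sets lebesgue" using C(1) C' by (auto simp: borel_compact)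
  define H where "H w = (if w \<in> C' then h w else 0)" for w
  have "integrable (lebesgue_on C') h" using h C' C'U by (auto simp: locally_integrable_def)
  then have H: "integrable lebesgue H"
    unfolding H_def using Lebesgue_Measure.integrable_restrict_UNIV[OF Cm(2)] by blast
  have zero: "conv H (ckern \<delta>) w = 0" if \<delta>: "0 < \<delta>" "\<delta> < r" and w: "w \<in> C" for w \<delta>
  proof -
    have t: "test_function U (\<lambda>z. ckern \<delta> (w - z))"
    proof (rule test_functionI[of _ C'])
      show "z \<notin> C' \<Longrightarrow> ckern \<delta> (w - z) = 0" for z
        using near[OF w, of z] kern_eq_0[OF \<delta>(1), of "w - z"] \<delta> by (force simp: dist_norm)
    qed (use Ck_kern_shift C' C'U in auto)
    have "conv H (ckern \<delta>) w = (LINT z|lebesgue. h z * ckern \<delta> (w - z))"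
      unfolding conv_def
    proof (rule Bochner_Integration.integral_cong[OF refl])
      fix z
      show "H z * ckern \<delta> (w - z) = h z * ckern \<delta> (w - z)"
        using near[OF w, of z] kern_eq_0[OF \<delta>(1), of "w - z"] \<delta>
        by (cases "z \<in> C'"; cases "dist w z \<le> r") (simp_all add: H_def dist_norm)
    qed
    also have "\<dots> = (LINT z|lebesgue_on U. h z * ckern \<delta> (w - z))"
      by (rule integral_lebesgue_on_eq(1)[symmetric]) (use U test_function_outside[OF t] in auto)
    also have "\<dots> = 0" by (rule z[OF t])
    finally show ?thesis .
  qed
  let ?I = "LINT w|lebesgue_on C. norm (H w)"
  have HC: "integrable lebesgue (\<lambda>w. indicator C w *\<^sub>R norm (H w))"
    using H Cm by (intro integrable_mult_indicator) auto
  have "?I < e" if "0 < e" for e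
  proof -
    obtain d where d: "0 < d" "\<And>\<delta>. 0 < \<delta> \<Longrightarrow> \<delta> < d \<Longrightarrow> (LINT w|lebesgue. norm (conv H (ckern \<delta>) w - H w)) < e"
      using conv_kern_L1[OF H \<open>0 < e\<close>] by blast
    define \<delta> where "\<delta> = min d r / 2"
    have \<delta>: "0 < \<delta>" "\<delta> < d" "\<delta> < r" using d(1) r(1) by (auto simp: \<delta>_def)
    have "?I = (LINT w|lebesgue. indicator C w *\<^sub>R norm (H w))"
      using Cm by (simp add: Bochner_Integration.integral_restrict_space)
    also have "\<dots> \<le> (LINT w|lebesgue. norm (conv H (ckern \<delta>) w - H w))"
      by (rule integral_mono[OF HC])
        (use integrable_conv_kern(1)[OF H \<delta>(1)] H zero[OF \<delta>(1,3)] in \<open>auto simp: indicator_def\<close>)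
    also have "\<dots> < e" using d(2) \<delta> by blast
    finally show ?thesis .
  qed
  moreover have "0 \<le> ?I" by simp
  ultimately have "?I = 0" by (metis less_irrefl not_le order_antisym)
  moreover have "integrable (lebesgue_on C) (\<lambda>w. norm (H w))"
    using HC Cm by (simp add: integrable_restrict_space)
  ultimately have "AE w in lebesgue_on C. norm (H w) = 0"
    by (subst (asm) integral_nonneg_eq_0_iff_AE) auto
  moreover have "AE w in lebesgue_on C. w \<in> C" by (rule AE_I2) simp
  ultimately show "AE w in lebesgue_on C. h w = 0"
    by eventually_elim (use near r in \<open>force simp: H_def\<close>)
qed

section \<open>Uniqueness and algebra of weak derivatives\<close>

lemma has_weak_derivativeD:
  assumes "has_weak_derivative U e f g" "test_function U \<eta>" and U: "open U"
  shows "integrable (lebesgue_on U) (\<lambda>w. f w * fderiv \<eta> w e)"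
    "integrable (lebesgue_on U) (\<lambda>w. g w * \<eta> w)"
    "(LINT w|lebesgue_on U. f w * fderiv \<eta> w e) = - (LINT w|lebesgue_on U. g w * \<eta> w)"
proof -
  have "locally_integrable U f" "locally_integrable U g" using assms(1) by (simp_all add: has_weak_derivative_def)
  then show "integrable (lebesgue_on U) (\<lambda>w. f w * fderiv \<eta> w e)"
    "integrable (lebesgue_on U) (\<lambda>w. g w * \<eta> w)"
    using locally_integrable_mult_test(2)[OF _ _ U] assms(2) test_function_frechet_derivative by blast+
  show "(LINT w|lebesgue_on U. f w * fderiv \<eta> w e) = - (LINT w|lebesgue_on U. g w * \<eta> w)"
    using assms(1,2) by (simp add: has_weak_derivative_def)
qed

lemma has_weak_derivative_unique_AE:
  assumes U: "open U" and g: "has_weak_derivative U e f g" "has_weak_derivative U e f g'"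
  shows "AE w in lebesgue_on U. g w = g' w"
proof -
  have "AE w in lebesgue_on U. g w - g' w = 0"
  proof (rule locally_integrable_zero_AE[OF U])
    show "locally_integrable U (\<lambda>w. g w - g' w)"
      using g by (auto simp: has_weak_derivative_def locally_integrable_def)
    fix \<eta> assume t: "test_function U \<eta>"
    have "(LINT w|lebesgue_on U. g w * \<eta> w) = (LINT w|lebesgue_on U. g' w * \<eta> w)"
      using has_weak_derivativeD(3)[OF g(1) t U] has_weak_derivativeD(3)[OF g(2) t U] by simp
    moreover note has_weak_derivativeD(2)[OF g(1) t U] has_weak_derivativeD(2)[OF g(2) t U]
    ultimately show "(LINT w|lebesgue_on U. (g w - g' w) * \<eta> w) = 0"
      by (simp add: left_diff_distrib)
  qed
  then show ?thesis by simp
qed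

lemma weak_derivative_works: "has_weak_derivative U e f g \<Longrightarrow> has_weak_derivative U e f (weak_derivative U e f)"
  unfolding weak_derivative_def by (rule someI[where P = "has_weak_derivative U e f"])

lemma weak_derivative_AE:
  "open U \<Longrightarrow> has_weak_derivative U e f g \<Longrightarrow> AE w in lebesgue_on U. weak_derivative U e f w = g w"
  using has_weak_derivative_unique_AE weak_derivative_works by blast

lemma has_weak_derivative_cong:
  assumes "\<And>w. w \<in> U \<Longrightarrow> f w = f' w"
  shows "has_weak_derivative U e f g \<longleftrightarrow> has_weak_derivative U e f' g"
proof -
  have "locally_integrable U f \<longleftrightarrow> locally_integrable U f'"
    unfolding locally_integrable_def using assms
    by (intro all_cong1 imp_cong refl Bochner_Integration.integrable_cong) auto
  moreover have "(LINT w|lebesgue_on U. f w * fderiv \<eta> w e)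
     = (LINT w|lebesgue_on U. f' w * fderiv \<eta> w e)" for \<eta>
    by (intro Bochner_Integration.integral_cong) (use assms in auto)
  ultimately show ?thesis unfolding has_weak_derivative_def by simp
qed

text \<open>The equality is literal and not only almost everywhere: functions that agree on
  \<open>U\<close> have the same candidates for a weak derivative, and the choice operator depends
  only on that set.\<close>

lemma weak_derivative_cong:
  assumes "\<And>w. w \<in> U \<Longrightarrow> f w = f' w"
  shows "weak_derivative U e f = weak_derivative U e f'"
proof -
  have "has_weak_derivative U e f = has_weak_derivative U e f'"
    using has_weak_derivative_cong[OF assms, of U] by (simp add: fun_eq_iff)
  then show ?thesis by (simp add: weak_derivative_def)
qed

lemma has_weak_derivative_add:
  assumes U: "open U" and f: "has_weak_derivative U e f g" and f': "has_weak_derivative U e f' g'"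
  shows "has_weak_derivative U e (\<lambda>w. f w + f' w) (\<lambda>w. g w + g' w)"
  unfolding has_weak_derivative_def
proof (intro conjI allI impI)
  show "locally_integrable U (\<lambda>w. f w + f' w)" "locally_integrable U (\<lambda>w. g w + g' w)"
    using f f' by (auto simp: has_weak_derivative_def locally_integrable_def)
  fix \<eta> assume t: "test_function U \<eta>"
  note t' = test_function_frechet_derivative[OF t, of e]
  note has_weak_derivativeD[OF f t U] has_weak_derivativeD[OF f' t U]
  then show "(LINT w|lebesgue_on U. (f w + f' w) * fderiv \<eta> w e) = - (LINT w|lebesgue_on U. (g w + g' w) * \<eta> w)"
    by (simp add: distrib_right)
qed

lemma has_weak_derivative_cmult:
  assumes "has_weak_derivative U e f g"
  shows "has_weak_derivative U e (\<lambda>w. c * f w) (\<lambda>w. c * g w)"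
  using assms by (auto simp: has_weak_derivative_def locally_integrable_def mult.assoc)

lemma has_weak_derivative_diff:
  assumes "open U" and "has_weak_derivative U e f g" "has_weak_derivative U e f' g'"
  shows "has_weak_derivative U e (\<lambda>w. f w - f' w) (\<lambda>w. g w - g' w)"
  using has_weak_derivative_add[OF assms(1,2) has_weak_derivative_cmult[OF assms(3), of "-1"]] by simp

lemma has_weak_derivative_cnj:
  assumes "has_weak_derivative U e f g"
  shows "has_weak_derivative U e (\<lambda>w. cnj (f w)) (\<lambda>w. cnj (g w))"
  unfolding has_weak_derivative_def
proof (intro conjI allI impI)
  show "locally_integrable U (\<lambda>w. cnj (f w))" "locally_integrable U (\<lambda>w. cnj (g w))"
    using assms by (auto simp: has_weak_derivative_def locally_integrable_def)
  fix \<eta> assume t: "test_function U \<eta>"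
  have "(LINT w|lebesgue_on U. f w * fderiv (\<lambda>w. cnj (\<eta> w)) w e) = - (LINT w|lebesgue_on U. g w * cnj (\<eta> w))"
    using assms test_function_cnj[OF t] by (auto simp: has_weak_derivative_def)
  then have "cnj (LINT w|lebesgue_on U. f w * cnj (fderiv \<eta> w e)) = cnj (- (LINT w|lebesgue_on U. g w * cnj (\<eta> w)))"
    by (simp add: frechet_derivative_cnj[OF test_function_differentiable[OF t]])
  then show "(LINT w|lebesgue_on U. cnj (f w) * fderiv \<eta> w e) = - (LINT w|lebesgue_on U. cnj (g w) * \<eta> w)"
    by (simp flip: Bochner_Integration.integral_cnj)
qed

lemma locally_integrable_continuous:
  assumes "continuous_on U f" shows "locally_integrable U f"
  unfolding locally_integrable_def
proof (intro allI impI)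
  fix C assume C: "compact C \<and> C \<subseteq> U"
  then have "integrable lborel (\<lambda>x. indicator C x *\<^sub>R f x)"
    by (intro borel_integrable_compact continuous_on_subset[OF assms]) auto
  then show "integrable (lebesgue_on C) f"
    using C by (simp add: integrable_restrict_space borel_compact integrable_lborel_lebesgue)
qed

text \<open>Classical integration by parts: the product with a test function is differentiable
  everywhere with compact support, so its directional derivative integrates to 0.\<close>

lemma has_weak_derivative_continuous:
  assumes U: "open U" and d: "\<And>w. (f has_derivative f' w) (at w)" and c: "continuous_on UNIV (\<lambda>w. f' w e)"
  shows "has_weak_derivative U e f (\<lambda>w. f' w e)"
  unfolding has_weak_derivative_def
proof (intro conjI allI impI)
  have cf: "continuous_on UNIV f"
    by (intro continuous_at_imp_continuous_on ballI has_derivative_continuous[OF d])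
  show l: "locally_integrable U f" "locally_integrable U (\<lambda>w. f' w e)"
    by (auto intro!: locally_integrable_continuous intro: continuous_on_subset[OF cf] continuous_on_subset[OF c])
  fix \<eta> assume t: "test_function U \<eta>"
  obtain K where K: "compact K" "K \<subseteq> U" "\<And>w. w \<notin> K \<Longrightarrow> \<eta> w = 0"
    using test_functionE[OF t] by blast
  note t' = test_function_frechet_derivative[OF t, of e]
  have "(LINT w|lebesgue. f w * fderiv \<eta> w e + f' w e * \<eta> w) = 0"
    by (rule integral_derivative_compact_support[OF has_derivative_mult[OF d test_function_has_derivative[OF t]] _ K(1)])
      (use K(3) in \<open>auto intro!: continuous_intros cf c test_function_continuous[OF t] test_function_continuous[OF t']\<close>)
  then have "(LINT w|lebesgue. f w * fderiv \<eta> w e) = - (LINT w|lebesgue. f' w e * \<eta> w)"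
    using locally_integrable_mult_test(1)[OF l(1) t' U] locally_integrable_mult_test(1)[OF l(2) t U]
    by (simp add: eq_neg_iff_add_eq_0)
  then show "(LINT w|lebesgue_on U. f w * fderiv \<eta> w e) = - (LINT w|lebesgue_on U. f' w e * \<eta> w)"
    using U test_function_outside[OF t] test_function_outside[OF t']
    by (simp add: integral_lebesgue_on_eq(1))
qed

lemma has_weak_derivative_test:
  assumes "open U" "test_function V \<eta>"
  shows "has_weak_derivative U e \<eta> (\<lambda>w. fderiv \<eta> w e)"
  by (rule has_weak_derivative_continuous[OF assms(1) test_function_has_derivative[OF assms(2)]])
    (rule test_function_continuous[OF test_function_frechet_derivative[OF assms(2)]])

text \<open>Carries a local statement on \<open>U\<close> to the whole plane, where mollification is
  available. The product rule results from testing the given derivative with \<eta> \<kappa>, which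
  is a test function on \<open>U\<close> even when \<eta> is not.\<close>

lemma has_weak_derivative_cutoff:
  assumes U: "open U" and \<kappa>: "test_function U \<kappa>" and f: "has_weak_derivative U e f g"
  shows "has_weak_derivative UNIV e (\<lambda>w. f w * \<kappa> w) (\<lambda>w. g w * \<kappa> w + f w * fderiv \<kappa> w e)"
  unfolding has_weak_derivative_def
proof (intro conjI allI impI)
  have lf: "locally_integrable U f" "locally_integrable U g" using f by (auto simp: has_weak_derivative_def)
  note \<kappa>' = test_function_frechet_derivative[OF \<kappa>, of e]
  have i: "integrable lebesgue (\<lambda>w. f w * \<kappa> w)" "integrable lebesgue (\<lambda>w. g w * \<kappa> w)"
     "integrable lebesgue (\<lambda>w. f w * fderiv \<kappa> w e)"
    using lf \<kappa> \<kappa>' U by (simp_all add: locally_integrable_mult_test(1))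
  show "locally_integrable UNIV (\<lambda>w. f w * \<kappa> w)"
     "locally_integrable UNIV (\<lambda>w. g w * \<kappa> w + f w * fderiv \<kappa> w e)"
    using i by (auto simp: locally_integrable_def integrable_restrict_space borel_compact intro!: integrable_mult_indicator Bochner_Integration.integrable_add)
  fix \<eta> assume t: "test_function UNIV \<eta>"
  have t2: "test_function U (\<lambda>w. \<eta> w * \<kappa> w)" by (rule test_function_mult[OF \<kappa> test_function_Ck[OF t]])
  have t3: "test_function U (\<lambda>w. fderiv \<eta> w e * \<kappa> w)"
    by (rule test_function_mult[OF \<kappa> test_function_Ck[OF test_function_frechet_derivative[OF t]]])
  have t4: "test_function U (\<lambda>w. \<eta> w * fderiv \<kappa> w e)"
    by (rule test_function_mult[OF \<kappa>' test_function_Ck[OF t]])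
  note t5 = test_function_frechet_derivative[OF t2, of e]
  have "(LINT w|lebesgue_on U. f w * fderiv (\<lambda>w. \<eta> w * \<kappa> w) w e) = - (LINT w|lebesgue_on U. g w * (\<eta> w * \<kappa> w))"
    using f t2 by (auto simp: has_weak_derivative_def)
  then have "(LINT w|lebesgue. f w * fderiv (\<lambda>w. \<eta> w * \<kappa> w) w e) = - (LINT w|lebesgue. g w * (\<eta> w * \<kappa> w))"
    using U test_function_outside[OF t2] test_function_outside[OF t5]
    by (subst (asm) (1 2) integral_lebesgue_on_eq(1)) auto
  then have "(LINT w|lebesgue. f w * (\<eta> w * fderiv \<kappa> w e) + f w * (fderiv \<eta> w e * \<kappa> w)) = - (LINT w|lebesgue. g w * (\<eta> w * \<kappa> w))"
    by (simp add: frechet_derivative_mult test_function_differentiable[OF t] test_function_differentiable[OF \<kappa>] distrib_left)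
  then have "(LINT w|lebesgue. f w * (fderiv \<eta> w e * \<kappa> w)) = - ((LINT w|lebesgue. g w * (\<eta> w * \<kappa> w)) + (LINT w|lebesgue. f w * (\<eta> w * fderiv \<kappa> w e)))"
    unfolding Bochner_Integration.integral_add[OF locally_integrable_mult_test(1)[OF lf(1) t4 U] locally_integrable_mult_test(1)[OF lf(1) t3 U]]
    by (simp only: eq_neg_iff_add_eq_0 add_ac)
  then show "(LINT w|lebesgue_on UNIV. f w * \<kappa> w * fderiv \<eta> w e) =
      - (LINT w|lebesgue_on UNIV. (g w * \<kappa> w + f w * fderiv \<kappa> w e) * \<eta> w)"
  proof -
    assume *: "(LINT w|lebesgue. f w * (fderiv \<eta> w e * \<kappa> w)) = - ((LINT w|lebesgue. g w * (\<eta> w * \<kappa> w)) + (LINT w|lebesgue. f w * (\<eta> w * fderiv \<kappa> w e)))"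
    have 1: "(\<lambda>w. f w * \<kappa> w * fderiv \<eta> w e) = (\<lambda>w. f w * (fderiv \<eta> w e * \<kappa> w))"
      by (rule ext) (simp only: mult_ac)
    have 2: "(\<lambda>w. (g w * \<kappa> w + f w * fderiv \<kappa> w e) * \<eta> w) = (\<lambda>w. g w * (\<eta> w * \<kappa> w) + f w * (\<eta> w * fderiv \<kappa> w e))"
      by (rule ext) (simp add: algebra_simps)
    show ?thesis
      unfolding 1 2 lebesgue_on_UNIV_eq *
        Bochner_Integration.integral_add[OF locally_integrable_mult_test(1)[OF lf(2) t2 U] locally_integrable_mult_test(1)[OF lf(1) t4 U]] ..
  qed
qed

text \<open>Mollify a piecewise linear function of the distance to \<open>K\<close>.\<close>

lemma cutoff_exists:
  assumes U: "open U" and K: "compact K" "K \<subseteq> U"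
  obtains \<kappa> V where "test_function U \<kappa>" "open V" "K \<subseteq> V" "\<And>w. w \<in> V \<Longrightarrow> \<kappa> w = 1"
proof (cases "K = {}")
  case True
  have "test_function U (\<lambda>_. 0)" by (rule test_functionI[of _ "{}"]) auto
  then show ?thesis using that[of "\<lambda>_. 0" "{}"] True by simp
next
  case False
  obtain r where r: "0 < r" "(\<Union>x\<in>K. cball x r) \<subseteq> U"
    using compact_subset_open_imp_cball_epsilon_subset[OF K(1) U K(2)] by blast
  \<comment> \<open>Four layers of width \<open>d\<close> fit into \<open>r\<close>:
    \<open>f\<close> is 1 up to distance \<open>2 * d\<close> and 0 from \<open>3 * d\<close> on;
    mollifying with radius \<open>d\<close> leaves the value 1 within \<open>d\<close> and enlarges
    the support to at most \<open>4 * d\<close>.\<close>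
  define d where "d = r / 4"
  have d: "0 < d" using r by (simp add: d_def)
  define f where "f w = complex_of_real (max 0 (min 1 (3 - infdist w K / d)))" for w
  have cf: "continuous_on UNIV f" unfolding f_def using d by (intro continuous_intros) auto
  have c: "compact {w. infdist w K \<le> a * d}" if "0 < a" for a
    using compact_infdist_le[OF False K(1), of "a * d"] that d by simp
  have f0: "f w = 0" if "w \<notin> {w. infdist w K \<le> 3 * d}" for w
    using that d by (simp add: f_def field_simps)
  have f1: "f w = 1" if "infdist w K \<le> 2 * d" for w
    using that d by (simp add: f_def field_simps)
  have tri: "infdist z K \<le> infdist w K + dist w z" for w z
    using infdist_triangle[of z K w] by (simp add: dist_commute)
  show ?thesis
  proof (rule that)
    show "test_function U (conv f (ckern d))"
    proof (rule test_functionI)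
      show "Ck k (conv f (ckern d))" for k
        using Ck_conv[OF cf c[of 3] f0 Ck_kern] by simp
      show "compact {w. infdist w K \<le> 4 * d}" by (rule c) simp
      show "{w. infdist w K \<le> 4 * d} \<subseteq> U"
      proof
        fix w assume w: "w \<in> {w. infdist w K \<le> 4 * d}"
        obtain x where "x \<in> K" "infdist w K = dist w x"
          using infdist_attains_inf[OF compact_imp_closed[OF K(1)] False] by metis
        then have "w \<in> cball x r" using w by (simp add: d_def dist_commute)
        then show "w \<in> U" using r(2) \<open>x \<in> K\<close> by blast
      qed
      fix w assume w: "w \<notin> {w. infdist w K \<le> 4 * d}"
      show "conv f (ckern d) w = 0"
      proof (rule conv_kern_support[where K = "{w. infdist w K \<le> 3 * d}", OF f0 d])
        fix z assume "z \<in> {w. infdist w K \<le> 3 * d}"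
        then show "d \<le> dist w z" using w tri[where w = z and z = w] by (simp add: dist_commute)
      qed
    qed
    show "open {w. infdist w K < d}"
      by (intro open_Collect_less continuous_intros)
    show "K \<subseteq> {w. infdist w K < d}" using d by auto
    fix w assume w: "w \<in> {w. infdist w K < d}"
    \<comment> \<open>The averaging estimate with error 0: \<open>f\<close> is constantly 1 on the
      ball of radius \<open>d\<close> around \<open>w\<close>.\<close>
    have "norm (conv f (ckern d) w - f w) \<le> 0"
    proof (rule conv_kern_dist_le[OF cf c[of 3] f0 d])
      fix z assume "dist w z < d"
      then have "f w = 1" "f z = 1" using w tri[of z w] d by (auto intro!: f1)
      then show "dist (f w) (f z) \<le> 0" by simp
    qed auto
    then show "conv f (ckern d) w = 1" using f1[of w] w d by simp
  qed
qed

section \<open>Mollification and the chain rule\<close>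

lemma frechet_derivative_apply: "(f has_derivative f') (at w) \<Longrightarrow> fderiv f w e = f' e"
  using frechet_derivative_at[of f f' w] by simp

lemma frechet_derivative_of_real_flat_exp:
  "fderiv (\<lambda>w::complex. complex_of_real (flat_exp k (1 - w \<bullet> w))) w e
    = of_real (- 2 * (w \<bullet> e) * (flat_exp (k + 2) (1 - w \<bullet> w) - real k * flat_exp (k + 1) (1 - w \<bullet> w)))"
proof -
  have "((\<lambda>w::complex. 1 - w \<bullet> w) has_derivative (\<lambda>e. - 2 * (w \<bullet> e))) (at w)"
    by (auto intro!: derivative_eq_intros simp: inner_commute)
  from has_derivative_of_real[OF has_derivative_compose[OF this flat_exp_derivative[unfolded has_field_derivative_def]]]
  have "((\<lambda>w::complex. complex_of_real (flat_exp k (1 - w \<bullet> w))) has_derivative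
    (\<lambda>e. of_real ((flat_exp (k + 2) (1 - w \<bullet> w) - real k * flat_exp (k + 1) (1 - w \<bullet> w)) * (- 2 * (w \<bullet> e))))) (at w)" .
  from frechet_derivative_apply[OF this, of e] show ?thesis by (simp only: mult.commute)
qed

text \<open>An explicit computation. The first derivative in direction \<open>d\<close> is
  \<open>- 2 * (w \<bullet> d)\<close> times a radial function, and differentiating once more gives
  terms in \<open>(w \<bullet> d) * (w \<bullet> e)\<close> and \<open>d \<bullet> e\<close>,
  symmetric in \<open>d\<close> and \<open>e\<close>. The symmetry passes to the scaled kernel, then
  to every mollified function, and makes the mixed terms cancel in the integration by parts of a
  Jacobian.\<close>

lemma bump_second_derivative_symmetric:
  "fderiv (\<lambda>w. fderiv (\<lambda>w. of_real (bump w)) w d) w e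
    = fderiv (\<lambda>w. fderiv (\<lambda>w. complex_of_real (bump w)) w e) w d"
proof -
  let ?h = "\<lambda>k (w::complex). complex_of_real (flat_exp k (1 - w \<bullet> w))"
  have D: "fderiv (\<lambda>w. complex_of_real (bump w)) w d = of_real (- 2 * (w \<bullet> d)) * ?h 2 w" for w d
    unfolding bump_def using frechet_derivative_of_real_flat_exp[of 0 w d] by (simp add: numeral_2_eq_2)
  have DD: "fderiv (\<lambda>w. of_real (- 2 * (w \<bullet> d)) * ?h 2 w) w e
      = of_real (- 2 * (w \<bullet> d)) * fderiv (?h 2) w e + of_real (- 2 * (e \<bullet> d)) * ?h 2 w" for d e
  proof -
    have l: "((\<lambda>w. complex_of_real (- 2 * (w \<bullet> d))) has_derivative (\<lambda>e. of_real (- 2 * (e \<bullet> d)))) (at w)"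
      by (auto intro!: derivative_eq_intros)
    have "((\<lambda>w. of_real (- 2 * (w \<bullet> d)) * ?h 2 w) has_derivative
       (\<lambda>e. of_real (- 2 * (w \<bullet> d)) * fderiv (?h 2) w e + of_real (- 2 * (e \<bullet> d)) * ?h 2 w)) (at w)"
      by (rule has_derivative_mult[OF l Ck_differentiable[OF Ck_flat_exp]])
    then show ?thesis by (rule frechet_derivative_apply)
  qed
  show ?thesis
    unfolding D DD frechet_derivative_of_real_flat_exp by (simp add: inner_commute[of d e])
qed

lemma ckern_second_derivative_symmetric:
  "fderiv (\<lambda>w. fderiv (ckern \<delta>) w d) w e
    = fderiv (\<lambda>w. fderiv (ckern \<delta>) w e) w d"
proof -
  let ?b = "\<lambda>w. complex_of_real (bump w)"
  define c where "c = complex_of_real (inverse (LINT z|lborel. bump (z /\<^sub>R \<delta>)))"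
  have k: "ckern \<delta> = (\<lambda>w. c * ?b (inverse \<delta> *\<^sub>R w))"
    by (auto simp: kern_def c_def divide_inverse)
  have scale: "fderiv (\<lambda>w. c * f (inverse \<delta> *\<^sub>R w)) w e
      = c * fderiv f (inverse \<delta> *\<^sub>R w) (inverse \<delta> *\<^sub>R e)"
    if "Ck 1 f" for f w e
  proof -
    have "((\<lambda>w. inverse \<delta> *\<^sub>R w) has_derivative (\<lambda>e. inverse \<delta> *\<^sub>R e)) (at w)"
      by (auto intro!: derivative_eq_intros)
    from has_derivative_mult_right[OF has_derivative_compose[OF this Ck_differentiable[of 0]], of f c] that
    have "((\<lambda>w. c * f (inverse \<delta> *\<^sub>R w)) has_derivative (\<lambda>e. c * fderiv f (inverse \<delta> *\<^sub>R w) (inverse \<delta> *\<^sub>R e))) (at w)"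
      by simp
    then show ?thesis by (rule frechet_derivative_apply)
  qed
  have C1: "Ck 1 ?b" by (rule Ck_bump)
  have C2: "Ck 1 (\<lambda>w. fderiv ?b w d)" for d
    using Ck_bump[of "Suc 1", unfolded Ck.simps(2)[of 1]] by blast
  show ?thesis
    unfolding k scale[OF C1] scale[OF C2] by (subst bump_second_derivative_symmetric) (rule refl)
qed

section \<open>Mollified functions as smooth approximations\<close>

definition moll :: "nat \<Rightarrow> (complex \<Rightarrow> complex) \<Rightarrow> complex \<Rightarrow> complex" where
  "moll n f = conv f (ckern (inverse (real (Suc n))))"

lemma inverse_Suc_pos: "0 < inverse (real (Suc n))"
  by (rule positive_imp_inverse_positive) simp

lemma inverse_Suc_less: "0 < d \<Longrightarrow> \<forall>\<^sub>F n in sequentially. inverse (real (Suc n)) < d"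
  using LIMSEQ_inverse_real_of_nat order_tendstoD(2) by blast

lemma moll_L1_tendsto:
  assumes "integrable lebesgue H"
  shows "(\<lambda>n. LINT w|lebesgue. norm (moll n H w - H w)) \<longlonglongrightarrow> 0"
proof (rule LIMSEQ_I)
  fix e :: real assume "0 < e"
  then obtain d where d: "0 < d" "\<And>\<delta>. 0 < \<delta> \<Longrightarrow> \<delta> < d \<Longrightarrow> (LINT w|lebesgue. norm (conv H (ckern \<delta>) w - H w)) < e"
    using conv_kern_L1[OF assms] by blast
  obtain N where N: "\<And>n. n \<ge> N \<Longrightarrow> inverse (real (Suc n)) < d"
    using inverse_Suc_less[OF d(1)] by (auto simp: eventually_sequentially)
  show "\<exists>N. \<forall>n\<ge>N. norm ((LINT w|lebesgue. norm (moll n H w - H w)) - 0) < e"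
    using d(2)[OF _ N] by (intro exI[of _ N]) (simp add: moll_def)
qed

lemma integrable_moll: "integrable lebesgue H \<Longrightarrow> integrable lebesgue (moll n H)"
  unfolding moll_def by (rule integrable_conv_kern) auto

lemma moll_tendsto:
  assumes f: "continuous_on UNIV f" "compact K" "\<And>w. w \<notin> K \<Longrightarrow> f w = 0"
  shows "(\<lambda>n. moll n f w) \<longlonglongrightarrow> f w"
proof (rule LIMSEQ_I)
  fix e :: real assume e: "0 < e"
  obtain d where d: "0 < d" "\<And>w z. dist w z < d \<Longrightarrow> dist (f w) (f z) < e / 2"
    using uniformly_continuous_compact_support[OF f, of "e / 2"] e by auto
  obtain N where N: "\<And>n. n \<ge> N \<Longrightarrow> inverse (real (Suc n)) < d"
    using inverse_Suc_less[OF d(1)] by (auto simp: eventually_sequentially)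
  have "norm (moll n f w - f w) \<le> e / 2" if "n \<ge> N" for n
    unfolding moll_def
    by (rule conv_kern_dist_le[OF f]) (use N[OF that] d(2)[of w] in \<open>auto intro!: less_imp_le\<close>)
  then show "\<exists>N. \<forall>n\<ge>N. norm (moll n f w - f w) < e"
    using e by (intro exI[of _ N]) fastforce
qed

lemma norm_conv_kern_le:
  assumes g: "integrable lebesgue g" and b: "AE w in lebesgue. norm (g w) \<le> M" and \<delta>: "0 < \<delta>"
  shows "norm (conv g (ckern \<delta>) w) \<le> M"
proof -
  have "norm (conv g (ckern \<delta>) w) \<le> (LINT z|lebesgue. M * kern \<delta> (w - z))"
    unfolding conv_def
  proof (rule order_trans[OF integral_norm_bound integral_mono_AE])
    show "integrable lebesgue (\<lambda>z. norm (g z * ckern \<delta> (w - z)))"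
      using integrable_shift_mult[OF g \<delta>] by (rule integrable_norm)
    show "integrable lebesgue (\<lambda>z. M * kern \<delta> (w - z))"
      using integrable_lborel_lebesgue[OF integral_kern_shift(2)[OF \<delta>]] by simp
    show "AE z in lebesgue. norm (g z * ckern \<delta> (w - z)) \<le> M * kern \<delta> (w - z)"
      using b by eventually_elim (use kern_nonneg[OF \<delta>] in \<open>simp add: norm_mult mult_right_mono\<close>)
  qed
  also have "\<dots> = (LINT z|lborel. M * kern \<delta> (w - z))"
    by (rule integral_completion) simp
  also have "\<dots> = M" by (simp add: integral_kern_shift[OF \<delta>])
  finally show ?thesis .
qed

text \<open>Mollification commutes with weak differentiation: the reflected kernel around
  \<open>w\<close> is itself a test function. The minus sign of the reflection cancels the one in
  the definition of the weak derivative.\<close>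

lemma frechet_derivative_conv_kern:
  assumes f: "continuous_on UNIV f" "compact K" "\<And>w. w \<notin> K \<Longrightarrow> f w = 0"
    and g: "has_weak_derivative UNIV e f g" and \<delta>: "0 < \<delta>"
  shows "fderiv (conv f (ckern \<delta>)) w e = conv g (ckern \<delta>) w"
proof -
  let ?k = "\<lambda>z. ckern \<delta> (w - z)"
  have t: "test_function UNIV ?k"
  proof (rule test_functionI[of _ "cball w \<delta>"])
    show "z \<notin> cball w \<delta> \<Longrightarrow> ckern \<delta> (w - z) = 0" for z
      using kern_eq_0[OF \<delta>, of "w - z"] by (simp add: dist_norm)
  qed (use Ck_kern_shift in auto)
  have kd: "fderiv ?k z e = - fderiv (ckern \<delta>) (w - z) e" for z
  proof -
    have "((\<lambda>z. w - z) has_derivative (\<lambda>e. - e)) (at z)"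
      by (auto intro!: derivative_eq_intros)
    from has_derivative_compose[OF this Ck_differentiable[OF Ck_kern]]
    have "(?k has_derivative (\<lambda>e. fderiv (ckern \<delta>) (w - z) (- e))) (at z)" .
    then have "fderiv ?k z e = fderiv (ckern \<delta>) (w - z) (- e)"
      by (rule frechet_derivative_apply)
    then show ?thesis
      using linear_neg[OF has_derivative_linear[OF Ck_differentiable[OF Ck_kern[of "Suc 0" \<delta>]]]] by simp
  qed
  have "fderiv (conv f (ckern \<delta>)) w e = conv f (\<lambda>w. fderiv (ckern \<delta>) w e) w"
    by (rule frechet_derivative_apply[OF conv_has_derivative[OF f Ck_kern]])
  also have "\<dots> = (LINT z|lebesgue. - (f z * fderiv ?k z e))"
    unfolding conv_def kd by simp
  also have "\<dots> = (LINT z|lebesgue. g z * ?k z)"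
    using has_weak_derivativeD(3)[OF g t] by (simp add: lebesgue_on_UNIV_eq)
  finally show ?thesis by (simp add: conv_def)
qed

lemma Ck_moll:
  assumes "continuous_on UNIV f" "compact K" "\<And>w. w \<notin> K \<Longrightarrow> f w = 0"
  shows "Ck k (moll n f)"
  unfolding moll_def by (rule Ck_conv[OF assms Ck_kern])

lemma frechet_derivative_moll:
  assumes "continuous_on UNIV f" "compact K" "\<And>w. w \<notin> K \<Longrightarrow> f w = 0"
    and "has_weak_derivative UNIV e f g"
  shows "fderiv (moll n f) w e = moll n g w"
  unfolding moll_def by (rule frechet_derivative_conv_kern[OF assms inverse_Suc_pos])

lemma moll_second_derivative_symmetric:
  assumes f: "continuous_on UNIV f" "compact K" "\<And>w. w \<notin> K \<Longrightarrow> f w = 0"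
  shows "fderiv (\<lambda>w. fderiv (moll n f) w d) w e
    = fderiv (\<lambda>w. fderiv (moll n f) w e) w d"
proof -
  let ?k = "ckern (inverse (real (Suc n)))"
  have 1: "fderiv (conv f \<rho>) w e = conv f (\<lambda>w. fderiv \<rho> w e) w"
    if "Ck 1 \<rho>" for \<rho> w e
    by (rule frechet_derivative_apply[OF conv_has_derivative[OF f that]])
  have C2: "Ck 1 (\<lambda>w. fderiv ?k w d)" for d
    using Ck_kern[of "Suc 1", unfolded Ck.simps(2)[of 1]] by blast
  show ?thesis
    unfolding moll_def 1[OF Ck_kern] 1[OF C2] by (subst ckern_second_derivative_symmetric) (rule refl)
qed

text \<open>The limit passage used throughout: one factor is bounded and converges almost
  everywhere, the other converges in L1. Splitting off \<open>a n w * (G n w - Gl w)\<close> leaves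
  a dominated convergence with the fixed majorant \<open>C * norm (Gl w)\<close>.\<close>

lemma L1_mult_tendsto:
  fixes a :: "nat \<Rightarrow> 'x \<Rightarrow> complex"
  assumes am: "\<And>n. a n \<in> borel_measurable M" "al \<in> borel_measurable M"
    and ab: "\<And>n. AE w in M. norm (a n w) \<le> C" and a: "AE w in M. (\<lambda>n. a n w) \<longlonglongrightarrow> al w"
    and G: "\<And>n. integrable M (G n)" "integrable M Gl" "(\<lambda>n. LINT w|M. norm (G n w - Gl w)) \<longlonglongrightarrow> 0"
  shows "(\<lambda>n. LINT w|M. a n w * G n w) \<longlonglongrightarrow> (LINT w|M. al w * Gl w)"
proof -
  have i: "integrable M (\<lambda>w. a n w * h w)" if "integrable M h" for n h
    using integrable_mult_bounded[OF that am(1)[of n] ab[of n]] by (simp add: mult.commute)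
  have "(\<lambda>n. LINT w|M. a n w * (G n w - Gl w)) \<longlonglongrightarrow> 0"
  proof (rule Lim_null_comparison)
    show "\<forall>\<^sub>F n in sequentially. norm (LINT w|M. a n w * (G n w - Gl w)) \<le> C * (LINT w|M. norm (G n w - Gl w))"
    proof (intro always_eventually allI)
      fix n
      have "norm (LINT w|M. a n w * (G n w - Gl w)) \<le> (LINT w|M. C * norm (G n w - Gl w))"
      proof (rule order_trans[OF integral_norm_bound integral_mono_AE])
        show "integrable M (\<lambda>w. norm (a n w * (G n w - Gl w)))" "integrable M (\<lambda>w. C * norm (G n w - Gl w))"
          using G i by auto
        show "AE w in M. norm (a n w * (G n w - Gl w)) \<le> C * norm (G n w - Gl w)"
          using ab[of n] by eventually_elim (simp add: norm_mult mult_right_mono)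
      qed
      then show "norm (LINT w|M. a n w * (G n w - Gl w)) \<le> C * (LINT w|M. norm (G n w - Gl w))" by simp
    qed
    show "(\<lambda>n. C * (LINT w|M. norm (G n w - Gl w))) \<longlonglongrightarrow> 0"
      using tendsto_mult_left[OF G(3), of C] by simp
  qed
  moreover have "(\<lambda>n. LINT w|M. a n w * Gl w) \<longlonglongrightarrow> (LINT w|M. al w * Gl w)"
  proof (rule integral_dominated_convergence[where w = "\<lambda>w. C * norm (Gl w)"])
    show "AE w in M. (\<lambda>n. a n w * Gl w) \<longlonglongrightarrow> al w * Gl w"
      using a by eventually_elim (intro tendsto_intros)
    show "AE w in M. norm (a n w * Gl w) \<le> C * norm (Gl w)" for n
      using ab[of n] by eventually_elim (simp add: norm_mult mult_right_mono)
  qed (use am G in auto)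
  ultimately have "(\<lambda>n. (LINT w|M. a n w * (G n w - Gl w)) + (LINT w|M. a n w * Gl w)) \<longlonglongrightarrow> 0 + (LINT w|M. al w * Gl w)"
    by (rule tendsto_add)
  moreover have "(LINT w|M. a n w * (G n w - Gl w)) + (LINT w|M. a n w * Gl w) = (LINT w|M. a n w * G n w)" for n
    using i[OF G(1), of n] i[OF G(2), of n] by (simp add: right_diff_distrib)
  ultimately show ?thesis by simp
qed

lemma continuous_mult_test:
  assumes "open U" "continuous_on U f" "test_function U \<kappa>"
  shows "continuous_on UNIV (\<lambda>w. f w * \<kappa> w)"
proof -
  obtain K where K: "compact K" "K \<subseteq> U" "\<And>w. w \<notin> K \<Longrightarrow> \<kappa> w = 0"
    using test_functionE[OF assms(3)] by blast
  have "continuous_on (U \<union> - K) (\<lambda>w. f w * \<kappa> w)"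
  proof (rule continuous_on_open_Un)
    show "continuous_on U (\<lambda>w. f w * \<kappa> w)"
      by (intro continuous_intros assms(2) continuous_on_subset[OF test_function_continuous[OF assms(3)]]) auto
    have "continuous_on (- K) (\<lambda>w. 0 :: complex)" by (rule continuous_on_const)
    then show "continuous_on (- K) (\<lambda>w. f w * \<kappa> w)"
      by (rule continuous_on_eq) (use K(3) in auto)
  qed (use assms K compact_imp_closed in auto)
  moreover have "U \<union> - K = UNIV" using K by auto
  ultimately show ?thesis by simp
qed

lemma frechet_derivative_of_real_expand:
  fixes \<zeta> :: "complex \<Rightarrow> complex"
  assumes "\<zeta> differentiable (at y)"
  shows "fderiv \<zeta> y x = of_real (Re x) * fderiv \<zeta> y 1 + of_real (Im x) * fderiv \<zeta> y \<i>"
proof -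
  interpret linear "fderiv \<zeta> y"
    using linear_frechet_derivative[OF assms] .
  have "x = Re x *\<^sub>R 1 + Im x *\<^sub>R \<i>" by (simp add: complex_eq_iff)
  then have "fderiv \<zeta> y x = fderiv \<zeta> y (Re x *\<^sub>R 1 + Im x *\<^sub>R \<i>)" by simp
  also have "\<dots> = Re x *\<^sub>R fderiv \<zeta> y 1 + Im x *\<^sub>R fderiv \<zeta> y \<i>"
    by (simp only: add scale)
  finally show ?thesis by (simp only: scaleR_conv_of_real)
qed

text \<open>The derivative of \<zeta> is only real linear, so in the chain rule the real and
  imaginary parts of the inner derivative are multiplied by different functions and converge
  separately.\<close>

lemma L1_Re_Im_tendsto:
  fixes G :: "nat \<Rightarrow> 'x \<Rightarrow> complex"
  assumes G: "\<And>n. integrable M (G n)" "integrable M Gl" "(\<lambda>n. LINT w|M. norm (G n w - Gl w)) \<longlonglongrightarrow> 0"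
  shows "(\<lambda>n. LINT w|M. norm (complex_of_real (Re (G n w)) - of_real (Re (Gl w)))) \<longlonglongrightarrow> 0"
    "(\<lambda>n. LINT w|M. norm (complex_of_real (Im (G n w)) - of_real (Im (Gl w)))) \<longlonglongrightarrow> 0"
proof -
  have *: "(\<lambda>n. LINT w|M. norm (complex_of_real (p (G n w)) - of_real (p (Gl w)))) \<longlonglongrightarrow> 0"
    if p: "bounded_linear p" "\<And>z. \<bar>p z\<bar> \<le> norm z" for p
  proof (rule Lim_null_comparison[OF _ G(3)], intro always_eventually allI)
    fix n
    have eq: "norm (complex_of_real (p (G n w)) - of_real (p (Gl w))) = \<bar>p (G n w - Gl w)\<bar>" for w
      using linear_diff[OF bounded_linear.linear[OF p(1)]] by (metis norm_of_real of_real_diff)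
    have "(LINT w|M. \<bar>p (G n w - Gl w)\<bar>) \<le> (LINT w|M. norm (G n w - Gl w))"
      by (rule integral_mono[OF integrable_abs[OF integrable_bounded_linear[OF p(1) Bochner_Integration.integrable_diff[OF G(1,2)]]]])
        (use G p in auto)
    then show "norm (LINT w|M. norm (complex_of_real (p (G n w)) - of_real (p (Gl w)))) \<le> (LINT w|M. norm (G n w - Gl w))"
      unfolding eq by simp
  qed
  show "(\<lambda>n. LINT w|M. norm (complex_of_real (Re (G n w)) - of_real (Re (Gl w)))) \<longlonglongrightarrow> 0"
    "(\<lambda>n. LINT w|M. norm (complex_of_real (Im (G n w)) - of_real (Im (Gl w)))) \<longlonglongrightarrow> 0"
    using *[OF bounded_linear_Re abs_Re_le_cmod] *[OF bounded_linear_Im abs_Im_le_cmod] by simp_all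
qed

text \<open>The cutoff is \<open>1\<close> near the support of \<open>\<eta>\<close>, which is all that the integrals against \<open>\<eta>\<close> see.\<close>

lemma test_function_local:
  assumes U: "open U" and t: "test_function U \<eta>"
  obtains \<kappa> where "test_function U \<kappa>"
    "\<And>w e d. \<eta> w \<noteq> 0 \<or> fderiv \<eta> w e \<noteq> 0 \<Longrightarrow> \<kappa> w = 1 \<and> fderiv \<kappa> w d = 0"
proof -
  obtain K where K: "compact K" "K \<subseteq> U" "\<And>w. w \<notin> K \<Longrightarrow> \<eta> w = 0"
    using test_functionE[OF t] by blast
  obtain \<kappa> V where \<kappa>: "test_function U \<kappa>" "open V" "K \<subseteq> V" "\<And>w. w \<in> V \<Longrightarrow> \<kappa> w = 1"
    using cutoff_exists[OF U K(1,2)] by blast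
  have "\<kappa> w = 1 \<and> fderiv \<kappa> w d = 0" if "\<eta> w \<noteq> 0 \<or> fderiv \<eta> w e \<noteq> 0" for w e d
  proof -
    have "w \<in> K" using that K(3)[of w] frechet_derivative_outside[where \<eta> = \<eta> and K = K and c = 0 and w = w and e = e]
        compact_imp_closed[OF K(1)] K(3) by blast
    then have "w \<in> V" using \<kappa>(3) by auto
    then show ?thesis using \<kappa>(4) frechet_derivative_outside[of "- V" \<kappa> 1 w d] \<kappa>(2) by auto
  qed
  then show ?thesis using that[OF \<kappa>(1)] by blast
qed

text \<open>For the mollified inner map the classical chain rule holds. In the limit the inner maps
  converge pointwise, \<zeta> and its derivatives are bounded and continuous, and the inner
  derivatives converge in L1, which is precisely the situation of
  \<open>L1_mult_tendsto\<close>.\<close>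

lemma weak_chain_rule:
  assumes U: "open U" and \<phi>: "continuous_on U \<phi>" and g: "has_weak_derivative U e \<phi> g" and z: "test_function V \<zeta>"
  shows "has_weak_derivative U e (\<lambda>w. \<zeta> (\<phi> w)) (\<lambda>w. fderiv \<zeta> (\<phi> w) (g w))"
proof -
  let ?d = "\<lambda>y x. fderiv \<zeta> y x"
  note zd = test_function_differentiable[OF z]
  note z' = test_function_frechet_derivative[OF z]
  define D1 D2 where "D1 = (\<lambda>y. ?d y 1)" and "D2 = (\<lambda>y. ?d y \<i>)"
  have dx: "?d y x = of_real (Re x) * D1 y + of_real (Im x) * D2 y" for x y
    unfolding D1_def D2_def by (rule frechet_derivative_of_real_expand[OF zd])
  have cz: "continuous_on UNIV \<zeta>" and cD: "continuous_on UNIV D1" "continuous_on UNIV D2"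
    using test_function_continuous z z' by (auto simp: D1_def D2_def)
  have lg: "locally_integrable U g" using g by (simp add: has_weak_derivative_def)
  have cl: "continuous_on U (\<lambda>w. \<zeta> (\<phi> w))" "continuous_on U (\<lambda>w. D1 (\<phi> w))" "continuous_on U (\<lambda>w. D2 (\<phi> w))"
    by (auto intro!: continuous_on_compose2[OF cz \<phi>] continuous_on_compose2[OF cD(1) \<phi>] continuous_on_compose2[OF cD(2) \<phi>])
  obtain B where B: "0 \<le> B" "\<And>y. norm (\<zeta> y) \<le> B" using test_function_bounded[OF z] by blast
  obtain C1 where C1: "0 \<le> C1" "\<And>y. norm (D1 y) \<le> C1"
    unfolding D1_def using test_function_bounded[OF z'] by blast
  obtain C2 where C2: "0 \<le> C2" "\<And>y. norm (D2 y) \<le> C2"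
    unfolding D2_def using test_function_bounded[OF z'] by blast
  have lD: "locally_integrable U (\<lambda>w. ?d (\<phi> w) (g w))"
    unfolding locally_integrable_def dx
  proof (intro allI impI Bochner_Integration.integrable_add)
    fix C assume C: "compact C \<and> C \<subseteq> U"
    have ig: "integrable (lebesgue_on C) g" using lg C by (auto simp: locally_integrable_def)
    have m: "h \<in> borel_measurable (lebesgue_on C)" if "continuous_on U h" for h :: "complex \<Rightarrow> complex"
      using C continuous_on_subset[OF that]
      by (intro continuous_imp_measurable_on_sets_lebesgue) (auto simp: borel_compact)
    show "integrable (lebesgue_on C) (\<lambda>w. of_real (Re (g w)) * D1 (\<phi> w))"
      by (rule integrable_mult_bounded[OF _ m[OF cl(2)], where B = C1]) (use ig C1 in auto)
    show "integrable (lebesgue_on C) (\<lambda>w. of_real (Im (g w)) * D2 (\<phi> w))"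
      by (rule integrable_mult_bounded[OF _ m[OF cl(3)], where B = C2]) (use ig C2 in auto)
  qed
  show ?thesis
    unfolding has_weak_derivative_def
  proof (intro conjI allI impI locally_integrable_continuous[OF cl(1)] lD)
    fix \<eta> assume t: "test_function U \<eta>"
    note t' = test_function_frechet_derivative[OF t, of e]
    obtain \<kappa> where \<kappa>: "test_function U \<kappa>"
      "\<And>w e d. \<eta> w \<noteq> 0 \<or> fderiv \<eta> w e \<noteq> 0 \<Longrightarrow> \<kappa> w = 1 \<and> fderiv \<kappa> w d = 0"
      using test_function_local[OF U t] by blast
    \<comment> \<open>The cutoff makes the inner map continuous with compact support on the plane.
      \<open>G\<close> is its weak derivative, and the pair agrees with \<phi> and \<open>g\<close>
      wherever the integrands are nonzero.\<close>
    define F where "F w = \<phi> w * \<kappa> w" for w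
    define G where "G w = g w * \<kappa> w + \<phi> w * fderiv \<kappa> w e" for w
    obtain K where K: "compact K" "K \<subseteq> U" "\<And>w. w \<notin> K \<Longrightarrow> \<kappa> w = 0"
      using test_functionE[OF \<kappa>(1)] by blast
    have F: "continuous_on UNIV F" "\<And>w. w \<notin> K \<Longrightarrow> F w = 0"
      unfolding F_def using continuous_mult_test[OF U \<phi> \<kappa>(1)] K(3) by auto
    have FG: "has_weak_derivative UNIV e F G"
      unfolding F_def G_def by (rule has_weak_derivative_cutoff[OF U \<kappa>(1) g])
    have iG: "integrable lebesgue G"
      unfolding G_def
      using locally_integrable_mult_test(1)[OF lg \<kappa>(1) U]
        locally_integrable_mult_test(1)[OF locally_integrable_continuous[OF \<phi>] test_function_frechet_derivative[OF \<kappa>(1)] U]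
      by simp
    let ?F = "\<lambda>n. moll n F"
    have dF: "(?F n has_derivative fderiv (?F n) w) (at w)" for n w
      by (rule Ck_differentiable[OF Ck_moll[OF F(1) K(1) F(2), of "Suc 0"]])
    have DF: "fderiv (?F n) w e = moll n G w" for n w
      by (rule frechet_derivative_moll[OF F(1) K(1) F(2) FG])
    have cF: "continuous_on UNIV (?F n)" for n using Ck_moll[OF F(1) K(1) F(2), of 0] by simp
    have cG: "continuous_on UNIV (moll n G)" for n
      using Ck_moll[OF F(1) K(1) F(2), of "Suc 0" n] by (simp add: DF[symmetric])
    have step: "has_weak_derivative U e (\<lambda>w. \<zeta> (?F n w)) (\<lambda>w. ?d (?F n w) (moll n G w))" for n
    proof -
      have "has_weak_derivative U e (\<lambda>w. \<zeta> (?F n w)) (\<lambda>w. ?d (?F n w) (fderiv (?F n) w e))"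
      proof (rule has_weak_derivative_continuous[OF U has_derivative_compose[OF dF test_function_has_derivative[OF z]]])
        show "continuous_on UNIV (\<lambda>w. ?d (?F n w) (fderiv (?F n) w e))"
          unfolding DF dx
          by (intro continuous_intros cG continuous_on_compose2[OF cD(1) cF] continuous_on_compose2[OF cD(2) cF]) auto
      qed
      then show ?thesis by (simp only: DF)
    qed
    have eq: "(LINT w|lebesgue. \<zeta> (?F n w) * fderiv \<eta> w e) = - (LINT w|lebesgue. ?d (?F n w) (moll n G w) * \<eta> w)" for n
      using has_weak_derivativeD(3)[OF step t U] U test_function_outside[OF t] test_function_outside[OF t']
      by (simp add: integral_lebesgue_on_eq(1))
    have meas: "h \<in> borel_measurable lebesgue" if "continuous_on UNIV h" for h :: "complex \<Rightarrow> complex"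
      using that by (rule continuous_measurable_lebesgue)
    have Flim: "(\<lambda>n. ?F n w) \<longlonglongrightarrow> F w" for w by (rule moll_tendsto[OF F(1) K(1) F(2)])
    have it': "integrable lebesgue (\<lambda>w. fderiv \<eta> w e)"
      using locally_integrable_mult_test(1)[OF locally_integrable_continuous t' U, of "\<lambda>_. 1"] by simp
    have L: "(\<lambda>n. LINT w|lebesgue. \<zeta> (?F n w) * fderiv \<eta> w e) \<longlonglongrightarrow> (LINT w|lebesgue. \<zeta> (F w) * fderiv \<eta> w e)"
    proof (rule L1_mult_tendsto[where C = B])
      show "AE w in lebesgue. (\<lambda>n. \<zeta> (?F n w)) \<longlonglongrightarrow> \<zeta> (F w)"
        by (intro AE_I2 continuous_on_tendsto_compose[OF cz Flim]) auto
    qed (use B it' in \<open>auto intro!: meas continuous_on_compose2[OF cz cF] continuous_on_compose2[OF cz F(1)]\<close>)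
    have mG: "\<And>n. integrable lebesgue (moll n G)" "integrable lebesgue G" "(\<lambda>n. LINT w|lebesgue. norm (moll n G w - G w)) \<longlonglongrightarrow> 0"
      using integrable_moll[OF iG] iG moll_L1_tendsto[OF iG] by auto
    obtain T where T: "\<And>w. norm (\<eta> w) \<le> T" using test_function_bounded[OF t] by blast
    have R: "(\<lambda>n. LINT w|lebesgue. (D (?F n w) * \<eta> w) * h n w) \<longlonglongrightarrow> (LINT w|lebesgue. (D (F w) * \<eta> w) * hl w)"
      if "\<And>n. integrable lebesgue (h n)" "integrable lebesgue hl" "(\<lambda>n. LINT w|lebesgue. norm (h n w - hl w)) \<longlonglongrightarrow> 0"
        and D: "continuous_on UNIV D" "\<And>y. norm (D y) \<le> C" "0 \<le> C" for h hl C and D :: "complex \<Rightarrow> complex"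
    proof (rule L1_mult_tendsto[where C = "C * T", OF _ _ _ _ that(1,2,3)])
      show "AE w in lebesgue. (\<lambda>n. D (?F n w) * \<eta> w) \<longlonglongrightarrow> D (F w) * \<eta> w"
        by (intro AE_I2 tendsto_intros continuous_on_tendsto_compose[OF D(1) Flim]) auto
      show "AE w in lebesgue. norm (D (?F n w) * \<eta> w) \<le> C * T" for n
        using D(2,3) T by (intro AE_I2) (auto simp: norm_mult intro!: mult_mono)
    qed (auto intro!: meas continuous_intros test_function_continuous[OF t] continuous_on_compose2[OF D(1) cF] continuous_on_compose2[OF D(1) F(1)])
    note R1 = R[OF _ _ L1_Re_Im_tendsto(1)[OF mG] cD(1) C1(2,1)]
    note R2 = R[OF _ _ L1_Re_Im_tendsto(2)[OF mG] cD(2) C2(2,1)]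
    have exp: "?d y x * s = D1 y * s * of_real (Re x) + D2 y * s * of_real (Im x)" for y x s
      unfolding dx by (simp add: algebra_simps)
    have ii: "integrable lebesgue (\<lambda>w. D (f w) * \<eta> w * complex_of_real (h w))"
      if "integrable lebesgue h" "continuous_on UNIV f" and D: "continuous_on UNIV D" "\<And>y. norm (D y) \<le> C" "0 \<le> C" for f C D and h :: "complex \<Rightarrow> real"
    proof -
      have "integrable lebesgue (\<lambda>w. complex_of_real (h w) * (D (f w) * \<eta> w))"
      proof (rule integrable_mult_bounded[where B = "C * T"])
        show "AE w in lebesgue. norm (D (f w) * \<eta> w) \<le> C * T"
          using D(2,3) T by (intro AE_I2) (auto simp: norm_mult intro!: mult_mono)
        show "(\<lambda>w. D (f w) * \<eta> w) \<in> borel_measurable lebesgue"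
          by (intro meas continuous_intros test_function_continuous[OF t] continuous_on_compose2[OF D(1) that(2)]) auto
      qed (use that in auto)
      then show ?thesis by (simp add: mult_ac)
    qed
    have "integrable lebesgue (\<lambda>w. Re (h w))" "integrable lebesgue (\<lambda>w. Im (h w))"
      if "integrable lebesgue h" for h :: "complex \<Rightarrow> complex" using that by auto
    note ri = this[OF mG(1)] this[OF mG(2)]
    have "(\<lambda>n. LINT w|lebesgue. ?d (?F n w) (moll n G w) * \<eta> w) \<longlonglongrightarrow> (LINT w|lebesgue. ?d (F w) (G w) * \<eta> w)"
      using tendsto_add[OF R1 R2] ri
      unfolding exp
        Bochner_Integration.integral_add[OF ii[OF ri(1) cF cD(1) C1(2,1)] ii[OF ri(2) cF cD(2) C2(2,1)]]
        Bochner_Integration.integral_add[OF ii[OF ri(3) F(1) cD(1) C1(2,1)] ii[OF ri(4) F(1) cD(2) C2(2,1)]]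
      by simp
    from tendsto_minus[OF this] L
    have "(LINT w|lebesgue. \<zeta> (F w) * fderiv \<eta> w e) = - (LINT w|lebesgue. ?d (F w) (G w) * \<eta> w)"
      unfolding eq by (rule LIMSEQ_unique[rotated])
    moreover have "\<zeta> (F w) * fderiv \<eta> w e = \<zeta> (\<phi> w) * fderiv \<eta> w e" for w
      using \<kappa>(2)[of w e] by (cases "fderiv \<eta> w e = 0") (simp_all add: F_def)
    moreover have "?d (F w) (G w) * \<eta> w = ?d (\<phi> w) (g w) * \<eta> w" for w
      using \<kappa>(2)[of w e e] by (cases "\<eta> w = 0") (simp_all add: F_def G_def)
    ultimately show "(LINT w|lebesgue_on U. \<zeta> (\<phi> w) * fderiv \<eta> w e) = - (LINT w|lebesgue_on U. ?d (\<phi> w) (g w) * \<eta> w)"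
      using U test_function_outside[OF t] test_function_outside[OF t'] by (simp add: integral_lebesgue_on_eq(1))
  qed
qed

section \<open>Integration by parts of a Jacobian; Sobolev functions as limits\<close>

text \<open>For smooth \<open>b\<close> this is integration by parts and the symmetry of second derivatives; only \<open>b\<close> is mollified.\<close>

lemma null_lagrangian:
  assumes U: "open U"
    and a: "continuous_on U a" "has_weak_derivative U 1 a a1" "has_weak_derivative U \<i> a a2"
      "AE w in lebesgue_on U. norm (a1 w) \<le> M" "AE w in lebesgue_on U. norm (a2 w) \<le> M"
    and b: "continuous_on U b" "has_weak_derivative U 1 b b1" "has_weak_derivative U \<i> b b2"
    and t: "test_function U \<eta>"
  shows "(LINT w|lebesgue_on U. \<eta> w * (a1 w * b2 w - a2 w * b1 w))
    = - (LINT w|lebesgue_on U. a w * (fderiv \<eta> w 1 * b2 w - fderiv \<eta> w \<i> * b1 w))"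
proof -
  define e1 e2 where "e1 w = fderiv \<eta> w 1" and "e2 w = fderiv \<eta> w \<i>" for w
  have t1: "test_function U e1" and t2: "test_function U e2"
    unfolding e1_def[abs_def] e2_def[abs_def] by (rule test_function_frechet_derivative[OF t])+
  obtain \<kappa> where \<kappa>: "test_function U \<kappa>"
    "\<And>w e d. \<eta> w \<noteq> 0 \<or> fderiv \<eta> w e \<noteq> 0 \<Longrightarrow> \<kappa> w = 1 \<and> fderiv \<kappa> w d = 0"
    using test_function_local[OF U t] by blast
  define F where "F w = b w * \<kappa> w" for w
  define G1 where "G1 w = b1 w * \<kappa> w + b w * fderiv \<kappa> w 1" for w
  define G2 where "G2 w = b2 w * \<kappa> w + b w * fderiv \<kappa> w \<i>" for w
  obtain K where K: "compact K" "K \<subseteq> U" "\<And>w. w \<notin> K \<Longrightarrow> \<kappa> w = 0"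
    using test_functionE[OF \<kappa>(1)] by blast
  have F: "continuous_on UNIV F" "\<And>w. w \<notin> K \<Longrightarrow> F w = 0"
    unfolding F_def using continuous_mult_test[OF U b(1) \<kappa>(1)] K(3) by auto
  have FG1: "has_weak_derivative UNIV 1 F G1"
    unfolding F_def G1_def by (rule has_weak_derivative_cutoff[OF U \<kappa>(1) b(2)])
  have FG2: "has_weak_derivative UNIV \<i> F G2"
    unfolding F_def G2_def by (rule has_weak_derivative_cutoff[OF U \<kappa>(1) b(3)])
  have lb: "locally_integrable U b1" "locally_integrable U b2" "locally_integrable U a1" "locally_integrable U a2"
    using a b by (auto simp: has_weak_derivative_def)
  have la: "locally_integrable U a" by (rule locally_integrable_continuous[OF a(1)])
  have ibk: "integrable lebesgue (\<lambda>w. b w * fderiv \<kappa> w e)" for e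
    by (rule locally_integrable_mult_test(1)[OF locally_integrable_continuous[OF b(1)] test_function_frechet_derivative[OF \<kappa>(1)] U])
  have iG: "integrable lebesgue G1" "integrable lebesgue G2"
    unfolding G1_def G2_def using locally_integrable_mult_test(1)[OF lb(1) \<kappa>(1) U] locally_integrable_mult_test(1)[OF lb(2) \<kappa>(1) U] ibk
    by (auto intro: Bochner_Integration.integrable_add)
  let ?f = "\<lambda>n. moll n F" and ?f1 = "\<lambda>n. moll n G1" and ?f2 = "\<lambda>n. moll n G2"
  have D1: "(\<lambda>w. fderiv (?f n) w 1) = ?f1 n" and D2: "(\<lambda>w. fderiv (?f n) w \<i>) = ?f2 n" for n
    using frechet_derivative_moll[OF F(1) K(1) F(2) FG1] frechet_derivative_moll[OF F(1) K(1) F(2) FG2] by auto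
  have Ckf: "Ck k (?f1 n)" "Ck k (?f2 n)" for k n
    using Ck_moll[OF F(1) K(1) F(2), of "Suc k" n] unfolding Ck.simps D1[symmetric] D2[symmetric] by auto
  have df: "?f1 n differentiable (at w)" "?f2 n differentiable (at w)" for n w
    using Ckf[of "Suc 0" n] by auto
  have sym: "fderiv (?f2 n) w 1 = fderiv (?f1 n) w \<i>" for n w
    using moll_second_derivative_symmetric[OF F(1) K(1) F(2), of n \<i> w 1] unfolding D1 D2 .
  have cf: "continuous_on UNIV (?f1 n)" "continuous_on UNIV (?f2 n)" for n
    using Ckf[of 0 n] by auto
  have i1: "integrable lebesgue (\<lambda>w. a1 w * \<eta> w * ?f2 n w)" "integrable lebesgue (\<lambda>w. a2 w * \<eta> w * ?f1 n w)"
    "integrable lebesgue (\<lambda>w. a w * e1 w * ?f2 n w)" "integrable lebesgue (\<lambda>w. a w * e2 w * ?f1 n w)" for n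
    using locally_integrable_mult_test(1)[OF lb(3) test_function_mult[OF t Ckf(2)] U, of n]
      locally_integrable_mult_test(1)[OF lb(4) test_function_mult[OF t Ckf(1)] U, of n]
      locally_integrable_mult_test(1)[OF la test_function_mult[OF t1 Ckf(2)] U, of n]
      locally_integrable_mult_test(1)[OF la test_function_mult[OF t2 Ckf(1)] U, of n]
    by (simp_all add: mult_ac)
  have step: "(LINT w|lebesgue. a1 w * \<eta> w * ?f2 n w) - (LINT w|lebesgue. a2 w * \<eta> w * ?f1 n w)
      = - ((LINT w|lebesgue. a w * e1 w * ?f2 n w) - (LINT w|lebesgue. a w * e2 w * ?f1 n w))" for n
  proof -
    \<comment> \<open>The mixed second derivative of the mollified \<open>b\<close>. Testing the
      derivatives of \<open>a\<close> with \<open>?f2 n w * \<eta> w\<close> and with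
      \<open>?f1 n w * \<eta> w\<close> produces the same term \<open>a w * s w * \<eta> w\<close>
      in both identities, and it drops out of their difference.\<close>
    define s where "s w = fderiv (?f1 n) w \<i>" for w
    have Cs: "Ck k s" for k using Ckf(1)[of "Suc k" n] by (simp add: s_def[abs_def])
    have isw: "integrable lebesgue (\<lambda>w. a w * s w * \<eta> w)"
      using locally_integrable_mult_test(1)[OF la test_function_mult[OF t Cs] U] by (simp add: mult_ac)
    have tt: "test_function U (\<lambda>w. ?f2 n w * \<eta> w)" "test_function U (\<lambda>w. ?f1 n w * \<eta> w)"
      by (rule test_function_mult[OF t] Ckf)+
    have x1: "fderiv (\<lambda>w. ?f2 n w * \<eta> w) w 1 = ?f2 n w * e1 w + s w * \<eta> w" for w
      by (subst frechet_derivative_mult[OF df(2) test_function_differentiable[OF t]]) (simp add: e1_def s_def sym)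
    have x2: "fderiv (\<lambda>w. ?f1 n w * \<eta> w) w \<i> = ?f1 n w * e2 w + s w * \<eta> w" for w
      by (subst frechet_derivative_mult[OF df(1) test_function_differentiable[OF t]]) (simp add: e2_def s_def)
    have y1: "(LINT w|lebesgue. a w * (?f2 n w * e1 w + s w * \<eta> w)) = - (LINT w|lebesgue. a1 w * (?f2 n w * \<eta> w))"
      using has_weak_derivativeD(3)[OF a(2) tt(1) U] U test_function_outside[OF tt(1)]
        test_function_outside[OF test_function_frechet_derivative[OF tt(1), of 1]]
      by (simp add: integral_lebesgue_on_eq(1) x1)
    have y2: "(LINT w|lebesgue. a w * (?f1 n w * e2 w + s w * \<eta> w)) = - (LINT w|lebesgue. a2 w * (?f1 n w * \<eta> w))"
      using has_weak_derivativeD(3)[OF a(3) tt(2) U] U test_function_outside[OF tt(2)]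
        test_function_outside[OF test_function_frechet_derivative[OF tt(2), of \<i>]]
      by (simp add: integral_lebesgue_on_eq(1) x2)
    have z1: "(\<lambda>w. a w * (?f2 n w * e1 w + s w * \<eta> w)) = (\<lambda>w. a w * e1 w * ?f2 n w + a w * s w * \<eta> w)"
      and z2: "(\<lambda>w. a w * (?f1 n w * e2 w + s w * \<eta> w)) = (\<lambda>w. a w * e2 w * ?f1 n w + a w * s w * \<eta> w)"
      and z3: "(\<lambda>w. a1 w * (?f2 n w * \<eta> w)) = (\<lambda>w. a1 w * \<eta> w * ?f2 n w)"
      and z4: "(\<lambda>w. a2 w * (?f1 n w * \<eta> w)) = (\<lambda>w. a2 w * \<eta> w * ?f1 n w)"
      by (auto simp: algebra_simps)
    have y1': "(LINT w|lebesgue. a w * e1 w * ?f2 n w) + (LINT w|lebesgue. a w * s w * \<eta> w) = - (LINT w|lebesgue. a1 w * \<eta> w * ?f2 n w)"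
      using y1 unfolding z1 z3 Bochner_Integration.integral_add[OF i1(3) isw] .
    have y2': "(LINT w|lebesgue. a w * e2 w * ?f1 n w) + (LINT w|lebesgue. a w * s w * \<eta> w) = - (LINT w|lebesgue. a2 w * \<eta> w * ?f1 n w)"
      using y2 unfolding z2 z4 Bochner_Integration.integral_add[OF i1(4) isw] .
    have alg: "p - q = - (u - v)" if "u + r = - p" "v + r = - q" for p q u v r :: complex
    proof -
      have "p = - (u + r)" "q = - (v + r)" using that by simp_all
      then show ?thesis by simp
    qed
    show ?thesis by (rule alg[OF y1' y2'])
  qed
  obtain T where T: "\<And>w. norm (\<eta> w) \<le> T" using test_function_bounded[OF t] by blast
  have bdd: "AE w in lebesgue. norm (h w * \<eta> w) \<le> \<bar>M\<bar> * T" if "AE w in lebesgue_on U. norm (h w) \<le> M" for h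
  proof -
    have "AE w in lebesgue. w \<in> U \<longrightarrow> norm (h w) \<le> M" using that U by (simp add: AE_restrict_space_iff)
    then show ?thesis
    proof eventually_elim
      case (elim w)
      have "0 \<le> T" using T[of w] norm_ge_zero order_trans by blast
      then show ?case
        using elim T[of w] test_function_outside[OF t, of w] by (cases "w \<in> U") (auto simp: norm_mult intro!: mult_mono)
    qed
  qed
  have cae: "continuous_on UNIV (\<lambda>w. a w * e1 w)" "continuous_on UNIV (\<lambda>w. a w * e2 w)"
    using continuous_mult_test[OF U a(1)] t1 t2 by auto
  obtain K' where K': "compact K'" "K' \<subseteq> U" "\<And>w. w \<notin> K' \<Longrightarrow> \<eta> w = 0" using test_functionE[OF t] by blast
  have z': "w \<notin> K' \<Longrightarrow> e1 w = 0" "w \<notin> K' \<Longrightarrow> e2 w = 0" for w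
    using frechet_derivative_outside[OF compact_imp_closed[OF K'(1)] K'(3)] by (auto simp: e1_def e2_def)
  have z'': "w \<notin> K' \<Longrightarrow> a w * e1 w = 0" "w \<notin> K' \<Longrightarrow> a w * e2 w = 0" for w
    using z' by simp_all
  obtain N1 where N1: "\<And>w. norm (a w * e1 w) \<le> N1"
    using continuous_compact_support_bounded[OF cae(1) K'(1) z''(1)] by metis
  obtain N2 where N2: "\<And>w. norm (a w * e2 w) \<le> N2"
    using continuous_compact_support_bounded[OF cae(2) K'(1) z''(2)] by metis
  note L1 = integrable_moll[OF iG(1)] iG(1) moll_L1_tendsto[OF iG(1)]
  note L2 = integrable_moll[OF iG(2)] iG(2) moll_L1_tendsto[OF iG(2)]
  have ma: "(\<lambda>w. a1 w * \<eta> w) \<in> borel_measurable lebesgue" "(\<lambda>w. a2 w * \<eta> w) \<in> borel_measurable lebesgue"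
    using locally_integrable_mult_test(1)[OF lb(3) t U] locally_integrable_mult_test(1)[OF lb(4) t U] by auto
  note mb = cae[THEN continuous_measurable_lebesgue]
  \<comment> \<open>Here the bounds on \<open>a1\<close> and \<open>a2\<close> enter: the mollified
    derivatives of \<open>b\<close> converge to \<open>G1\<close> and \<open>G2\<close> in L1
    only.\<close>
  have "(\<lambda>n. LINT w|lebesgue. a1 w * \<eta> w * ?f2 n w) \<longlonglongrightarrow> (LINT w|lebesgue. a1 w * \<eta> w * G2 w)"
    by (rule L1_mult_tendsto[OF ma(1,1) bdd[OF a(4)] _ L2]) simp
  moreover have "(\<lambda>n. LINT w|lebesgue. a2 w * \<eta> w * ?f1 n w) \<longlonglongrightarrow> (LINT w|lebesgue. a2 w * \<eta> w * G1 w)"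
    by (rule L1_mult_tendsto[OF ma(2,2) bdd[OF a(5)] _ L1]) simp
  ultimately have l: "(\<lambda>n. (LINT w|lebesgue. a1 w * \<eta> w * ?f2 n w) - (LINT w|lebesgue. a2 w * \<eta> w * ?f1 n w))
     \<longlonglongrightarrow> (LINT w|lebesgue. a1 w * \<eta> w * G2 w) - (LINT w|lebesgue. a2 w * \<eta> w * G1 w)"
    by (rule tendsto_diff)
  have "(\<lambda>n. LINT w|lebesgue. a w * e1 w * ?f2 n w) \<longlonglongrightarrow> (LINT w|lebesgue. a w * e1 w * G2 w)"
    by (rule L1_mult_tendsto[where C = N1, OF mb(1,1) _ _ L2]) (use N1 in auto)
  moreover have "(\<lambda>n. LINT w|lebesgue. a w * e2 w * ?f1 n w) \<longlonglongrightarrow> (LINT w|lebesgue. a w * e2 w * G1 w)"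
    by (rule L1_mult_tendsto[where C = N2, OF mb(2,2) _ _ L1]) (use N2 in auto)
  ultimately have r: "(\<lambda>n. - ((LINT w|lebesgue. a w * e1 w * ?f2 n w) - (LINT w|lebesgue. a w * e2 w * ?f1 n w)))
     \<longlonglongrightarrow> - ((LINT w|lebesgue. a w * e1 w * G2 w) - (LINT w|lebesgue. a w * e2 w * G1 w))"
    by (intro tendsto_minus tendsto_diff)
  have main: "(LINT w|lebesgue. a1 w * \<eta> w * G2 w) - (LINT w|lebesgue. a2 w * \<eta> w * G1 w)
      = - ((LINT w|lebesgue. a w * e1 w * G2 w) - (LINT w|lebesgue. a w * e2 w * G1 w))"
    using l r unfolding step by (rule LIMSEQ_unique)
  \<comment> \<open>Wherever an integrand can be nonzero the cutoff is 1 with vanishing derivative,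
    so \<open>G1\<close> and \<open>G2\<close> are there the original derivatives of
    \<open>b\<close>.\<close>
  have nz: "G1 w = b1 w \<and> G2 w = b2 w" if "\<eta> w \<noteq> 0 \<or> e1 w \<noteq> 0 \<or> e2 w \<noteq> 0" for w
    using \<kappa>(2)[of w 1] \<kappa>(2)[of w \<i>] that unfolding G1_def G2_def e1_def e2_def by auto
  have j: "integrable lebesgue (\<lambda>w. a1 w * \<eta> w * G2 w)" "integrable lebesgue (\<lambda>w. a2 w * \<eta> w * G1 w)"
    "integrable lebesgue (\<lambda>w. a w * e1 w * G2 w)" "integrable lebesgue (\<lambda>w. a w * e2 w * G1 w)"
    using integrable_mult_bounded[OF iG(2) ma(1) bdd[OF a(4)]] integrable_mult_bounded[OF iG(1) ma(2) bdd[OF a(5)]]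
      integrable_mult_bounded[OF iG(2) mb(1) AE_I2[of _ "\<lambda>w. norm (a w * e1 w) \<le> N1"]]
      integrable_mult_bounded[OF iG(1) mb(2) AE_I2[of _ "\<lambda>w. norm (a w * e2 w) \<le> N2"]] N1 N2
    by (simp_all add: mult_ac)
  have s1: "(\<lambda>w. a1 w * \<eta> w * G2 w - a2 w * \<eta> w * G1 w) = (\<lambda>w. \<eta> w * (a1 w * b2 w - a2 w * b1 w))"
  proof
    fix w show "a1 w * \<eta> w * G2 w - a2 w * \<eta> w * G1 w = \<eta> w * (a1 w * b2 w - a2 w * b1 w)"
      using nz[of w] by (cases "\<eta> w = 0") (simp_all add: algebra_simps)
  qed
  have s2: "(\<lambda>w. a w * e1 w * G2 w - a w * e2 w * G1 w) = (\<lambda>w. a w * (e1 w * b2 w - e2 w * b1 w))"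
  proof
    fix w show "a w * e1 w * G2 w - a w * e2 w * G1 w = a w * (e1 w * b2 w - e2 w * b1 w)"
      using nz[of w] by (cases "e1 w = 0"; cases "e2 w = 0") (simp_all add: algebra_simps)
  qed
  have "(LINT w|lebesgue. \<eta> w * (a1 w * b2 w - a2 w * b1 w)) = - (LINT w|lebesgue. a w * (e1 w * b2 w - e2 w * b1 w))"
    using main unfolding Bochner_Integration.integral_diff[OF j(1,2), symmetric] Bochner_Integration.integral_diff[OF j(3,4), symmetric] s1 s2 .
  then show ?thesis
    using U test_function_outside[OF t] test_function_outside[OF t1] test_function_outside[OF t2]
    by (simp add: integral_lebesgue_on_eq(1) flip: e1_def e2_def)
qed

section \<open>Restriction to subdomains, and Sobolev functions with explicit derivatives\<close>

lemma has_weak_derivative_mono: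
  assumes "open V" "open U" "U \<subseteq> V" and f: "has_weak_derivative V e f g"
  shows "has_weak_derivative U e f g"
  unfolding has_weak_derivative_def
proof (intro conjI allI impI)
  show "locally_integrable U f" "locally_integrable U g"
    using f assms(3) by (auto simp: has_weak_derivative_def locally_integrable_def)
  fix \<eta> assume t: "test_function U \<eta>"
  show "(LINT w|lebesgue_on U. f w * fderiv \<eta> w e) = - (LINT w|lebesgue_on U. g w * \<eta> w)"
    using has_weak_derivativeD(3)[OF f test_function_mono[OF t assms(3)] assms(1)] assms
      test_function_outside[OF t] test_function_outside[OF test_function_frechet_derivative[OF t, of e]]
      test_function_outside[OF test_function_mono[OF t assms(3)]]
      test_function_outside[OF test_function_frechet_derivative[OF test_function_mono[OF t assms(3)], of e]]
    by (simp add: integral_lebesgue_on_eq(1))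
qed

text \<open>Carries the weak derivatives as data, \<open>G 1\<close> and \<open>G \<i>\<close>, so
  that differences and compositions can be computed with formulas instead of with the representative
  chosen by \<open>weak_derivative\<close>.\<close>

definition W12_with :: "complex set \<Rightarrow> (complex \<Rightarrow> complex) \<Rightarrow> (complex \<Rightarrow> complex \<Rightarrow> complex) \<Rightarrow> bool" where
  "W12_with U f G \<longleftrightarrow> square_integrable U f \<and>
     (\<forall>e\<in>{1, \<i>}. has_weak_derivative U e f (G e) \<and> square_integrable U (G e))"

text \<open>The square of the Sobolev norm, with the derivatives read off from \<open>G\<close>.
  Working with squares avoids square roots; the price is a factor 2 in the triangle
  inequality.\<close>

definition sqnorm :: "complex set \<Rightarrow> (complex \<Rightarrow> complex) \<Rightarrow> (complex \<Rightarrow> complex \<Rightarrow> complex) \<Rightarrow> real" where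
  "sqnorm U f G = (LINT w|lebesgue_on U. (cmod (f w))\<^sup>2)
     + ((LINT w|lebesgue_on U. (cmod (G 1 w))\<^sup>2) + (LINT w|lebesgue_on U. (cmod (G \<i> w))\<^sup>2))"

lemma sqnorm_nonneg: "0 \<le> sqnorm U f G"
  by (simp add: sqnorm_def)

lemma norm_add_sq: "(norm (x + y :: complex))\<^sup>2 \<le> 2 * (norm x)\<^sup>2 + 2 * (norm y)\<^sup>2"
proof -
  have "(norm (x + y))\<^sup>2 \<le> (norm x + norm y)\<^sup>2" by (intro power_mono norm_triangle_ineq) simp
  also have "\<dots> \<le> 2 * (norm x)\<^sup>2 + 2 * (norm y)\<^sup>2"
    using sum_squares_bound[of "norm x" "norm y"] by (simp add: power2_sum)
  finally show ?thesis .
qed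

lemma square_integrable_add:
  assumes "square_integrable U f" "square_integrable U g"
  shows "square_integrable U (\<lambda>w. f w + g w)"
proof -
  have m [measurable]: "f \<in> borel_measurable (lebesgue_on U)" "g \<in> borel_measurable (lebesgue_on U)"
    using assms by (auto simp: square_integrable_def)
  have "integrable (lebesgue_on U) (\<lambda>w. 2 * (norm (f w))\<^sup>2 + 2 * (norm (g w))\<^sup>2)"
    using assms by (auto simp: square_integrable_def)
  then have "integrable (lebesgue_on U) (\<lambda>w. (norm (f w + g w))\<^sup>2)"
    by (rule Bochner_Integration.integrable_bound) (use norm_add_sq in auto)
  then show ?thesis by (simp add: square_integrable_def)
qed

lemma square_integrable_cmult: "square_integrable U f \<Longrightarrow> square_integrable U (\<lambda>w. c * f w)"
  by (auto simp: square_integrable_def norm_mult power_mult_distrib)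

lemma square_integrable_diff:
  assumes "square_integrable U f" "square_integrable U g"
  shows "square_integrable U (\<lambda>w. f w - g w)"
  using square_integrable_add[OF assms(1) square_integrable_cmult[OF assms(2), of "-1"]] by simp

lemma integral_norm_add_sq:
  assumes "square_integrable U f" "square_integrable U g"
  shows "(LINT w|lebesgue_on U. (cmod (f w + g w))\<^sup>2)
    \<le> 2 * (LINT w|lebesgue_on U. (cmod (f w))\<^sup>2) + 2 * (LINT w|lebesgue_on U. (cmod (g w))\<^sup>2)"
proof -
  have "(LINT w|lebesgue_on U. (cmod (f w + g w))\<^sup>2) \<le> (LINT w|lebesgue_on U. 2 * (cmod (f w))\<^sup>2 + 2 * (cmod (g w))\<^sup>2)"
    by (rule integral_mono) (use square_integrable_add[OF assms] assms norm_add_sq in \<open>auto simp: square_integrable_def\<close>)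
  then show ?thesis using assms by (simp add: square_integrable_def)
qed

lemma W12_with_diff:
  assumes "open U" "W12_with U f G" "W12_with U f' G'"
  shows "W12_with U (\<lambda>w. f w - f' w) (\<lambda>e w. G e w - G' e w)"
  using assms unfolding W12_with_def by (auto intro!: square_integrable_diff has_weak_derivative_diff)

lemma sqnorm_triangle:
  assumes "W12_with U (\<lambda>w. f w - u w) (\<lambda>e w. G e w - D e w)" "W12_with U (\<lambda>w. u w - v w) (\<lambda>e w. D e w - E e w)"
  shows "sqnorm U (\<lambda>w. f w - v w) (\<lambda>e w. G e w - E e w)
    \<le> 2 * sqnorm U (\<lambda>w. f w - u w) (\<lambda>e w. G e w - D e w) + 2 * sqnorm U (\<lambda>w. u w - v w) (\<lambda>e w. D e w - E e w)"
  using integral_norm_add_sq[of U "\<lambda>w. f w - u w" "\<lambda>w. u w - v w"]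
    integral_norm_add_sq[of U "\<lambda>w. G 1 w - D 1 w" "\<lambda>w. D 1 w - E 1 w"]
    integral_norm_add_sq[of U "\<lambda>w. G \<i> w - D \<i> w" "\<lambda>w. D \<i> w - E \<i> w"] assms
  by (simp add: W12_with_def sqnorm_def)

lemma W12_withI:
  assumes "f \<in> W12 U" shows "\<exists>G. W12_with U f G"
proof -
  have "\<forall>e\<in>{1, \<i>}. \<exists>g. has_weak_derivative U e f g \<and> square_integrable U g" "square_integrable U f"
    using assms by (auto simp: W12_def)
  then show ?thesis unfolding W12_with_def by metis
qed

lemma W12_0_obtain:
  assumes "g \<in> W12_0 X" obtains G where "W12_with X g G"
proof -
  have "g \<in> W12 X" using assms by (simp add: W12_0_def)
  then show ?thesis using W12_withI that by blast
qed

lemma W12_with_imp_W12: "W12_with U f G \<Longrightarrow> f \<in> W12 U"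
  by (auto simp: W12_with_def W12_def)

lemma norm_weak_gradient:
  "(norm (weak_gradient U f w))\<^sup>2 = (cmod (weak_derivative U 1 f w))\<^sup>2 + (cmod (weak_derivative U \<i> f w))\<^sup>2"
  by (simp add: weak_gradient_def norm_vec_def L2_set_def sum_2)

lemma W12_norm_eq:
  assumes U: "open U" and f: "W12_with U f G"
  shows "W12_norm U f = sqrt (sqnorm U f G)"
proof -
  have d: "has_weak_derivative U 1 f (G 1)" "has_weak_derivative U \<i> f (G \<i>)"
    and i: "square_integrable U (G 1)" "square_integrable U (G \<i>)"
    using f by (auto simp: W12_with_def)
  have lw: "weak_derivative U e f \<in> borel_measurable (lebesgue_on U)" if "has_weak_derivative U e f (G e)" for e
    using weak_derivative_works[OF that] U by (auto simp: has_weak_derivative_def intro: locally_integrable_measurable)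
  have "(LINT w|lebesgue_on U. (norm (weak_gradient U f w))\<^sup>2) = (LINT w|lebesgue_on U. (cmod (G 1 w))\<^sup>2 + (cmod (G \<i> w))\<^sup>2)"
  proof (rule integral_cong_AE)
    show "AE w in lebesgue_on U. (norm (weak_gradient U f w))\<^sup>2 = (cmod (G 1 w))\<^sup>2 + (cmod (G \<i> w))\<^sup>2"
      using weak_derivative_AE[OF U d(1)] weak_derivative_AE[OF U d(2)]
      by eventually_elim (simp add: norm_weak_gradient)
  qed (use lw[OF d(1)] lw[OF d(2)] i in \<open>auto simp: norm_weak_gradient square_integrable_def\<close>)
  also have "\<dots> = (LINT w|lebesgue_on U. (cmod (G 1 w))\<^sup>2) + (LINT w|lebesgue_on U. (cmod (G \<i> w))\<^sup>2)"
    using i by (simp add: square_integrable_def)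
  finally show ?thesis by (simp add: W12_norm_def sqnorm_def)
qed

section \<open>Square integrability on bounded domains, and membership in
  \<open>W12_0\<close>\<close>

lemma square_integrable_bounded:
  assumes U: "U \<in> lmeasurable" and m: "f \<in> borel_measurable (lebesgue_on U)" and b: "AE w in lebesgue_on U. norm (f w) \<le> M"
  shows "square_integrable U f"
proof -
  have fin: "finite_measure (lebesgue_on U)" using U by (rule finite_measure_lebesgue_on)
  then have "integrable (lebesgue_on U) (\<lambda>w. M\<^sup>2)" by (simp add: finite_measure.integrable_const)
  then have "integrable (lebesgue_on U) (\<lambda>w. (norm (f w))\<^sup>2)"
  proof (rule Bochner_Integration.integrable_bound)
    show "AE w in lebesgue_on U. norm ((norm (f w))\<^sup>2) \<le> norm (M\<^sup>2)"
      using b by eventually_elim (simp add: power_mono)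
  qed (use m in auto)
  then show ?thesis using m by (simp add: square_integrable_def)
qed

lemma open_bounded_lmeasurable: "open U \<Longrightarrow> bounded U \<Longrightarrow> (U :: complex set) \<in> lmeasurable"
  by (rule lmeasurable_open)

lemma W12_with_test:
  assumes U: "open U" "bounded U" and t: "test_function U \<eta>"
  shows "W12_with U \<eta> (\<lambda>e w. fderiv \<eta> w e)"
proof -
  have "square_integrable U \<xi>" if t': "test_function U \<xi>" for \<xi>
  proof -
    obtain M where M: "\<And>w. norm (\<xi> w) \<le> M" using test_function_bounded[OF t'] by metis
    show ?thesis
      by (rule square_integrable_bounded[OF open_bounded_lmeasurable[OF U], of _ M])
        (use M U continuous_on_subset[OF test_function_continuous[OF t']] in
          \<open>auto intro!: continuous_imp_measurable_on_sets_lebesgue\<close>)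
  qed
  then show ?thesis
    using t test_function_frechet_derivative[OF t] has_weak_derivative_test[OF U(1) t] by (simp add: W12_with_def)
qed

text \<open>Translates the defining closure into terms of \<open>sqnorm\<close>, free of chosen
  representatives; later memberships in \<open>W12_0\<close> are read and shown in this
  form.\<close>

lemma W12_0_iff:
  assumes U: "open U" "bounded U" and f: "W12_with U f G"
  shows "f \<in> W12_0 U \<longleftrightarrow> (\<exists>\<eta>. (\<forall>j. test_function U (\<eta> j)) \<and>
    (\<lambda>j. sqnorm U (\<lambda>w. f w - \<eta> j w) (\<lambda>e w. G e w - fderiv (\<eta> j) w e)) \<longlonglongrightarrow> 0)"
proof -
  have "(\<lambda>j. W12_norm U (\<lambda>w. f w - \<eta> j w)) \<longlonglongrightarrow> 0 \<longleftrightarrow>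
     (\<lambda>j. sqnorm U (\<lambda>w. f w - \<eta> j w) (\<lambda>e w. G e w - fderiv (\<eta> j) w e)) \<longlonglongrightarrow> 0"
    (is "?l \<longleftrightarrow> ?s \<longlonglongrightarrow> 0") if "\<forall>j. test_function U (\<eta> j)" for \<eta> :: "nat \<Rightarrow> complex \<Rightarrow> complex"
  proof -
    have "W12_norm U (\<lambda>w. f w - \<eta> j w) = sqrt (?s j)" for j
      using W12_norm_eq[OF U(1) W12_with_diff[OF U(1) f W12_with_test[OF U]]] that by blast
    moreover have "(\<lambda>j. sqrt (?s j)) \<longlonglongrightarrow> 0 \<longleftrightarrow> ?s \<longlonglongrightarrow> 0"
    proof
      assume "(\<lambda>j. sqrt (?s j)) \<longlonglongrightarrow> 0"
      from tendsto_power[OF this, of 2] show "?s \<longlonglongrightarrow> 0" by (simp add: sqnorm_nonneg)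
    next
      assume "?s \<longlonglongrightarrow> 0"
      from tendsto_real_sqrt[OF this] show "(\<lambda>j. sqrt (?s j)) \<longlonglongrightarrow> 0" by simp
    qed
    ultimately show ?thesis by simp
  qed
  then show ?thesis using W12_with_imp_W12[OF f] by (auto simp: W12_0_def)
qed

lemma L2_imp_L1_tendsto:
  fixes h :: "nat \<Rightarrow> complex \<Rightarrow> complex"
  assumes U: "U \<in> lmeasurable" and h: "\<And>j. square_integrable U (h j)"
    and lim: "(\<lambda>j. LINT w|lebesgue_on U. (cmod (h j w))\<^sup>2) \<longlonglongrightarrow> 0"
  shows "\<And>j. integrable (lebesgue_on U) (h j)" "(\<lambda>j. LINT w|lebesgue_on U. cmod (h j w)) \<longlonglongrightarrow> 0"
proof -
  interpret finite_measure "lebesgue_on U" using U by (rule finite_measure_lebesgue_on)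
  let ?m = "measure (lebesgue_on U) U"
  have hm [measurable]: "h j \<in> borel_measurable (lebesgue_on U)" and hi: "integrable (lebesgue_on U) (\<lambda>w. (cmod (h j w))\<^sup>2)" for j
    using h by (auto simp: square_integrable_def)
  \<comment> \<open>Replaces the Cauchy-Schwarz inequality on a set of finite measure: the constant
    part integrates to \<open>e * ?m\<close>, and the quadratic part tends to 0 for each fixed
    \<open>e\<close>.\<close>
  have le: "x \<le> e + x\<^sup>2 / e" if "0 < e" for x e :: real
  proof -
    have "2 * (x * e) \<le> x\<^sup>2 + e\<^sup>2" "0 \<le> x\<^sup>2 + e\<^sup>2" using sum_squares_bound[of x e] by simp_all
    then have "x * e \<le> e\<^sup>2 + x\<^sup>2" by linarith
    then have "x * e \<le> e * e + x\<^sup>2" by (simp only: power2_eq_square)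
    then show ?thesis using that by (simp add: field_simps)
  qed
  have i: "integrable (lebesgue_on U) (\<lambda>w. e + (cmod (h j w))\<^sup>2 / e)" for e j using hi by auto
  show hint: "integrable (lebesgue_on U) (h j)" for j
    by (rule Bochner_Integration.integrable_bound[OF i[of 1 j]]) (use le[of 1] in auto)
  show "(\<lambda>j. LINT w|lebesgue_on U. cmod (h j w)) \<longlonglongrightarrow> 0"
  proof (rule LIMSEQ_I)
    fix r :: real assume r: "0 < r"
    \<comment> \<open>Chosen so that the constant part contributes at most \<open>r / 2\<close>; the
      quadratic part is then made smaller than \<open>r / 2\<close> by taking the index
      large.\<close>
    define e where "e = r / (2 * (1 + ?m))"
    have m0: "0 \<le> ?m" by simp
    have e: "0 < e" "e * ?m \<le> r / 2" using r m0 by (auto simp: e_def field_simps add_pos_nonneg)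
    have "0 < e * r / 2" using e r by simp
    from LIMSEQ_D[OF lim this] obtain N where N: "\<And>n. n \<ge> N \<Longrightarrow> (LINT w|lebesgue_on U. (cmod (h n w))\<^sup>2) < e * r / 2"
      by auto
    have "(LINT w|lebesgue_on U. cmod (h n w)) < r" if "n \<ge> N" for n
    proof -
      have "(LINT w|lebesgue_on U. cmod (h n w)) \<le> (LINT w|lebesgue_on U. e + (cmod (h n w))\<^sup>2 / e)"
        by (rule integral_mono[OF _ i]) (use hint le[OF e(1)] in auto)
      also have "\<dots> = e * ?m + (LINT w|lebesgue_on U. (cmod (h n w))\<^sup>2) / e"
        using hi by (simp add: Bochner_Integration.integral_add mult.commute)
      also have "(LINT w|lebesgue_on U. (cmod (h n w))\<^sup>2) / e < r / 2"
        using N[OF that] e(1) by (simp add: field_simps)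
      finally show ?thesis using e(2) by simp
    qed
    then show "\<exists>N. \<forall>n\<ge>N. norm ((LINT w|lebesgue_on U. cmod (h n w)) - 0) < r" by auto
  qed
qed

lemma square_integrable_imp_integrable:
  assumes "U \<in> lmeasurable" "square_integrable U f"
  shows "integrable (lebesgue_on U) f"
proof -
  interpret finite_measure "lebesgue_on U" using assms(1) by (rule finite_measure_lebesgue_on)
  have i: "integrable (lebesgue_on U) (\<lambda>w. 1 + (cmod (f w))\<^sup>2)" using assms(2) by (auto simp: square_integrable_def)
  have le: "x \<le> 1 + x\<^sup>2" for x :: real
  proof -
    have "2 * x \<le> x\<^sup>2 + 1" "0 \<le> x\<^sup>2" using sum_squares_bound[of x 1] by simp_all
    then show ?thesis by linarith
  qed
  show ?thesis
    by (rule Bochner_Integration.integrable_bound[OF i]) (use assms(2) le in \<open>auto simp: square_integrable_def\<close>)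
qed

lemma integrable_imp_locally_integrable:
  assumes U: "open U" and f: "integrable (lebesgue_on U) f"
  shows "locally_integrable U f"
  unfolding locally_integrable_def
proof (intro allI impI)
  fix C assume C: "compact C \<and> C \<subseteq> U"
  then have Cm: "C \<in> sets (lebesgue_on U)" using U by (simp add: sets_restrict_space_iff borel_compact)
  have "integrable (restrict_space (lebesgue_on U) C) f"
    using integrable_mult_indicator[OF Cm f] C Cm by (subst integrable_restrict_space) (auto simp: Int_absorb2)
  then show "integrable (lebesgue_on C) f"
    using C U by (simp add: restrict_restrict_space borel_compact Int_absorb1)
qed

text \<open>The limit and its candidate derivatives are given in advance, so no completeness is
  invoked. The weak identity passes to the limit because L2 convergence on a bounded set implies L1
  convergence. Membership in the closure follows by replacing each \<open>u j\<close> with a nearby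
  test function.\<close>

lemma W12_0_limit:
  assumes U: "open U" "bounded U" and f: "square_integrable U f" "\<And>e. e \<in> {1, \<i>} \<Longrightarrow> square_integrable U (G e)"
    and u: "\<And>j. u j \<in> W12_0 U" "\<And>j. W12_with U (u j) (D j)"
    and lim: "(\<lambda>j. sqnorm U (\<lambda>w. f w - u j w) (\<lambda>e w. G e w - D j e w)) \<longlonglongrightarrow> 0"
  shows "W12_with U f G" "f \<in> W12_0 U"
proof -
  note Um = open_bounded_lmeasurable[OF U]
  have si: "square_integrable U (u j)" "\<And>e. e \<in> {1, \<i>} \<Longrightarrow> square_integrable U (D j e)" for j
    using u(2)[of j] by (auto simp: W12_with_def)
  have lim0: "(\<lambda>j. LINT w|lebesgue_on U. (cmod (f w - u j w))\<^sup>2) \<longlonglongrightarrow> 0"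
    by (rule tendsto_sandwich[OF _ _ tendsto_const lim]) (auto simp: sqnorm_def)
  have lime: "(\<lambda>j. LINT w|lebesgue_on U. (cmod (G e w - D j e w))\<^sup>2) \<longlonglongrightarrow> 0" if "e \<in> {1, \<i>}" for e
    by (rule tendsto_sandwich[OF _ _ tendsto_const lim]) (use that in \<open>auto simp: sqnorm_def\<close>)
  have fl: "integrable (lebesgue_on U) f" "\<And>e. e \<in> {1, \<i>} \<Longrightarrow> integrable (lebesgue_on U) (G e)"
    using square_integrable_imp_integrable[OF Um] f by auto
  have "has_weak_derivative U e f (G e)" if e: "e \<in> {1, \<i>}" for e
    unfolding has_weak_derivative_def
  proof (intro conjI allI impI)
    show "locally_integrable U f" "locally_integrable U (G e)"
      using integrable_imp_locally_integrable[OF U(1)] fl e by auto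
    fix \<eta> assume t: "test_function U \<eta>"
    have lim': "(\<lambda>j. LINT w|lebesgue_on U. \<xi> w * v j w) \<longlonglongrightarrow> (LINT w|lebesgue_on U. \<xi> w * vl w)"
      if t: "test_function U \<xi>" and v: "\<And>j. square_integrable U (v j)" "square_integrable U vl"
        "(\<lambda>j. LINT w|lebesgue_on U. (cmod (vl w - v j w))\<^sup>2) \<longlonglongrightarrow> 0" for \<xi> v vl
    proof -
      obtain M where M: "\<And>w. norm (\<xi> w) \<le> M" using test_function_bounded[OF t] by blast
      have m: "\<xi> \<in> borel_measurable (lebesgue_on U)"
        using U continuous_on_subset[OF test_function_continuous[OF t]] by (auto intro!: continuous_imp_measurable_on_sets_lebesgue)
      have L: "(\<lambda>j. LINT w|lebesgue_on U. cmod (vl w - v j w)) \<longlonglongrightarrow> 0"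
        by (rule L2_imp_L1_tendsto(2)[OF Um square_integrable_diff[OF v(2,1)] v(3)])
      show ?thesis
        by (rule L1_mult_tendsto[where C = M, OF m m])
          (use M L square_integrable_imp_integrable[OF Um] v in \<open>auto simp: norm_minus_commute\<close>)
    qed
    have "(\<lambda>j. LINT w|lebesgue_on U. fderiv \<eta> w e * u j w) \<longlonglongrightarrow> (LINT w|lebesgue_on U. fderiv \<eta> w e * f w)"
      by (rule lim'[OF test_function_frechet_derivative[OF t] si(1) f(1) lim0])
    moreover have "(\<lambda>j. - (LINT w|lebesgue_on U. \<eta> w * D j e w)) \<longlonglongrightarrow> - (LINT w|lebesgue_on U. \<eta> w * G e w)"
      by (rule tendsto_minus[OF lim'[OF t si(2)[OF e] f(2)[OF e] lime[OF e]]])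
    moreover have "(LINT w|lebesgue_on U. fderiv \<eta> w e * u j w) = - (LINT w|lebesgue_on U. \<eta> w * D j e w)" for j
    proof -
      have "has_weak_derivative U e (u j) (D j e)" using u(2)[of j] e by (auto simp: W12_with_def)
      from has_weak_derivativeD(3)[OF this t U(1)] show ?thesis by (simp add: mult.commute)
    qed
    ultimately have "(LINT w|lebesgue_on U. fderiv \<eta> w e * f w) = - (LINT w|lebesgue_on U. \<eta> w * G e w)"
      using LIMSEQ_unique by simp
    then show "(LINT w|lebesgue_on U. f w * fderiv \<eta> w e) = - (LINT w|lebesgue_on U. G e w * \<eta> w)"
      by (simp add: mult.commute)
  qed
  with f show fG: "W12_with U f G" by (simp add: W12_with_def)
  \<comment> \<open>The diagonal choice: for each \<open>j\<close> a test function within squared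
    distance \<open>1 / (j + 1)\<close> of \<open>u j\<close>.\<close>
  have ex: "\<exists>\<xi>. test_function U \<xi> \<and> sqnorm U (\<lambda>w. u j w - \<xi> w) (\<lambda>e w. D j e w - fderiv \<xi> w e) < inverse (real (Suc j))" for j
  proof -
    obtain \<eta> where \<eta>: "\<forall>k. test_function U (\<eta> k)"
      "(\<lambda>k. sqnorm U (\<lambda>w. u j w - \<eta> k w) (\<lambda>e w. D j e w - fderiv (\<eta> k) w e)) \<longlonglongrightarrow> 0"
      using W12_0_iff[OF U u(2)[of j]] u(1)[of j] by blast
    have "\<forall>\<^sub>F k in sequentially. sqnorm U (\<lambda>w. u j w - \<eta> k w) (\<lambda>e w. D j e w - fderiv (\<eta> k) w e) < inverse (real (Suc j))"
      by (rule order_tendstoD(2)[OF \<eta>(2) inverse_Suc_pos])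
    then obtain k where "sqnorm U (\<lambda>w. u j w - \<eta> k w) (\<lambda>e w. D j e w - fderiv (\<eta> k) w e) < inverse (real (Suc j))"
      by (auto simp: eventually_sequentially)
    then show ?thesis using \<eta>(1) by blast
  qed
  from choice[of "\<lambda>j \<xi>. test_function U \<xi> \<and> sqnorm U (\<lambda>w. u j w - \<xi> w) (\<lambda>e w. D j e w - fderiv \<xi> w e) < inverse (real (Suc j))"] ex
  obtain \<xi> where \<xi>: "\<And>j. test_function U (\<xi> j)"
    "\<And>j. sqnorm U (\<lambda>w. u j w - \<xi> j w) (\<lambda>e w. D j e w - fderiv (\<xi> j) w e) < inverse (real (Suc j))"
    by blast
  have "(\<lambda>j. sqnorm U (\<lambda>w. f w - \<xi> j w) (\<lambda>e w. G e w - fderiv (\<xi> j) w e)) \<longlonglongrightarrow> 0"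
  proof (rule tendsto_sandwich[OF _ _ tendsto_const])
    show "\<forall>\<^sub>F j in sequentially. sqnorm U (\<lambda>w. f w - \<xi> j w) (\<lambda>e w. G e w - fderiv (\<xi> j) w e)
      \<le> 2 * sqnorm U (\<lambda>w. f w - u j w) (\<lambda>e w. G e w - D j e w) + 2 * inverse (real (Suc j))"
    proof (intro always_eventually allI)
      fix j
      show "sqnorm U (\<lambda>w. f w - \<xi> j w) (\<lambda>e w. G e w - fderiv (\<xi> j) w e)
        \<le> 2 * sqnorm U (\<lambda>w. f w - u j w) (\<lambda>e w. G e w - D j e w) + 2 * inverse (real (Suc j))"
        using sqnorm_triangle[OF W12_with_diff[OF U(1) fG u(2)[of j]] W12_with_diff[OF U(1) u(2)[of j] W12_with_test[OF U \<xi>(1)[of j]]]] \<xi>(2)[of j]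
        by linarith
    qed
    show "(\<lambda>j. 2 * sqnorm U (\<lambda>w. f w - u j w) (\<lambda>e w. G e w - D j e w) + 2 * inverse (real (Suc j))) \<longlonglongrightarrow> 0"
      using tendsto_add[OF tendsto_mult_left[OF lim, of 2] tendsto_mult_left[OF LIMSEQ_inverse_real_of_nat, of 2]] by simp
  qed (simp add: sqnorm_nonneg)
  then show "f \<in> W12_0 U" using W12_0_iff[OF U fG] \<xi>(1) by blast
qed

lemma W12_with_bounded:
  assumes U: "open U" "bounded U"
    and f: "f \<in> borel_measurable (lebesgue_on U)" "AE w in lebesgue_on U. norm (f w) \<le> M"
    and d: "\<And>e. e \<in> {1, \<i>} \<Longrightarrow> has_weak_derivative U e f (G e)"
    and b: "\<And>e. e \<in> {1, \<i>} \<Longrightarrow> AE w in lebesgue_on U. norm (G e w) \<le> M"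
  shows "W12_with U f G"
  unfolding W12_with_def
proof (intro conjI ballI d)
  show "square_integrable U f" by (rule square_integrable_bounded[OF open_bounded_lmeasurable[OF U] f])
  fix e :: complex assume e: "e \<in> {1, \<i>}"
  have "G e \<in> borel_measurable (lebesgue_on U)"
    using d[OF e] U by (auto simp: has_weak_derivative_def intro: locally_integrable_measurable)
  then show "square_integrable U (G e)" by (rule square_integrable_bounded[OF open_bounded_lmeasurable[OF U] _ b[OF e]])
qed

text \<open>Mollifications with radius smaller than the distance to the boundary are test functions
  on \<open>U\<close>. They converge in L1 together with their derivatives, and the uniform bounds
  turn this into L2 convergence.\<close>

lemma bounded_compact_support_W12_0:
  assumes U: "open U" "bounded U"
    and f: "continuous_on UNIV f" "compact K" "K \<subseteq> U" "\<And>w. w \<notin> K \<Longrightarrow> f w = 0"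
    and d: "\<And>e. e \<in> {1, \<i>} \<Longrightarrow> has_weak_derivative U e f (G e)"
    and b: "\<And>e. e \<in> {1, \<i>} \<Longrightarrow> AE w in lebesgue_on U. norm (G e w) \<le> M"
  shows "f \<in> W12_0 U"
proof -
  obtain r where r: "0 < r" "(\<Union>x\<in>K. cball x r) \<subseteq> U"
    using compact_subset_open_imp_cball_epsilon_subset[OF f(2) U(1) f(3)] by blast
  obtain \<kappa> V where \<kappa>: "test_function U \<kappa>" "open V" "K \<subseteq> V" "\<And>w. w \<in> V \<Longrightarrow> \<kappa> w = 1"
    using cutoff_exists[OF U(1) f(2,3)] by blast
  \<comment> \<open>Since \<kappa> is 1 near \<open>K\<close>, multiplying by it changes nothing and
    its derivative does not meet \<open>f\<close>. The product rule for cutoffs therefore extends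
    the weak derivatives of \<open>f\<close> from \<open>U\<close> to the plane by zero.\<close>
  have fk: "(\<lambda>w. f w * \<kappa> w) = f"
  proof
    fix w show "f w * \<kappa> w = f w"
      using f(4)[of w] \<kappa>(3) \<kappa>(4)[of w] by (cases "w \<in> K") auto
  qed
  have fdk: "f w * fderiv \<kappa> w e = 0" for w e
  proof (cases "w \<in> K")
    case True
    then show ?thesis
      using frechet_derivative_outside[of "- V" \<kappa> 1 w e] \<kappa> by auto
  qed (simp add: f(4))
  define H where "H e w = G e w * \<kappa> w" for e w
  have FH: "has_weak_derivative UNIV e f (H e)" if "e \<in> {1, \<i>}" for e
    using has_weak_derivative_cutoff[OF U(1) \<kappa>(1) d[OF that]] unfolding fk fdk by (simp add: H_def[abs_def])
  have iH: "integrable lebesgue (H e)" if "e \<in> {1, \<i>}" for e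
    unfolding H_def[abs_def]
    by (rule locally_integrable_mult_test(1)[OF _ \<kappa>(1) U(1)]) (use d[OF that] in \<open>simp add: has_weak_derivative_def\<close>)
  obtain T where T: "\<And>w. norm (\<kappa> w) \<le> T" "0 \<le> T" using test_function_bounded[OF \<kappa>(1)] by blast
  have bH: "AE w in lebesgue. norm (H e w) \<le> \<bar>M\<bar> * T" if "e \<in> {1, \<i>}" for e
  proof -
    have "AE w in lebesgue. w \<in> U \<longrightarrow> norm (G e w) \<le> M" using b[OF that] U by (simp add: AE_restrict_space_iff)
    then show ?thesis
    proof eventually_elim
      case (elim w)
      then show ?case
        using T test_function_outside[OF \<kappa>(1), of w] by (cases "w \<in> U") (auto simp: H_def norm_mult intro!: mult_mono)
    qed
  qed
  obtain B where B: "\<And>w. norm (f w) \<le> B" using continuous_compact_support_bounded[OF f(1,2,4)] by blast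
  have fi: "integrable lebesgue f" using integrable_continuous_compact_support[OF f(1,2,4)] by blast
  have fm: "f \<in> borel_measurable (lebesgue_on U)"
    using U continuous_on_subset[OF f(1)] by (auto intro!: continuous_imp_measurable_on_sets_lebesgue)
  \<comment> \<open>From this index on the mollification radius is below \<open>r\<close>, so the
    supports stay in \<open>K' \<subseteq> U\<close>.\<close>
  obtain n0 where n0: "\<And>n. n \<ge> n0 \<Longrightarrow> inverse (real (Suc n)) < r"
    using inverse_Suc_less[OF r(1)] by (auto simp: eventually_sequentially)
  define K' where "K' = {x + y | x y. x \<in> K \<and> y \<in> cball 0 r}"
  have K': "compact K'" unfolding K'_def by (rule compact_sums) (use f in auto)
  have K'U: "K' \<subseteq> U" using r(2) by (force simp: K'_def dist_norm)
  define \<eta> where "\<eta> j = moll (n0 + j) f" for j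
  have t: "test_function U (\<eta> j)" for j
  proof (rule test_functionI[OF _ K' K'U])
    show "Ck k (\<eta> j)" for k unfolding \<eta>_def by (rule Ck_moll[OF f(1,2,4)])
    fix w assume w: "w \<notin> K'"
    show "\<eta> j w = 0"
      unfolding \<eta>_def moll_def
    proof (rule conv_kern_support[where K = K, OF f(4) inverse_Suc_pos])
      fix z assume z: "z \<in> K"
      have "w = z + (w - z)" by simp
      then have "w - z \<notin> cball 0 r" using w z unfolding K'_def by blast
      then show "inverse (real (Suc (n0 + j))) \<le> dist w z"
        using n0[of "n0 + j"] by (simp add: dist_norm norm_minus_commute)
    qed
  qed
  have De: "fderiv (\<eta> j) w e = moll (n0 + j) (H e) w" if "e \<in> {1, \<i>}" for e j w
    unfolding \<eta>_def by (rule frechet_derivative_moll[OF f(1,2,4) FH[OF that]])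
  have fH: "W12_with U f H"
  proof (rule W12_with_bounded[OF U fm])
    show "AE w in lebesgue_on U. norm (f w) \<le> max B (\<bar>M\<bar> * T)"
      using B by (auto simp: le_max_iff_disj)
    fix e :: complex assume e: "e \<in> {1, \<i>}"
    show "has_weak_derivative U e f (H e)"
      by (rule has_weak_derivative_mono[OF open_UNIV U(1) subset_UNIV FH[OF e]])
    have "AE w in lebesgue. w \<in> U \<longrightarrow> norm (H e w) \<le> max B (\<bar>M\<bar> * T)"
      using bH[OF e] by eventually_elim (simp add: le_max_iff_disj)
    then show "AE w in lebesgue_on U. norm (H e w) \<le> max B (\<bar>M\<bar> * T)"
      using U by (simp add: AE_restrict_space_iff)
  qed
  \<comment> \<open>With |h| \<le> C the mollifications obey the same bound, so the squared
    difference is at most \<open>2 * C\<close> times the difference, which tends to 0 in L1.\<close>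
  have sq: "(\<lambda>j. LINT w|lebesgue_on U. (cmod (h w - moll (n0 + j) h w))\<^sup>2) \<longlonglongrightarrow> 0"
    if h: "integrable lebesgue h" and hb: "AE w in lebesgue. norm (h w) \<le> C" for h C
  proof (rule tendsto_sandwich[OF _ _ tendsto_const])
    have cb: "norm (moll n h w) \<le> C" for n w
      unfolding moll_def by (rule norm_conv_kern_le[OF h hb inverse_Suc_pos])
    have C0: "0 \<le> C" using cb[of 0 0] norm_ge_zero order_trans by blast
    show "\<forall>\<^sub>F j in sequentially. (LINT w|lebesgue_on U. (cmod (h w - moll (n0 + j) h w))\<^sup>2)
      \<le> 2 * C * (LINT w|lebesgue. cmod (moll (n0 + j) h w - h w))"
    proof (intro always_eventually allI)
      fix j
      have ih: "integrable lebesgue (\<lambda>w. moll (n0 + j) h w - h w)" using integrable_moll[OF h] h by simp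
      have ae: "AE w in lebesgue. (cmod (h w - moll (n0 + j) h w))\<^sup>2 \<le> 2 * C * cmod (moll (n0 + j) h w - h w)"
        using hb
      proof eventually_elim
        case (elim w)
        have "cmod (h w - moll (n0 + j) h w) \<le> 2 * C"
          using norm_triangle_ineq4[of "h w" "moll (n0 + j) h w"] elim cb[of "n0 + j" w] by simp
        then show ?case
          by (simp add: power2_eq_square norm_minus_commute mult_right_mono)
      qed
      have i2: "integrable lebesgue (\<lambda>w. (cmod (h w - moll (n0 + j) h w))\<^sup>2)"
      proof (rule Bochner_Integration.integrable_bound[OF integrable_mult_right[OF integrable_norm[OF ih], of "2 * C"]])
        show "AE w in lebesgue. norm ((cmod (h w - moll (n0 + j) h w))\<^sup>2) \<le> norm (2 * C * norm (moll (n0 + j) h w - h w))"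
          using ae by eventually_elim simp
      qed (use h integrable_moll[OF h] in auto)
      have "(LINT w|lebesgue_on U. (cmod (h w - moll (n0 + j) h w))\<^sup>2) = (LINT w|lebesgue. indicator U w *\<^sub>R (cmod (h w - moll (n0 + j) h w))\<^sup>2)"
        using U by (simp add: Bochner_Integration.integral_restrict_space)
      also have "\<dots> \<le> (LINT w|lebesgue. 2 * C * cmod (moll (n0 + j) h w - h w))"
      proof (rule integral_mono_AE[OF integrable_mult_indicator[OF _ i2]])
        show "AE w in lebesgue. indicator U w *\<^sub>R (cmod (h w - moll (n0 + j) h w))\<^sup>2 \<le> 2 * C * cmod (moll (n0 + j) h w - h w)"
          using ae by eventually_elim (use C0 in \<open>auto simp: indicator_def\<close>)
      qed (use U ih in auto)
      finally show "(LINT w|lebesgue_on U. (cmod (h w - moll (n0 + j) h w))\<^sup>2) \<le> 2 * C * (LINT w|lebesgue. cmod (moll (n0 + j) h w - h w))"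
        by simp
    qed
    have "(\<lambda>j. LINT w|lebesgue. cmod (moll (n0 + j) h w - h w)) \<longlonglongrightarrow> 0"
      using LIMSEQ_ignore_initial_segment[OF moll_L1_tendsto[OF h], of n0] by (simp add: add.commute)
    from tendsto_mult_left[OF this, of "2 * C"]
    show "(\<lambda>j. 2 * C * (LINT w|lebesgue. cmod (moll (n0 + j) h w - h w))) \<longlonglongrightarrow> 0" by simp
  qed simp
  have "(\<lambda>j. sqnorm U (\<lambda>w. f w - \<eta> j w) (\<lambda>e w. H e w - fderiv (\<eta> j) w e)) \<longlonglongrightarrow> 0 + (0 + 0)"
    unfolding sqnorm_def De[OF insertI1] De[of \<i>, simplified]
    unfolding \<eta>_def
    by (intro tendsto_add sq[OF fi AE_I2[OF B]] sq[OF iH bH]) auto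
  then show ?thesis using W12_0_iff[OF U fH] t by auto
qed

section \<open>Measures with vanishing distributional gradient\<close>

lemma test_function_translate:
  assumes "\<And>k. Ck k \<zeta>" "compact K" "\<And>w. w \<notin> K \<Longrightarrow> \<zeta> w = 0" "\<And>w. w \<in> K \<Longrightarrow> w + s \<in> U"
  shows "test_function U (\<lambda>y. \<zeta> (y - s))"
proof (rule test_functionI[of _ "(\<lambda>w. w + s) ` K"])
  show "Ck k (\<lambda>y. \<zeta> (y - s))" for k
    using Ck_affine_compose[OF assms(1), of k 1 "- s"] by simp
  show "compact ((\<lambda>w. w + s) ` K)"
    by (intro compact_continuous_image assms(2) continuous_intros)
  fix w assume w: "w \<notin> (\<lambda>w. w + s) ` K"
  have "w - s \<notin> K"
  proof
    assume "w - s \<in> K"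
    then have "(w - s) + s \<in> (\<lambda>w. w + s) ` K" by blast
    then show False using w by simp
  qed
  then show "\<zeta> (w - s) = 0" by (rule assms(3))
qed (use assms(4) in auto)

lemma frechet_derivative_translate:
  assumes "Ck 1 \<zeta>"
  shows "fderiv (\<lambda>y. \<zeta> (y - s)) y e = fderiv \<zeta> (y - s) e"
proof -
  have "((\<lambda>y. y - s) has_derivative (\<lambda>e. e)) (at y)"
    by (auto intro!: derivative_eq_intros)
  from has_derivative_compose[OF this Ck_differentiable[of 0]] assms
  have "((\<lambda>y. \<zeta> (y - s)) has_derivative (\<lambda>e. fderiv \<zeta> (y - s) e)) (at y)" by simp
  then show ?thesis by (rule frechet_derivative_apply)
qed

text \<open>Write the difference of \<zeta> and its translate as an integral of derivatives along
  the segment from 0 to \<open>s\<close> and exchange the order of integration. For each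
  \<open>t\<close> the inner integral is that of a derivative of a translated test function, whose
  support remains in \<Omega> by the hypothesis on \<open>s\<close>, so it is 0.\<close>

lemma integral_translate_invariant:
  fixes m :: "complex measure"
  assumes m: "finite_measure m" "sets m = sets borel"
    and z: "\<And>\<zeta> e. test_function \<Omega> \<zeta> \<Longrightarrow> (LINT y|m. fderiv \<zeta> y e) = 0"
    and \<zeta>: "\<And>k. Ck k \<zeta>" "compact K" "\<And>w. w \<notin> K \<Longrightarrow> \<zeta> w = 0"
    and s: "\<And>w t. w \<in> K \<Longrightarrow> 0 \<le> t \<Longrightarrow> t \<le> 1 \<Longrightarrow> w + t *\<^sub>R s \<in> \<Omega>"
  shows "(LINT y|m. \<zeta> (y - s)) = (LINT y|m. \<zeta> y)"
proof -
  interpret finite_measure m by (rule m)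
  interpret P: pair_sigma_finite m "lborel :: real measure" ..
  note [measurable_cong] = m(2)
  have sp: "space m = UNIV" using sets_eq_imp_space_eq[OF m(2)] by simp
  let ?D = "\<lambda>y. fderiv \<zeta> y s"
  have cD: "continuous_on UNIV ?D" using \<zeta>(1)[of "Suc 0"] by simp
  have cz: "continuous_on UNIV \<zeta>" using \<zeta>(1)[of 0] by simp
  have D0: "w \<notin> K \<Longrightarrow> ?D w = 0" for w
    using frechet_derivative_outside[where \<eta> = \<zeta>, OF compact_imp_closed[OF \<zeta>(2)] \<zeta>(3)] .
  obtain B where B: "\<And>w. norm (?D w) \<le> B" using continuous_compact_support_bounded[OF cD \<zeta>(2) D0] by blast
  obtain B' where B': "\<And>w. norm (\<zeta> w) \<le> B'" using continuous_compact_support_bounded[OF cz \<zeta>(2,3)] by blast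
  have [measurable]: "?D \<in> borel_measurable borel" "\<zeta> \<in> borel_measurable borel"
    by (intro borel_measurable_continuous_onI cD cz)+
  define F where "F = (\<lambda>y t. indicator {0..1::real} t *\<^sub>R - ?D (y - t *\<^sub>R s))"
  have FTC: "(LINT t|lborel. F y t) = \<zeta> (y - s) - \<zeta> y" for y
  proof -
    have "(LINT t|lborel. indicator {0..1} t *\<^sub>R - ?D (y - t *\<^sub>R s)) = \<zeta> (y - 1 *\<^sub>R s) - \<zeta> (y - 0 *\<^sub>R s)"
    proof (rule integral_FTC_Icc)
      fix t :: real
      have "((\<lambda>t. y - t *\<^sub>R s) has_derivative (\<lambda>h. - (h *\<^sub>R s))) (at t within {0..1})"
        by (auto intro!: derivative_eq_intros)
      from has_derivative_compose[OF this Ck_differentiable[OF \<zeta>(1)[of "Suc 0"]]]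
      have "((\<lambda>t. \<zeta> (y - t *\<^sub>R s)) has_derivative (\<lambda>h. fderiv \<zeta> (y - t *\<^sub>R s) (- (h *\<^sub>R s)))) (at t within {0..1})" .
      moreover have "fderiv \<zeta> v (- (h *\<^sub>R s)) = h *\<^sub>R - ?D v" for h v
      proof -
        interpret linear "fderiv \<zeta> v"
          using has_derivative_linear[OF Ck_differentiable[OF \<zeta>(1)[of "Suc 0"]]] .
        show ?thesis by (simp add: neg scale)
      qed
      ultimately show "((\<lambda>t. \<zeta> (y - t *\<^sub>R s)) has_vector_derivative - ?D (y - t *\<^sub>R s)) (at t within {0..1})"
        by (simp add: has_vector_derivative_def)
    next
      show "continuous_on {0..1} (\<lambda>t. - ?D (y - t *\<^sub>R s))"
        by (intro continuous_intros continuous_on_compose2[OF cD]) auto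
    qed simp
    then show ?thesis by (simp add: F_def)
  qed
  have Fm [measurable]: "case_prod F \<in> borel_measurable (m \<Otimes>\<^sub>M lborel)"
    unfolding F_def by measurable
  have nF: "norm (F y t) \<le> B * indicator {0..1} t" for y t
    using B[of "y - t *\<^sub>R s"] by (auto simp: F_def indicator_def)
  have B0: "0 \<le> B" using B[of 0] norm_ge_zero order_trans by blast
  have Fi: "integrable lborel (F y)" for y
  proof (rule Bochner_Integration.integrable_bound)
    show "integrable lborel (\<lambda>t. B * indicator {0..1::real} t)" by simp
    show "AE t in lborel. norm (F y t) \<le> norm (B * indicator {0..1} t :: real)"
      using nF B0 by (auto simp: abs_of_nonneg)
    show "F y \<in> borel_measurable lborel" unfolding F_def by measurable
  qed
  have int: "integrable (m \<Otimes>\<^sub>M lborel) (case_prod F)"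
  proof (rule P.Fubini_integrable)
    have "integrable m (\<lambda>_. B)" by simp
    then show "integrable m (\<lambda>y. LINT t|lborel. norm (case (y, t) of (y, t) \<Rightarrow> F y t))"
    proof (rule Bochner_Integration.integrable_bound)
      have "(LINT t|lborel. norm (F y t)) \<le> (LINT t|lborel. B * indicator {0..1::real} t)" for y
        by (rule integral_mono) (use Fi nF in auto)
      then show "AE y in m. norm (LINT t|lborel. norm (case (y, t) of (y, t) \<Rightarrow> F y t)) \<le> norm B"
        using B0 by simp
    qed measurable
  qed (use Fi in auto)
  have iz: "integrable m (\<lambda>y. \<zeta> (y - s))" "integrable m \<zeta>"
    by (auto intro!: integrable_const_bound[where B = B'] simp: B')
  have "(LINT y|m. \<zeta> (y - s)) - (LINT y|m. \<zeta> y) = (LINT y|m. LINT t|lborel. F y t)"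
    using iz by (simp add: FTC)
  also have "\<dots> = (LINT t|lborel. LINT y|m. F y t)" by (rule P.Fubini_integral[OF int, symmetric])
  also have "\<dots> = (LINT (t::real)|lborel. 0)"
  proof (rule Bochner_Integration.integral_cong[OF refl])
    fix t :: real
    show "(LINT y|m. F y t) = 0"
    proof (cases "t \<in> {0..1}")
      case True
      have "test_function \<Omega> (\<lambda>y. \<zeta> (y - t *\<^sub>R s))"
        by (rule test_function_translate[OF \<zeta>]) (use s True in auto)
      from z[OF this, of s] have "(LINT y|m. ?D (y - t *\<^sub>R s)) = 0"
        using \<zeta>(1)[of 1] by (simp add: frechet_derivative_translate)
      then show ?thesis using True by (simp add: F_def)
    qed (simp add: F_def)
  qed
  finally show ?thesis by simp
qed

text \<open>The mollified density \<open>s \<mapsto> \<integral> kern \<delta> (y - s) dm\<close> is constant on the ball, by translation invariance.\<close>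

lemma integral_smooth_ball_const:
  fixes m :: "complex measure"
  assumes m: "finite_measure m" "sets m = sets borel"
    and z: "\<And>\<zeta> e. test_function \<Omega> \<zeta> \<Longrightarrow> (LINT y|m. fderiv \<zeta> y e) = 0"
    and r: "0 < r" "ball p (2 * r) \<subseteq> \<Omega>"
  obtains c where "0 \<le> c" "\<And>f K. continuous_on UNIV f \<Longrightarrow> compact K \<Longrightarrow> K \<subseteq> ball p r \<Longrightarrow> (\<And>w. w \<notin> K \<Longrightarrow> f w = 0) \<Longrightarrow>
     (LINT y|m. f y) = complex_of_real c * (LINT y|lborel. f y)"
proof -
  interpret finite_measure m by (rule m)
  interpret P: pair_sigma_finite m "lborel :: complex measure" ..
  note [measurable_cong] = m(2)
  have sp: "space m = UNIV" using sets_eq_imp_space_eq[OF m(2)] by simp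
  define k where "k \<delta> s = (LINT y|m. kern \<delta> (y - s))" for \<delta> s
  have kc: "(LINT y|m. ckern \<delta> (y - s)) = of_real (k \<delta> s)" for \<delta> s
    unfolding k_def by (rule integral_complex_of_real)
  \<comment> \<open>The doubled radius in \<open>ball p (2 * r)\<close> is the room needed to slide
    a kernel of radius \<delta> < r from \<open>p\<close> to any centre \<open>s\<close> in
    \<open>ball p r\<close>.\<close>
  have kconst: "k \<delta> s = k \<delta> p" if \<delta>: "0 < \<delta>" "\<delta> < r" and s: "s \<in> ball p r" for \<delta> s
  proof -
    have "(LINT y|m. ckern \<delta> ((y - (s - p)) - p)) = (LINT y|m. ckern \<delta> (y - p))"
    proof (rule integral_translate_invariant[OF m z, where K = "cball p \<delta>" and \<zeta> = "\<lambda>y. ckern \<delta> (y - p)"])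
      show "Ck n (\<lambda>y. ckern \<delta> (y - p))" for n
        using Ck_affine_compose[OF Ck_kern, of n \<delta> 1 "- p"] by simp
      show "w \<notin> cball p \<delta> \<Longrightarrow> ckern \<delta> (w - p) = 0" for w
        using kern_eq_0[OF \<delta>(1), of "w - p"] by (simp add: dist_norm norm_minus_commute)
      show "w + t *\<^sub>R (s - p) \<in> \<Omega>" if w: "w \<in> cball p \<delta>" and t: "0 \<le> t" "t \<le> 1" for w t
      proof -
        have "norm ((w - p) + t *\<^sub>R (s - p)) \<le> norm (w - p) + t * norm (s - p)"
          using norm_triangle_ineq[of "w - p" "t *\<^sub>R (s - p)"] t by simp
        also have "\<dots> \<le> \<delta> + 1 * norm (s - p)"
          using w t by (intro add_mono mult_right_mono) (auto simp: dist_norm norm_minus_commute)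
        also have "\<dots> < 2 * r" using \<delta> s by (simp add: dist_norm norm_minus_commute)
        finally have "w + t *\<^sub>R (s - p) \<in> ball p (2 * r)"
          by (simp add: dist_norm norm_minus_commute algebra_simps)
        then show ?thesis using r by blast
      qed
    qed auto
    then have "complex_of_real (k \<delta> s) = of_real (k \<delta> p)" by (simp flip: kc)
    then show ?thesis by simp
  qed
  have conv: "(LINT y|m. conv f (ckern \<delta>) y) = of_real (k \<delta> p) * (LINT y|lborel. f y)"
    if \<delta>: "0 < \<delta>" "\<delta> < r" and f: "continuous_on UNIV f" "compact K" "K \<subseteq> ball p r" "\<And>w. w \<notin> K \<Longrightarrow> f w = 0" for f K \<delta>
  proof -
    define F where "F = (\<lambda>y z. f z * ckern \<delta> (y - z))"
    have [measurable]: "f \<in> borel_measurable borel" using f(1) by (rule borel_measurable_continuous_onI)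
    have Fm [measurable]: "case_prod F \<in> borel_measurable (m \<Otimes>\<^sub>M lborel)"
      unfolding F_def by measurable
    have fi: "integrable lborel f" "integrable lebesgue f"
      using integrable_continuous_compact_support[OF f(1,2,4)] by blast+
    have Fi: "integrable lborel (F y)" for y
      using integrable_shift_mult[OF fi(2) \<delta>(1), of y] unfolding F_def
      by (subst (asm) integrable_completion) auto
    obtain Bk where Bk: "\<And>w. norm (ckern \<delta> w) \<le> Bk"
      using continuous_compact_support_bounded[OF continuous_ckern compact_cball[of 0 \<delta>]] kern_eq_0[OF \<delta>(1)]
      by (metis dist_0_norm less_imp_le mem_cball not_le of_real_0)
    have Bk0: "0 \<le> Bk" using Bk[of 0] norm_ge_zero order_trans by blast
    have int: "integrable (m \<Otimes>\<^sub>M lborel) (case_prod F)"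
    proof (rule P.Fubini_integrable)
      have "integrable m (\<lambda>_. Bk * (LINT z|lborel. norm (f z)))" by simp
      then show "integrable m (\<lambda>y. LINT z|lborel. norm (case (y, z) of (y, z) \<Rightarrow> F y z))"
      proof (rule Bochner_Integration.integrable_bound)
        have "(LINT z|lborel. norm (F y z)) \<le> (LINT z|lborel. Bk * norm (f z))" for y
        proof (rule integral_mono)
          show "norm (F y z) \<le> Bk * norm (f z)" for z
            using mult_left_mono[OF Bk[of "y - z"] norm_ge_zero[of "f z"]] by (simp add: F_def norm_mult mult.commute)
        qed (use Fi fi in auto)
        moreover have "0 \<le> (LINT z|lborel. norm (f z))" by simp
        ultimately show "AE y in m. norm (LINT z|lborel. norm (case (y, z) of (y, z) \<Rightarrow> F y z)) \<le> norm (Bk * (LINT z|lborel. norm (f z)))"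
          using Bk0 by (simp add: abs_of_nonneg)
      qed measurable
    qed (use Fi in auto)
    have "(LINT y|m. conv f (ckern \<delta>) y) = (LINT y|m. LINT z|lborel. F y z)"
      unfolding conv_def F_def by (intro Bochner_Integration.integral_cong refl integral_completion) simp
    also have "\<dots> = (LINT z|lborel. LINT y|m. F y z)" by (rule P.Fubini_integral[OF int, symmetric])
    also have "\<dots> = (LINT z|lborel. f z * of_real (k \<delta> p))"
    proof (rule Bochner_Integration.integral_cong[OF refl])
      fix z
      have "(LINT y|m. F y z) = f z * of_real (k \<delta> z)"
        unfolding F_def by (simp flip: kc)
      then show "(LINT y|m. F y z) = f z * of_real (k \<delta> p)"
        using f(3,4) kconst[OF \<delta>, of z] by (cases "z \<in> K") auto
    qed
    finally show ?thesis by (simp add: mult.commute)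
  qed
  have lim: "(\<lambda>n. LINT y|m. moll n f y) \<longlonglongrightarrow> (LINT y|m. f y)"
    if f: "continuous_on UNIV f" "compact K" "\<And>w. w \<notin> K \<Longrightarrow> f w = 0" for f K
  proof -
    obtain B where B: "\<And>w. norm (f w) \<le> B" using continuous_compact_support_bounded[OF f] by blast
    have fi: "integrable lebesgue f" using integrable_continuous_compact_support[OF f] by blast
    show ?thesis
    proof (rule integral_dominated_convergence[where w = "\<lambda>_. B"])
      show "AE x in m. (\<lambda>n. moll n f x) \<longlonglongrightarrow> f x" using moll_tendsto[OF f] by simp
      show "AE x in m. norm (moll n f x) \<le> B" for n
        unfolding moll_def using norm_conv_kern_le[OF fi _ inverse_Suc_pos, of B] B by auto
      show "f \<in> borel_measurable m" using borel_measurable_continuous_onI[OF f(1)] by simp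
      have "continuous_on UNIV (moll n f)" for n using Ck_moll[OF f, of 0] by simp
      then show "moll n f \<in> borel_measurable m" for n
        using borel_measurable_continuous_onI by (metis m(2) measurable_cong_sets)
    qed simp
  qed
  define c where "c = k (r / 2) p"
  have r2: "0 < r / 2" using r by simp
  have c0: "0 \<le> c" unfolding c_def k_def using kern_nonneg[OF r2] by simp
  \<comment> \<open>A reference function of Lebesgue integral 1, supported in the ball: its integral
    against \<open>m\<close> is the constant \<open>c\<close>.\<close>
  let ?f0 = "\<lambda>y. ckern (r / 2) (y - p)"
  have f0: "continuous_on UNIV ?f0" "compact (cball p (r/2))" "cball p (r/2) \<subseteq> ball p r" "\<And>w. w \<notin> cball p (r/2) \<Longrightarrow> ?f0 w = 0"
  proof -
    show "continuous_on UNIV ?f0" by (rule continuous_on_compose2[OF continuous_ckern]) (auto intro!: continuous_intros)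
    show "w \<notin> cball p (r/2) \<Longrightarrow> ?f0 w = 0" for w
      using kern_eq_0[OF r2, of "w - p"] by (simp add: dist_norm norm_minus_commute)
  qed (use r in auto)
  have If0: "(LINT y|lborel. ?f0 y) = 1"
    using integral_kern_shift(1)[OF r2, of p] by (simp add: integral_complex_of_real kern_commute[of _ p])
  have ev: "\<forall>\<^sub>F n in sequentially. (LINT y|m. moll n f y) = of_real (k (inverse (real (Suc n))) p) * (LINT y|lborel. f y)"
    if f: "continuous_on UNIV f" "compact K" "K \<subseteq> ball p r" "\<And>w. w \<notin> K \<Longrightarrow> f w = 0" for f K
    using inverse_Suc_less[OF r(1)]
  proof eventually_elim
    case (elim n)
    show ?case unfolding moll_def by (rule conv[OF inverse_Suc_pos elim f])
  qed
  have I0: "(LINT y|m. ?f0 y) = of_real c" unfolding c_def by (rule kc)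
  \<comment> \<open>Applied to \<open>?f0\<close>, the two descriptions of the mollified integrals
    force the densities \<open>k\<close> at radius \<open>1 / (n + 1)\<close> to converge to
    \<open>c\<close>. The limit for every other \<open>f\<close> is thereby known.\<close>
  have kl: "(\<lambda>n. complex_of_real (k (inverse (real (Suc n))) p)) \<longlonglongrightarrow> of_real c"
    using Lim_transform_eventually[OF lim[OF f0(1,2,4)] ev[OF f0]] unfolding If0 I0 mult_1_right .
  have "(LINT y|m. f y) = complex_of_real c * (LINT y|lborel. f y)"
    if f: "continuous_on UNIV f" "compact K" "K \<subseteq> ball p r" "\<And>w. w \<notin> K \<Longrightarrow> f w = 0" for f K
    using LIMSEQ_unique[OF Lim_transform_eventually[OF lim[OF f(1,2,4)] ev[OF f]] tendsto_mult_right[OF kl]] .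
  then show ?thesis using that[OF c0] by blast
qed

text \<open>The indicator of \<open>K\<close> is a pointwise limit of continuous functions with
  compact support in \<open>B\<close>; dominated convergence on both sides of the integral identity
  gives the measures.\<close>

lemma emeasure_compact_of_integrals:
  fixes m :: "complex measure"
  assumes m: "finite_measure m" "sets m = sets borel" and c: "0 \<le> c" and B: "open B"
    and eq: "\<And>f K. continuous_on UNIV f \<Longrightarrow> compact K \<Longrightarrow> K \<subseteq> B \<Longrightarrow> (\<And>w. w \<notin> K \<Longrightarrow> f w = 0) \<Longrightarrow>
     (LINT y|m. f y) = complex_of_real c * (LINT y|lborel. f y)"
    and K: "compact K" "K \<subseteq> B"
  shows "emeasure m K = ennreal c * emeasure lborel K"
proof (cases "K = {}")
  case False
  interpret finite_measure m by (rule m)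
  note [measurable_cong] = m(2)
  have Kb [measurable]: "K \<in> sets borel" using K by (simp add: borel_compact)
  obtain r where r: "0 < r" "(\<Union>x\<in>K. cball x r) \<subseteq> B"
    using compact_subset_open_imp_cball_epsilon_subset[OF K(1) B K(2)] by blast
  \<comment> \<open>Equal to 1 on \<open>K\<close> and falling linearly to 0 at distance
    \<open>r / (n + 1)\<close>. This is at most \<open>r\<close>, so all supports lie in the one
    compact set \<open>K'\<close>.\<close>
  define f where "f n w = max 0 (1 - infdist w K * (real (Suc n) / r))" for n w
  define K' where "K' = {w. infdist w K \<le> r}"
  have K': "compact K'" unfolding K'_def by (rule compact_infdist_le[OF False K(1) r(1)])
  have K'B: "K' \<subseteq> B"
  proof
    fix w assume w: "w \<in> K'"
    obtain x where "x \<in> K" "infdist w K = dist w x"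
      using infdist_attains_inf[OF compact_imp_closed[OF K(1)] False] by metis
    then have "w \<in> cball x r" using w by (simp add: K'_def dist_commute)
    then show "w \<in> B" using r(2) \<open>x \<in> K\<close> by blast
  qed
  have cf: "continuous_on UNIV (f n)" for n unfolding f_def by (intro continuous_intros)
  have f0: "f n w = 0" if "w \<notin> K'" for n w
  proof -
    have "r < infdist w K" using that by (simp add: K'_def)
    then have "r * (real (Suc n) / r) \<le> infdist w K * (real (Suc n) / r)"
      using r by (intro mult_right_mono) auto
    then show ?thesis using r by (simp add: f_def)
  qed
  have f1: "0 \<le> f n w" "f n w \<le> 1" for n w
    using r infdist_nonneg[of w K] by (auto simp: f_def)
  have flim: "(\<lambda>n. f n w) \<longlonglongrightarrow> indicator K w" for w
  proof (cases "w \<in> K")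
    case True then show ?thesis by (simp add: f_def)
  next
    case False
    then have d: "0 < infdist w K"
      using in_closed_iff_infdist_zero[OF compact_imp_closed[OF K(1)] \<open>K \<noteq> {}\<close>] infdist_nonneg[of w K] by force
    have "0 < infdist w K / r" using d r by simp
    then have "\<forall>\<^sub>F n in sequentially. inverse (real (Suc n)) < infdist w K / r"
      by (rule inverse_Suc_less)
    then have "\<forall>\<^sub>F n in sequentially. f n w = 0"
    proof eventually_elim
      case (elim n)
      then have "1 < infdist w K * (real (Suc n) / r)" using r by (simp add: field_simps)
      then show ?case by (simp add: f_def)
    qed
    then show ?thesis using False by (simp add: tendsto_eventually)
  qed
  have fm [measurable]: "f n \<in> borel_measurable borel" for n by (rule borel_measurable_continuous_onI[OF cf])
  have K'f: "integrable lborel (indicator K' :: complex \<Rightarrow> real)"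
    using emeasure_compact_finite[OF K'] K' by (intro integrable_real_indicator) (auto simp: borel_compact)
  have 1: "(\<lambda>n. LINT y|m. f n y) \<longlonglongrightarrow> (LINT y|m. indicator K y)"
    by (rule integral_dominated_convergence[where w = "\<lambda>_. 1"]) (use flim f1 in \<open>auto simp: abs_of_nonneg\<close>)
  have 2: "(\<lambda>n. LINT y|lborel. f n y) \<longlonglongrightarrow> (LINT y|lborel. indicator K y)"
  proof (rule integral_dominated_convergence[OF _ _ K'f])
    show "AE w in lborel. norm (f n w) \<le> indicator K' w" for n
      using f0 f1 by (auto simp: indicator_def abs_of_nonneg)
  qed (use flim in auto)
  have "(LINT y|m. f n y) = c * (LINT y|lborel. f n y)" for n
  proof -
    have "(LINT y|m. complex_of_real (f n y)) = of_real c * (LINT y|lborel. complex_of_real (f n y))"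
      by (rule eq[OF _ K' K'B]) (use f0 cf in \<open>auto intro: continuous_intros\<close>)
    then show ?thesis by (simp only: integral_complex_of_real of_real_mult[symmetric] of_real_eq_iff)
  qed
  then have "(LINT y|m. indicator K y) = c * (LINT y|lborel. indicator K y :: real)"
    using LIMSEQ_unique[OF 1] tendsto_mult_left[OF 2, of c] by simp
  then have "measure m K = c * measure lborel K"
    using sets_eq_imp_space_eq[OF m(2)] by simp
  then show ?thesis
    using emeasure_compact_finite[OF K(1)] c by (simp add: emeasure_eq_measure emeasure_eq_ennreal_measure ennreal_mult)
qed simp

text \<open>Uniqueness of measures on an intersection-stable generator, here the closed sets: the
  trace of a closed set on \<open>B\<close> is an increasing union of compact sets, where the two
  measures agree by hypothesis.\<close>

lemma emeasure_open_of_compact: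
  fixes m :: "complex measure"
  assumes m: "finite_measure m" "sets m = sets borel" and B: "open B" "bounded B"
    and eq: "\<And>K. compact K \<Longrightarrow> K \<subseteq> B \<Longrightarrow> emeasure m K = ennreal c * emeasure lborel K"
    and A: "A \<in> sets borel" "A \<subseteq> B"
  shows "emeasure m A = ennreal c * emeasure lborel A"
proof -
  interpret finite_measure m by (rule m)
  have [measurable]: "B \<in> sets borel" using B by simp
  have mB: "B \<in> sets m" using m(2) by simp
  \<comment> \<open>Restriction to \<open>B\<close> is expressed through densities, so that both
    measures live on all Borel sets of the plane and the generator need not be relativised.\<close>
  let ?M = "density m (indicator B)" and ?N = "density lborel (\<lambda>y. ennreal c * indicator B y)"
  have M: "emeasure ?M X = emeasure m (B \<inter> X)" if "X \<in> sets borel" for X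
    using that mB m(2) by (subst emeasure_density) (auto simp: indicator_inter_arith[symmetric])
  have N: "emeasure ?N X = ennreal c * emeasure lborel (B \<inter> X)" if "X \<in> sets borel" for X
    using that by (subst emeasure_density) (auto simp: mult.assoc indicator_inter_arith[symmetric] nn_integral_cmult)
  have "?M = ?N"
  proof (rule measure_eqI_generator_eq[where E = "Collect closed" and \<Omega> = UNIV and A = "\<lambda>_. UNIV"])
    show "Int_stable (Collect (closed :: complex set \<Rightarrow> bool))" by (auto simp: Int_stable_def)
    show "sets ?M = sigma_sets UNIV (Collect closed)" "sets ?N = sigma_sets UNIV (Collect closed)"
      using m(2) by (simp_all add: borel_eq_closed)
    fix X :: "complex set" assume "X \<in> Collect closed"
    then have X: "closed X" "X \<in> sets borel" by auto
    obtain C :: "nat \<Rightarrow> complex set" where C: "\<And>n. compact (C n)" "\<And>n. C n \<subseteq> B" "\<And>n. C n \<subseteq> interior (C (Suc n))" "\<Union>(range C) = B"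
      using open_Union_compact_subsets[OF B(1)] by metis
    have inc: "incseq (\<lambda>n. C n \<inter> X)"
      using C(3) interior_subset by (intro incseq_SucI) blast
    have un: "(\<Union>n. C n \<inter> X) = B \<inter> X" using C(4) by auto
    have comp: "compact (C n \<inter> X)" for n using C(1) X(1) by (rule compact_Int_closed)
    have r: "range (\<lambda>n. C n \<inter> X) \<subseteq> sets borel" using comp by (auto simp: borel_compact)
    have "emeasure m (C n \<inter> X) = ennreal c * emeasure lborel (C n \<inter> X)" for n
      by (rule eq[OF comp]) (use C(2) in auto)
    then have "(SUP n. emeasure m (C n \<inter> X)) = ennreal c * (SUP n. emeasure lborel (C n \<inter> X))"
      by (simp add: SUP_mult_left_ennreal)
    then have "emeasure m (B \<inter> X) = ennreal c * emeasure lborel (B \<inter> X)"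
      using SUP_emeasure_incseq[of "\<lambda>n. C n \<inter> X" m] SUP_emeasure_incseq[of "\<lambda>n. C n \<inter> X" lborel] inc r m(2)
      unfolding un by simp
    then show "emeasure ?M X = emeasure ?N X" by (simp add: M[OF X(2)] N[OF X(2)])
  next
    show "emeasure ?M UNIV \<noteq> \<infinity>" by (subst M) (auto simp: emeasure_eq_measure)
  qed auto
  then have "emeasure ?M A = emeasure ?N A" by simp
  then show ?thesis using A by (simp add: M N Int_absorb1)
qed

text \<open>The measure analogue of the fact that a distribution with zero gradient on a connected
  open set is constant: locally constant densities are glued by connectedness, and countably many
  balls reach every Borel set.\<close>

theorem measure_const_of_zero_gradient:
  fixes m :: "complex measure"
  assumes m: "finite_measure m" "sets m = sets borel" and \<Omega>: "open \<Omega>" "connected \<Omega>"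
    and z: "\<And>\<zeta> e. test_function \<Omega> \<zeta> \<Longrightarrow> (LINT y|m. fderiv \<zeta> y e) = 0"
  obtains c where "0 \<le> c" "\<And>A. A \<in> sets borel \<Longrightarrow> A \<subseteq> \<Omega> \<Longrightarrow> emeasure m A = ennreal c * emeasure lborel A"
proof (cases "\<Omega> = {}")
  case True
  then show ?thesis using that[of 0] by simp
next
  case False
  have "\<exists>r c. 0 < r \<and> ball p r \<subseteq> \<Omega> \<and> 0 \<le> c \<and> (\<forall>A\<in>sets borel. A \<subseteq> ball p r \<longrightarrow> emeasure m A = ennreal c * emeasure lborel A)"
    if p: "p \<in> \<Omega>" for p
  proof -
    obtain R where R: "0 < R" "ball p R \<subseteq> \<Omega>" using \<Omega>(1) p open_contains_ball by blast
    define r where "r = R / 2"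
    have r: "0 < r" "ball p (2 * r) \<subseteq> \<Omega>" using R by (auto simp: r_def)
    obtain c where c: "0 \<le> c" "\<And>f K. continuous_on UNIV f \<Longrightarrow> compact K \<Longrightarrow> K \<subseteq> ball p r \<Longrightarrow> (\<And>w. w \<notin> K \<Longrightarrow> f w = 0) \<Longrightarrow>
       (LINT y|m. f y) = complex_of_real c * (LINT y|lborel. f y)"
      using integral_smooth_ball_const[OF m z r] by blast
    have e: "emeasure m A = ennreal c * emeasure lborel A" if "A \<in> sets borel" "A \<subseteq> ball p r" for A
    proof (rule emeasure_open_of_compact[OF m open_ball bounded_ball _ that])
      fix K assume K: "compact K" "K \<subseteq> ball p r"
      show "emeasure m K = ennreal c * emeasure lborel K"
        by (rule emeasure_compact_of_integrals[OF m c(1) open_ball c(2) K])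
    qed
    have "ball p r \<subseteq> \<Omega>" using subset_ball[of r "2 * r" p] r by auto
    then show ?thesis using r(1) c(1) e by blast
  qed
  then obtain r c where rc: "\<And>p. p \<in> \<Omega> \<Longrightarrow> 0 < r p" "\<And>p. p \<in> \<Omega> \<Longrightarrow> ball p (r p) \<subseteq> \<Omega>" "\<And>p. p \<in> \<Omega> \<Longrightarrow> 0 \<le> c p"
    "\<And>p A. p \<in> \<Omega> \<Longrightarrow> A \<in> sets borel \<Longrightarrow> A \<subseteq> ball p (r p) \<Longrightarrow> emeasure m A = ennreal (c p) * emeasure lborel A"
    by metis
  \<comment> \<open>Two overlapping balls share an open set of positive finite Lebesgue measure, on
    which both constants compute \<open>m\<close>.\<close>
  have eqc: "c q = c p" if p: "p \<in> \<Omega>" and q: "q \<in> ball p (r p)" for p q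
  proof -
    have q\<Omega>: "q \<in> \<Omega>" using rc(2)[OF p] q by blast
    let ?A = "ball p (r p) \<inter> ball q (r q)"
    have A: "open ?A" "?A \<noteq> {}" using q rc(1)[OF q\<Omega>] by auto
    have "emeasure m ?A = ennreal (c p) * emeasure lborel ?A" "emeasure m ?A = ennreal (c q) * emeasure lborel ?A"
      using rc(4)[OF p, of ?A] rc(4)[OF q\<Omega>, of ?A] by auto
    moreover have "emeasure lborel ?A \<noteq> 0"
      using open_not_negligible[OF A] by (auto simp: negligible_iff_emeasure0)
    moreover have "emeasure lborel ?A \<noteq> \<infinity>"
      using emeasure_mono[of ?A "ball p (r p)" lborel] emeasure_lborel_ball_finite[of p "r p"] by (auto simp: top_unique)
    ultimately show ?thesis
      using rc(3)[OF p] rc(3)[OF q\<Omega>]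
      by (cases "emeasure lborel ?A") (auto simp: ennreal_mult[symmetric])
  qed
  have "c constant_on \<Omega>"
  proof (rule locally_constant_imp_constant[OF \<Omega>(2)])
    fix a assume a: "a \<in> \<Omega>"
    show "\<exists>T. openin (top_of_set \<Omega>) T \<and> a \<in> T \<and> (\<forall>x\<in>T. c x = c a)"
    proof (intro exI[of _ "ball a (r a)"] conjI ballI)
      show "openin (top_of_set \<Omega>) (ball a (r a))" by (rule open_subset[OF rc(2)[OF a] open_ball])
      show "a \<in> ball a (r a)" using rc(1)[OF a] by simp
    qed (rule eqc[OF a])
  qed
  then obtain d where d: "\<And>p. p \<in> \<Omega> \<Longrightarrow> c p = d" by (auto simp: constant_on_def)
  have d0: "0 \<le> d" using False d rc(3) by blast
  have "\<Union>((\<lambda>p. ball p (r p)) ` \<Omega>) = \<Omega>"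
  proof
    show "\<Union>((\<lambda>p. ball p (r p)) ` \<Omega>) \<subseteq> \<Omega>" using rc(2) by blast
    show "\<Omega> \<subseteq> \<Union>((\<lambda>p. ball p (r p)) ` \<Omega>)"
    proof
      fix p assume "p \<in> \<Omega>"
      then have "p \<in> ball p (r p)" using rc(1) by simp
      then show "p \<in> \<Union>((\<lambda>p. ball p (r p)) ` \<Omega>)" using \<open>p \<in> \<Omega>\<close> by blast
    qed
  qed
  \<comment> \<open>Countably many of the balls cover \<Omega>, so a Borel set can be cut into
    countably many disjoint pieces, each inside one ball.\<close>
  moreover obtain F where "F \<subseteq> (\<lambda>p. ball p (r p)) ` \<Omega>" "countable F" "\<Union>F = \<Union>((\<lambda>p. ball p (r p)) ` \<Omega>)"
    by (rule Lindelof[of "(\<lambda>p. ball p (r p)) ` \<Omega>"]) auto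
  ultimately have F: "F \<subseteq> (\<lambda>p. ball p (r p)) ` \<Omega>" "countable F" "\<Union>F = \<Omega>" by simp_all
  have Fne: "F \<noteq> {}" using F(3) False by auto
  define X where "X = from_nat_into F"
  have XF: "X n \<in> F" for n unfolding X_def by (rule from_nat_into[OF Fne])
  have rX: "range X = F" unfolding X_def by (rule range_from_nat_into[OF Fne F(2)])
  have Xb: "X n \<in> sets borel" for n using XF[of n] F(1) by auto
  have "emeasure m A = ennreal d * emeasure lborel A" if A: "A \<in> sets borel" "A \<subseteq> \<Omega>" for A
  proof -
    define Y where "Y n = A \<inter> disjointed X n" for n
    have dX: "disjointed X n \<in> sets borel" for n
      using sets.range_disjointed_sets[of X borel] Xb by auto
    have Yb: "range Y \<subseteq> sets borel" using A dX by (auto simp: Y_def)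
    have Yd: "disjoint_family Y"
      using disjoint_family_disjointed[of X] by (auto simp: Y_def disjoint_family_on_def)
    have YA: "(\<Union>n. Y n) = A"
      using A(2) F(3) rX UN_disjointed_eq[of X] by (auto simp: Y_def)
    have "emeasure m (Y n) = ennreal d * emeasure lborel (Y n)" for n
    proof -
      obtain p where p: "p \<in> \<Omega>" "X n = ball p (r p)" using XF[of n] F(1) by auto
      have "Y n \<subseteq> ball p (r p)" using disjointed_subset[of X n] p by (auto simp: Y_def)
      then show ?thesis using rc(4)[OF p(1), of "Y n"] d[OF p(1)] Yb by auto
    qed
    then have "(\<Sum>n. emeasure m (Y n)) = ennreal d * (\<Sum>n. emeasure lborel (Y n))"
      by (simp add: ennreal_suminf_cmult)
    then show ?thesis
      using suminf_emeasure[of Y m] suminf_emeasure[of Y lborel] Yb Yd m(2) by (simp add: YA)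
  qed
  then show ?thesis using that[OF d0] by blast
qed

section \<open>Homeomorphisms with unit Jacobian\<close>

text \<open>The change of variables in the form of an identity of measures. Measurability refers to
  the completed \<sigma>-algebras on both sides, which is more than continuity provides: preimages
  of null sets must again be measurable.\<close>

definition scales_measure :: "complex set \<Rightarrow> complex set \<Rightarrow> (complex \<Rightarrow> complex) \<Rightarrow> real \<Rightarrow> bool" where
  "scales_measure U V \<Phi> c \<longleftrightarrow> 0 \<le> c \<and> \<Phi> \<in> measurable (lebesgue_on U) (lebesgue_on V) \<and>
     distr (lebesgue_on U) (lebesgue_on V) \<Phi> = density (lebesgue_on V) (\<lambda>_. ennreal c)"

text \<open>Borel sets suffice: a Lebesgue null set lies in a Borel null set, whose preimage is null
  by the formula, so the preimage of the smaller set is measurable and null by completeness.\<close>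

lemma scales_measureI:
  assumes U: "open U" and V: "open V" and c: "0 \<le> c" and \<Phi>: "continuous_on U \<Phi>" "\<Phi> ` U \<subseteq> V"
    and eq: "\<And>A. A \<in> sets borel \<Longrightarrow> A \<subseteq> V \<Longrightarrow> emeasure lebesgue (\<Phi> -` A \<inter> U) = ennreal c * emeasure lborel A"
  shows "scales_measure U V \<Phi> c"
proof -
  have \<Phi>b: "\<Phi> -` A \<inter> U \<in> sets lebesgue" if "A \<in> sets borel" for A
  proof -
    have "\<Phi> \<in> borel_measurable (restrict_space borel U)"
      by (rule borel_measurable_continuous_on_restrict[OF \<Phi>(1)])
    from measurable_sets[OF this that] have "\<Phi> -` A \<inter> U \<in> sets (restrict_space borel U)" by (simp add: space_restrict_space)
    then have "\<Phi> -` A \<inter> U \<in> sets borel" using U by (simp add: sets_restrict_space_iff)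
    then show ?thesis by simp
  qed
  have *: "\<Phi> -` A \<inter> U \<in> sets lebesgue \<and> emeasure lebesgue (\<Phi> -` A \<inter> U) = ennreal c * emeasure lebesgue A"
    if A: "A \<in> sets lebesgue" "A \<subseteq> V" for A
  proof -
    \<comment> \<open>A Lebesgue set is a Borel set up to a subset \<open>N\<close> of a Borel null
      set \<open>N'\<close>; intersecting \<open>N'\<close> with \<open>V\<close> brings it into the
      range of the hypothesis.\<close>
    obtain S N N' where SN: "A = S \<union> N" "N \<subseteq> N'" "N' \<in> null_sets lborel" "S \<in> sets lborel"
      using A(1) by (rule sets_completionE)
    let ?N = "N' \<inter> V"
    have N'b: "?N \<in> sets borel" using SN(3) V by auto
    have N'0: "emeasure lborel ?N = 0"
      using SN(3) N'b emeasure_mono[of ?N N' lborel] by (auto simp: null_sets_def)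
    have "emeasure lebesgue (\<Phi> -` ?N \<inter> U) = 0" using eq[OF N'b] N'0 by simp
    then have n0: "\<Phi> -` ?N \<inter> U \<in> null_sets lebesgue" using \<Phi>b[OF N'b] by (simp add: null_sets_def)
    have sub: "\<Phi> -` N \<inter> U \<subseteq> \<Phi> -` ?N \<inter> U" using SN(1,2) A(2) by auto
    have nN: "\<Phi> -` N \<inter> U \<in> null_sets lebesgue"
      by (rule null_sets_completion_subset[OF sub n0])
    have Sb: "S \<in> sets borel" "S \<subseteq> V" using SN A by auto
    have un: "\<Phi> -` A \<inter> U = (\<Phi> -` S \<inter> U) \<union> (\<Phi> -` N \<inter> U)" using SN(1) by auto
    have nN': "N \<in> null_sets lebesgue"
      by (rule null_sets_completion_subset[OF SN(2) null_sets_completionI[OF SN(3)]])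
    have "emeasure lebesgue (\<Phi> -` A \<inter> U) = emeasure lebesgue (\<Phi> -` S \<inter> U)"
      unfolding un by (rule emeasure_Un_null_set[OF \<Phi>b[OF Sb(1)] nN])
    also have "\<dots> = ennreal c * emeasure lebesgue S" using eq[OF Sb] Sb by simp
    also have "emeasure lebesgue S = emeasure lebesgue A"
      unfolding SN(1) using emeasure_Un_null_set[OF _ nN', of S] Sb by simp
    finally show ?thesis
      unfolding un using sets.Un[OF \<Phi>b[OF Sb(1)] null_setsD2[OF nN]] by simp
  qed
  have m: "\<Phi> \<in> measurable (lebesgue_on U) (lebesgue_on V)"
  proof (rule measurableI)
    show "x \<in> space (lebesgue_on U) \<Longrightarrow> \<Phi> x \<in> space (lebesgue_on V)" for x using \<Phi>(2) by auto
    fix A assume "A \<in> sets (lebesgue_on V)"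
    then have "A \<in> sets lebesgue" "A \<subseteq> V" using V by (auto simp: sets_restrict_space_iff)
    then show "\<Phi> -` A \<inter> space (lebesgue_on U) \<in> sets (lebesgue_on U)"
      using *[of A] U by (auto simp: sets_restrict_space_iff)
  qed
  have "distr (lebesgue_on U) (lebesgue_on V) \<Phi> = density (lebesgue_on V) (\<lambda>_. ennreal c)"
  proof (rule measure_eqI)
    fix A assume "A \<in> sets (distr (lebesgue_on U) (lebesgue_on V) \<Phi>)"
    then have A: "A \<in> sets (lebesgue_on V)" by simp
    then have A': "A \<in> sets lebesgue" "A \<subseteq> V" using V by (auto simp: sets_restrict_space_iff)
    have "emeasure (distr (lebesgue_on U) (lebesgue_on V) \<Phi>) A = emeasure (lebesgue_on U) (\<Phi> -` A \<inter> U)"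
      using emeasure_distr[OF m A] by simp
    also have "\<dots> = emeasure lebesgue (\<Phi> -` A \<inter> U)" using U by (intro emeasure_restrict_space) auto
    also have "\<dots> = ennreal c * emeasure lebesgue A" using *[OF A'] by simp
    also have "emeasure lebesgue A = emeasure (lebesgue_on V) A" using V A' by (intro emeasure_restrict_space[symmetric]) auto
    also have "ennreal c * emeasure (lebesgue_on V) A = emeasure (density (lebesgue_on V) (\<lambda>_. ennreal c)) A"
      using A by (subst emeasure_density) (auto simp: nn_integral_cmult)
    finally show "emeasure (distr (lebesgue_on U) (lebesgue_on V) \<Phi>) A = emeasure (density (lebesgue_on V) (\<lambda>_. ennreal c)) A" .
  qed simp
  with m c show ?thesis by (simp add: scales_measure_def)
qed

section \<open>Transport of null sets, integrals and square integrability\<close>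

lemma scales_measure_measurable:
  "scales_measure U V \<Phi> c \<Longrightarrow> h \<in> borel_measurable (lebesgue_on V) \<Longrightarrow> (\<lambda>w. h (\<Phi> w)) \<in> borel_measurable (lebesgue_on U)"
  unfolding scales_measure_def by (auto intro: measurable_compose)

lemma scales_measure_AE:
  assumes "scales_measure U V \<Phi> c" "AE y in lebesgue_on V. P y"
  shows "AE w in lebesgue_on U. P (\<Phi> w)"
proof (rule AE_distrD[where f = \<Phi> and P = P and M' = "lebesgue_on V"])
  show "\<Phi> \<in> measurable (lebesgue_on U) (lebesgue_on V)" using assms(1) by (simp add: scales_measure_def)
  have "AE y in density (lebesgue_on V) (\<lambda>_. ennreal c). P y"
    by (subst AE_density) (use assms(2) in \<open>auto elim: eventually_mono\<close>)
  moreover have "distr (lebesgue_on U) (lebesgue_on V) \<Phi> = density (lebesgue_on V) (\<lambda>_. ennreal c)"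
    using assms(1) by (simp add: scales_measure_def)
  ultimately show "AE y in distr (lebesgue_on U) (lebesgue_on V) \<Phi>. P y" by (simp only:)
qed

lemma scales_measure_integral:
  fixes h :: "complex \<Rightarrow> 'b::{banach, second_countable_topology}"
  assumes s: "scales_measure U V \<Phi> c" and h: "h \<in> borel_measurable (lebesgue_on V)"
  shows "(LINT w|lebesgue_on U. h (\<Phi> w)) = c *\<^sub>R (LINT y|lebesgue_on V. h y)"
    and "integrable (lebesgue_on V) h \<Longrightarrow> integrable (lebesgue_on U) (\<lambda>w. h (\<Phi> w))"
proof -
  have m: "\<Phi> \<in> measurable (lebesgue_on U) (lebesgue_on V)" and c: "0 \<le> c"
    and d: "distr (lebesgue_on U) (lebesgue_on V) \<Phi> = density (lebesgue_on V) (\<lambda>_. ennreal c)"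
    using s by (auto simp: scales_measure_def)
  show "(LINT w|lebesgue_on U. h (\<Phi> w)) = c *\<^sub>R (LINT y|lebesgue_on V. h y)"
    using integral_distr[OF m h] integral_density[OF h, of "\<lambda>_. c"] c by (simp add: d)
  show "integrable (lebesgue_on U) (\<lambda>w. h (\<Phi> w))" if "integrable (lebesgue_on V) h"
    using integrable_distr_eq[OF m h] integrable_density[OF h, of "\<lambda>_. c"] c that by (simp add: d)
qed

lemma square_integrable_compose:
  assumes "scales_measure U V \<Phi> c" "square_integrable V h"
  shows "square_integrable U (\<lambda>w. h (\<Phi> w))"
    and "(LINT w|lebesgue_on U. (cmod (h (\<Phi> w)))\<^sup>2) = c * (LINT y|lebesgue_on V. (cmod (h y))\<^sup>2)"
  using assms scales_measure_measurable[OF assms(1)]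
    scales_measure_integral[OF assms(1), of "\<lambda>y. (cmod (h y))\<^sup>2"]
  by (auto simp: square_integrable_def)

lemma square_integrable_mult_bounded:
  assumes f: "square_integrable U f" and g: "g \<in> borel_measurable (lebesgue_on U)" "AE w in lebesgue_on U. cmod (g w) \<le> M"
  shows "square_integrable U (\<lambda>w. f w * g w)"
    and "(LINT w|lebesgue_on U. (cmod (f w * g w))\<^sup>2) \<le> M\<^sup>2 * (LINT w|lebesgue_on U. (cmod (f w))\<^sup>2)"
proof -
  have fm: "f \<in> borel_measurable (lebesgue_on U)" and fi: "integrable (lebesgue_on U) (\<lambda>w. M\<^sup>2 * (cmod (f w))\<^sup>2)"
    using f by (auto simp: square_integrable_def)
  have le: "AE w in lebesgue_on U. (cmod (f w * g w))\<^sup>2 \<le> M\<^sup>2 * (cmod (f w))\<^sup>2"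
    using g(2)
  proof eventually_elim
    case (elim w)
    have "(cmod (f w))\<^sup>2 * (cmod (g w))\<^sup>2 \<le> (cmod (f w))\<^sup>2 * M\<^sup>2"
      using elim by (intro mult_left_mono power_mono) auto
    then show ?case by (simp add: norm_mult power_mult_distrib mult.commute)
  qed
  have i: "integrable (lebesgue_on U) (\<lambda>w. (cmod (f w * g w))\<^sup>2)"
  proof (rule Bochner_Integration.integrable_bound[OF fi])
    show "AE w in lebesgue_on U. norm ((cmod (f w * g w))\<^sup>2) \<le> norm (M\<^sup>2 * (cmod (f w))\<^sup>2)"
      using le by eventually_elim simp
  qed (use fm g in auto)
  then show "square_integrable U (\<lambda>w. f w * g w)" using fm g by (simp add: square_integrable_def)
  have "(LINT w|lebesgue_on U. (cmod (f w * g w))\<^sup>2) \<le> (LINT w|lebesgue_on U. M\<^sup>2 * (cmod (f w))\<^sup>2)"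
    by (rule integral_mono_AE[OF i fi le])
  then show "(LINT w|lebesgue_on U. (cmod (f w * g w))\<^sup>2) \<le> M\<^sup>2 * (LINT w|lebesgue_on U. (cmod (f w))\<^sup>2)" by simp
qed

section \<open>Transport of the Sobolev spaces\<close>

lemma W12_with_cong:
  assumes "\<And>w. w \<in> U \<Longrightarrow> f w = f' w"
  shows "W12_with U f G \<longleftrightarrow> W12_with U f' G"
proof -
  have "square_integrable U f \<longleftrightarrow> square_integrable U f'"
    unfolding square_integrable_def
    by (intro conj_cong measurable_cong Bochner_Integration.integrable_cong) (use assms in auto)
  then show ?thesis unfolding W12_with_def using has_weak_derivative_cong[OF assms] by simp
qed

lemma W12_0_cong:
  assumes U: "open U" "bounded U" and eq: "\<And>w. w \<in> U \<Longrightarrow> f w = f' w" and f: "f \<in> W12_0 U"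
  shows "f' \<in> W12_0 U"
proof -
  obtain G where G: "W12_with U f G" using W12_0_obtain[OF f] .
  have G': "W12_with U f' G" using G W12_with_cong[OF eq] by simp
  have "sqnorm U (\<lambda>w. f w - h w) H = sqnorm U (\<lambda>w. f' w - h w) H" for h H
    unfolding sqnorm_def by (intro arg_cong2[where f = "(+)"] Bochner_Integration.integral_cong refl) (use eq in auto)
  then show ?thesis using f unfolding W12_0_iff[OF U G] W12_0_iff[OF U G'] by simp
qed

lemma continuous_on_compact_vimage_zero_extension:
  assumes U: "open (U :: complex set)" and hom: "homeomorphism U V \<Phi> \<Psi>" and z: "test_function V \<zeta>"
  obtains K where "compact K" "K \<subseteq> U" "\<And>w. w \<in> U - K \<Longrightarrow> \<zeta> (\<Phi> w) = 0"
    "continuous_on UNIV (\<lambda>w. if w \<in> U then \<zeta> (\<Phi> w) else 0)"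
proof -
  obtain L where L: "compact L" "L \<subseteq> V" "\<And>w. w \<notin> L \<Longrightarrow> \<zeta> w = 0" using test_functionE[OF z] by blast
  have \<Phi>: "continuous_on U \<Phi>" and \<Psi>: "continuous_on V \<Psi>"
    using hom by (auto simp: homeomorphism_def)
  let ?K = "\<Psi> ` L"
  have K: "compact ?K" by (intro compact_continuous_image continuous_on_subset[OF \<Psi> L(2)] L(1))
  have KU: "?K \<subseteq> U" using hom L(2) by (auto simp: homeomorphism_def)
  have zero: "\<zeta> (\<Phi> w) = 0" if "w \<in> U - ?K" for w
  proof (rule L(3))
    have "\<Psi> (\<Phi> w) = w" using that hom by (auto simp: homeomorphism_def)
    then show "\<Phi> w \<notin> L" using that by (metis DiffD2 imageI)
  qed
  have "continuous_on (U \<union> - ?K) (\<lambda>w. if w \<in> U then \<zeta> (\<Phi> w) else 0)"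
  proof (rule continuous_on_open_Un)
    have "continuous_on U (\<lambda>w. \<zeta> (\<Phi> w))"
      by (rule continuous_on_compose2[OF test_function_continuous[OF z] \<Phi>]) auto
    then show "continuous_on U (\<lambda>w. if w \<in> U then \<zeta> (\<Phi> w) else 0)" by (simp cong: continuous_on_cong)
    have "continuous_on (- ?K) (\<lambda>w. 0 :: complex)" by (rule continuous_on_const)
    then show "continuous_on (- ?K) (\<lambda>w. if w \<in> U then \<zeta> (\<Phi> w) else 0)"
      by (rule continuous_on_eq) (use zero in auto)
  qed (use U compact_imp_closed[OF K] in \<open>auto simp: open_Compl\<close>)
  moreover have "U \<union> - ?K = UNIV" using KU by auto
  ultimately show ?thesis using that[OF K KU zero] by simp
qed

text \<open>Stated for an abstract bounded matrix \<open>P\<close> playing the role of the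
  differential, so that it applies both to \<phi> and to its inverse. The chain rule is assumed for
  test functions only; it extends to \<open>W12_0\<close> because composition is bounded for
  \<open>sqnorm\<close>.\<close>

lemma W12_0_transfer:
  assumes U: "open U" "bounded U" and V: "open V" "bounded V"
    and hom: "homeomorphism U V \<Phi> \<Psi>" and s: "scales_measure U V \<Phi> c"
    and P: "\<And>j e. j \<in> {1, \<i>} \<Longrightarrow> e \<in> {1, \<i>} \<Longrightarrow> P j e \<in> borel_measurable (lebesgue_on U)"
      "\<And>j e. j \<in> {1, \<i>} \<Longrightarrow> e \<in> {1, \<i>} \<Longrightarrow> AE w in lebesgue_on U. cmod (P j e w) \<le> M"
    and wd: "\<And>\<zeta> e. test_function V \<zeta> \<Longrightarrow> e \<in> {1, \<i>} \<Longrightarrow> has_weak_derivative U e (\<lambda>w. \<zeta> (\<Phi> w))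
      (\<lambda>w. fderiv \<zeta> (\<Phi> w) 1 * P 1 e w + fderiv \<zeta> (\<Phi> w) \<i> * P \<i> e w)"
    and g: "g \<in> W12_0 V" "W12_with V g G"
  shows "(\<lambda>w. g (\<Phi> w)) \<in> W12_0 U"
    and "W12_with U (\<lambda>w. g (\<Phi> w)) (\<lambda>e w. G 1 (\<Phi> w) * P 1 e w + G \<i> (\<Phi> w) * P \<i> e w)"
proof -
  have c: "0 \<le> c" using s by (simp add: scales_measure_def)
  have \<Phi>c: "continuous_on U \<Phi>" using hom by (simp add: homeomorphism_def)
  obtain \<zeta> where \<zeta>: "\<And>j. test_function V (\<zeta> j)"
    "(\<lambda>j. sqnorm V (\<lambda>y. g y - \<zeta> j y) (\<lambda>e y. G e y - fderiv (\<zeta> j) y e)) \<longlonglongrightarrow> 0"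
    using g W12_0_iff[OF V g(2)] by blast
  define D where "D j e w = fderiv (\<zeta> j) (\<Phi> w) 1 * P 1 e w + fderiv (\<zeta> j) (\<Phi> w) \<i> * P \<i> e w" for j e w
  have u: "(\<lambda>w. \<zeta> j (\<Phi> w)) \<in> W12_0 U \<and> W12_with U (\<lambda>w. \<zeta> j (\<Phi> w)) (D j)" for j
  proof -
    note t = \<zeta>(1)[of j]
    obtain B where B: "\<And>y. cmod (\<zeta> j y) \<le> B" using test_function_bounded[OF t] by blast
    obtain C1 where C1: "\<And>y. cmod (fderiv (\<zeta> j) y 1) \<le> C1" "0 \<le> C1"
      using test_function_bounded[OF test_function_frechet_derivative[OF t]] by blast
    obtain C2 where C2: "\<And>y. cmod (fderiv (\<zeta> j) y \<i>) \<le> C2" "0 \<le> C2"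
      using test_function_bounded[OF test_function_frechet_derivative[OF t]] by blast
    let ?B = "max B (C1 * M + C2 * M)"
    have b: "AE w in lebesgue_on U. cmod (D j e w) \<le> ?B" if e: "e \<in> {1, \<i>}" for e
      using P(2)[OF _ e, of 1, simplified] P(2)[OF _ e, of \<i>, simplified]
    proof eventually_elim
      case (elim w)
      have "cmod (D j e w) \<le> cmod (fderiv (\<zeta> j) (\<Phi> w) 1) * cmod (P 1 e w) + cmod (fderiv (\<zeta> j) (\<Phi> w) \<i>) * cmod (P \<i> e w)"
        unfolding D_def by (rule order_trans[OF norm_triangle_ineq]) (simp add: norm_mult)
      also have "\<dots> \<le> C1 * M + C2 * M"
        using elim C1 C2 by (intro add_mono mult_mono) auto
      finally show ?case by simp
    qed
    have d: "has_weak_derivative U e (\<lambda>w. \<zeta> j (\<Phi> w)) (D j e)" if "e \<in> {1, \<i>}" for e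
      unfolding D_def[abs_def] by (rule wd[OF t that])
    have cu: "continuous_on U (\<lambda>w. \<zeta> j (\<Phi> w))"
      by (rule continuous_on_compose2[OF test_function_continuous[OF t] \<Phi>c]) auto
    have W: "W12_with U (\<lambda>w. \<zeta> j (\<Phi> w)) (D j)"
    proof (rule W12_with_bounded[OF U _ _ d b])
      show "(\<lambda>w. \<zeta> j (\<Phi> w)) \<in> borel_measurable (lebesgue_on U)"
        using U by (intro continuous_imp_measurable_on_sets_lebesgue cu) auto
      show "AE w in lebesgue_on U. cmod (\<zeta> j (\<Phi> w)) \<le> ?B" using B by (auto simp: le_max_iff_disj)
    qed
    obtain K where K: "compact K" "K \<subseteq> U" "\<And>w. w \<in> U - K \<Longrightarrow> \<zeta> j (\<Phi> w) = 0"
      "continuous_on UNIV (\<lambda>w. if w \<in> U then \<zeta> j (\<Phi> w) else 0)"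
      using continuous_on_compact_vimage_zero_extension[OF U(1) hom t] by blast
    have "(\<lambda>w. if w \<in> U then \<zeta> j (\<Phi> w) else 0) \<in> W12_0 U"
    proof (rule bounded_compact_support_W12_0[OF U K(4,1,2) _ _ b])
      show "w \<notin> K \<Longrightarrow> (if w \<in> U then \<zeta> j (\<Phi> w) else 0) = 0" for w using K(3) by auto
      show "has_weak_derivative U e (\<lambda>w. if w \<in> U then \<zeta> j (\<Phi> w) else 0) (D j e)" if "e \<in> {1, \<i>}" for e
        using d[OF that] by (subst has_weak_derivative_cong[where f' = "\<lambda>w. \<zeta> j (\<Phi> w)"]) auto
    qed
    then have "(\<lambda>w. \<zeta> j (\<Phi> w)) \<in> W12_0 U" by (rule W12_0_cong[OF U, rotated]) simp
    with W show ?thesis by blast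
  qed
  have sG: "square_integrable V (G e)" if "e \<in> {1, \<i>}" for e using g(2) that by (auto simp: W12_with_def)
  have sD: "square_integrable V (\<lambda>y. fderiv (\<zeta> j) y e)" if "e \<in> {1, \<i>}" for e j
    using W12_with_test[OF V \<zeta>(1)] that by (auto simp: W12_with_def)
  have sg: "square_integrable V g" using g(2) by (simp add: W12_with_def)
  have s\<zeta>: "square_integrable V (\<zeta> j)" for j using W12_with_test[OF V \<zeta>(1)] by (auto simp: W12_with_def)
  have PG: "square_integrable U (\<lambda>w. h (\<Phi> w) * P i e w)"
     "(LINT w|lebesgue_on U. (cmod (h (\<Phi> w) * P i e w))\<^sup>2) \<le> M\<^sup>2 * (c * (LINT y|lebesgue_on V. (cmod (h y))\<^sup>2))"
    if "i \<in> {1, \<i>}" "e \<in> {1, \<i>}" "square_integrable V h" for i e h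
    using square_integrable_mult_bounded[OF square_integrable_compose(1)[OF s that(3)] P(1)[OF that(1,2)] P(2)[OF that(1,2)]]
      square_integrable_compose(2)[OF s that(3)] by simp_all
  let ?H = "\<lambda>e w. G 1 (\<Phi> w) * P 1 e w + G \<i> (\<Phi> w) * P \<i> e w"
  let ?s = "\<lambda>j. sqnorm V (\<lambda>y. g y - \<zeta> j y) (\<lambda>e y. G e y - fderiv (\<zeta> j) y e)"
  \<comment> \<open>The function part scales by \<open>c\<close>. In each of the two directions, the
    square of a sum of two terms costs a factor 2 and each entry of \<open>P\<close> a factor
    \<open>M\<^sup>2\<close>, which together give \<open>4 * M\<^sup>2 * c\<close> for the
    gradient.\<close>
  have le: "sqnorm U (\<lambda>w. g (\<Phi> w) - \<zeta> j (\<Phi> w)) (\<lambda>e w. ?H e w - D j e w) \<le> (c + 4 * M\<^sup>2 * c) * ?s j" for j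
  proof -
    let ?J = "LINT y|lebesgue_on V. (cmod (g y - \<zeta> j y))\<^sup>2"
    let ?I = "\<lambda>e. LINT y|lebesgue_on V. (cmod (G e y - fderiv (\<zeta> j) y e))\<^sup>2"
    have e0: "(LINT w|lebesgue_on U. (cmod (g (\<Phi> w) - \<zeta> j (\<Phi> w)))\<^sup>2) = c * ?J"
      using square_integrable_compose(2)[OF s square_integrable_diff[OF sg s\<zeta>]] .
    have e1: "(LINT w|lebesgue_on U. (cmod (?H e w - D j e w))\<^sup>2) \<le> 2 * (M\<^sup>2 * (c * ?I 1)) + 2 * (M\<^sup>2 * (c * ?I \<i>))"
      if e: "e \<in> {1, \<i>}" for e
    proof -
      let ?a = "\<lambda>i w. (G i (\<Phi> w) - fderiv (\<zeta> j) (\<Phi> w) i) * P i e w"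
      have "?H e w - D j e w = ?a 1 w + ?a \<i> w" for w by (simp add: D_def algebra_simps)
      then have "(LINT w|lebesgue_on U. (cmod (?H e w - D j e w))\<^sup>2) = (LINT w|lebesgue_on U. (cmod (?a 1 w + ?a \<i> w))\<^sup>2)"
        by simp
      also have "\<dots> \<le> 2 * (LINT w|lebesgue_on U. (cmod (?a 1 w))\<^sup>2) + 2 * (LINT w|lebesgue_on U. (cmod (?a \<i> w))\<^sup>2)"
        by (rule integral_norm_add_sq) (use PG(1)[OF _ e square_integrable_diff[OF sG sD]] in auto)
      also have "\<dots> \<le> 2 * (M\<^sup>2 * (c * ?I 1)) + 2 * (M\<^sup>2 * (c * ?I \<i>))"
        using PG(2)[OF _ e square_integrable_diff[OF sG sD], of 1 1 1 j] PG(2)[OF _ e square_integrable_diff[OF sG sD], of \<i> \<i> \<i> j]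
        by (intro add_mono mult_left_mono) auto
      finally show ?thesis .
    qed
    have "sqnorm U (\<lambda>w. g (\<Phi> w) - \<zeta> j (\<Phi> w)) (\<lambda>e w. ?H e w - D j e w) \<le> c * ?J + 4 * M\<^sup>2 * c * (?I 1 + ?I \<i>)"
      unfolding sqnorm_def e0 using e1[of 1] e1[of \<i>] by (simp add: algebra_simps)
    also have "\<dots> \<le> (c + 4 * M\<^sup>2 * c) * (?J + (?I 1 + ?I \<i>))"
    proof -
      have "0 \<le> 4 * M\<^sup>2 * c * ?J" "0 \<le> c * (?I 1 + ?I \<i>)" using c by simp_all
      then show ?thesis by (simp add: algebra_simps)
    qed
    finally show ?thesis by (simp add: sqnorm_def)
  qed
  have lim: "(\<lambda>j. sqnorm U (\<lambda>w. g (\<Phi> w) - \<zeta> j (\<Phi> w)) (\<lambda>e w. ?H e w - D j e w)) \<longlonglongrightarrow> 0"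
  proof (rule tendsto_sandwich[OF _ _ tendsto_const])
    show "(\<lambda>j. (c + 4 * M\<^sup>2 * c) * ?s j) \<longlonglongrightarrow> 0"
      using tendsto_mult_left[OF \<zeta>(2), of "c + 4 * M\<^sup>2 * c"] by simp
  qed (use le in \<open>auto simp: sqnorm_nonneg\<close>)
  have sH: "square_integrable U (?H e)" if e: "e \<in> {1, \<i>}" for e
    by (intro square_integrable_add PG(1)[OF _ e sG]) auto
  note L = W12_0_limit[OF U square_integrable_compose(1)[OF s sg] sH, where u = "\<lambda>j w. \<zeta> j (\<Phi> w)" and D = D, OF _ _ _ lim]
  show "(\<lambda>w. g (\<Phi> w)) \<in> W12_0 U" "W12_with U (\<lambda>w. g (\<Phi> w)) ?H"
    using L u by blast+
qed

lemma has_weak_derivative_Re_Im: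
  assumes U: "open U" and f: "has_weak_derivative U e f g"
  shows "has_weak_derivative U e (\<lambda>w. of_real (Re (f w))) (\<lambda>w. of_real (Re (g w)))"
    and "has_weak_derivative U e (\<lambda>w. of_real (Im (f w))) (\<lambda>w. of_real (Im (g w)))"
proof -
  note c = has_weak_derivative_cnj[OF f]
  have re: "of_real (Re z) = (1/2) * (z + cnj z)" and im: "of_real (Im z) = (- \<i> / 2) * (z - cnj z)" for z
    by (simp_all add: complex_eq_iff)
  show "has_weak_derivative U e (\<lambda>w. of_real (Re (f w))) (\<lambda>w. of_real (Re (g w)))"
    unfolding re by (rule has_weak_derivative_cmult[OF has_weak_derivative_add[OF U f c]])
  show "has_weak_derivative U e (\<lambda>w. of_real (Im (f w))) (\<lambda>w. of_real (Im (g w)))"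
    unfolding im by (rule has_weak_derivative_cmult[OF has_weak_derivative_diff[OF U f c]])
qed

text \<open>The setting without the coefficient matrix: \<open>f1\<close> and \<open>f2\<close> are
  the partial derivatives of \<phi>, bounded by \<open>M\<close>, and the Jacobian is 1 with its
  sign. All that concerns composition with \<phi> and \<psi> is derived here. That \<open>U\<close>
  is nonempty makes the scaling constant positive.\<close>

locale unit_jacobian_homeomorphism =
  fixes U V :: "complex set" and \<phi> \<psi> f1 f2 :: "complex \<Rightarrow> complex" and M :: real
  assumes U: "open U" "bounded U" "U \<noteq> {}" and V: "open V" "bounded V" "connected V"
    and hom: "homeomorphism U V \<phi> \<psi>"
    and d1: "has_weak_derivative U 1 \<phi> f1" and d2: "has_weak_derivative U \<i> \<phi> f2"
    and b1: "AE w in lebesgue_on U. cmod (f1 w) \<le> M" and b2: "AE w in lebesgue_on U. cmod (f2 w) \<le> M"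
    and J: "AE w in lebesgue_on U. Re (f1 w) * Im (f2 w) - Re (f2 w) * Im (f1 w) = 1"
begin

text \<open>The coordinates of \<phi> as complex-valued functions, because weak derivatives are
  defined for such functions only. The differential is the matrix with rows (p1, p2) and (q1,
  q2).\<close>

definition "p w = complex_of_real (Re (\<phi> w))"
definition "q w = complex_of_real (Im (\<phi> w))"
definition "p1 w = complex_of_real (Re (f1 w))"
definition "q1 w = complex_of_real (Im (f1 w))"
definition "p2 w = complex_of_real (Re (f2 w))"
definition "q2 w = complex_of_real (Im (f2 w))"

lemma cont_\<phi>: "continuous_on U \<phi>" and cont_\<psi>: "continuous_on V \<psi>"
  and inv_\<psi>\<phi>: "w \<in> U \<Longrightarrow> \<psi> (\<phi> w) = w" and inv_\<phi>\<psi>: "y \<in> V \<Longrightarrow> \<phi> (\<psi> y) = y"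
  and \<phi>_in: "w \<in> U \<Longrightarrow> \<phi> w \<in> V" and \<psi>_in: "y \<in> V \<Longrightarrow> \<psi> y \<in> U"
  using hom by (auto simp: homeomorphism_def)

lemma weak_pq:
  "has_weak_derivative U 1 p p1" "has_weak_derivative U \<i> p p2"
  "has_weak_derivative U 1 q q1" "has_weak_derivative U \<i> q q2"
  unfolding p_def[abs_def] q_def[abs_def] p1_def[abs_def] q1_def[abs_def] p2_def[abs_def] q2_def[abs_def]
  using has_weak_derivative_Re_Im[OF U(1) d1] has_weak_derivative_Re_Im[OF U(1) d2] by auto

lemma cont_pq: "continuous_on U p" "continuous_on U q"
  unfolding p_def[abs_def] q_def[abs_def] by (intro continuous_intros cont_\<phi>)+

lemma pq_measurable: "p1 \<in> borel_measurable (lebesgue_on U)" "p2 \<in> borel_measurable (lebesgue_on U)"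
   "q1 \<in> borel_measurable (lebesgue_on U)" "q2 \<in> borel_measurable (lebesgue_on U)"
  using weak_pq U(1) by (auto simp: has_weak_derivative_def intro: locally_integrable_measurable)

lemma pq_bounded: "AE w in lebesgue_on U. cmod (p1 w) \<le> M" "AE w in lebesgue_on U. cmod (q1 w) \<le> M"
    "AE w in lebesgue_on U. cmod (p2 w) \<le> M" "AE w in lebesgue_on U. cmod (q2 w) \<le> M"
  unfolding p1_def q1_def p2_def q2_def norm_of_real
  using b1 b2 by (auto elim: eventually_mono intro: order_trans[OF abs_Re_le_cmod] order_trans[OF abs_Im_le_cmod])

lemma J': "AE w in lebesgue_on U. p1 w * q2 w - p2 w * q1 w = 1"
  using J by eventually_elim (simp add: p1_def q1_def p2_def q2_def flip: of_real_mult of_real_diff)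

section \<open>The chain rule and integration by parts along \<phi>\<close>

lemma weak_compose:
  assumes z: "test_function X \<zeta>"
  shows "has_weak_derivative U 1 (\<lambda>w. \<zeta> (\<phi> w)) (\<lambda>w. fderiv \<zeta> (\<phi> w) 1 * p1 w + fderiv \<zeta> (\<phi> w) \<i> * q1 w)"
    and "has_weak_derivative U \<i> (\<lambda>w. \<zeta> (\<phi> w)) (\<lambda>w. fderiv \<zeta> (\<phi> w) 1 * p2 w + fderiv \<zeta> (\<phi> w) \<i> * q2 w)"
proof -
  have 1: "fderiv \<zeta> (\<phi> w) x = fderiv \<zeta> (\<phi> w) 1 * of_real (Re x) + fderiv \<zeta> (\<phi> w) \<i> * of_real (Im x)" for x w
    using frechet_derivative_of_real_expand[OF test_function_differentiable[OF z], of "\<phi> w" x] by (simp only: mult.commute)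
  have "(\<lambda>w. fderiv \<zeta> (\<phi> w) (f1 w)) = (\<lambda>w. fderiv \<zeta> (\<phi> w) 1 * p1 w + fderiv \<zeta> (\<phi> w) \<i> * q1 w)"
    "(\<lambda>w. fderiv \<zeta> (\<phi> w) (f2 w)) = (\<lambda>w. fderiv \<zeta> (\<phi> w) 1 * p2 w + fderiv \<zeta> (\<phi> w) \<i> * q2 w)"
    using 1[of _ "f1 _"] 1[of _ "f2 _"] by (simp_all add: fun_eq_iff p1_def p2_def q1_def q2_def)
  then show "has_weak_derivative U 1 (\<lambda>w. \<zeta> (\<phi> w)) (\<lambda>w. fderiv \<zeta> (\<phi> w) 1 * p1 w + fderiv \<zeta> (\<phi> w) \<i> * q1 w)"
    "has_weak_derivative U \<i> (\<lambda>w. \<zeta> (\<phi> w)) (\<lambda>w. fderiv \<zeta> (\<phi> w) 1 * p2 w + fderiv \<zeta> (\<phi> w) \<i> * q2 w)"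
    using weak_chain_rule[OF U(1) cont_\<phi> d1 z] weak_chain_rule[OF U(1) cont_\<phi> d2 z] by simp_all
qed

lemma weak_compose_bounded:
  assumes z: "test_function X \<zeta>"
  obtains C where "AE w in lebesgue_on U. cmod (fderiv \<zeta> (\<phi> w) 1 * p1 w + fderiv \<zeta> (\<phi> w) \<i> * q1 w) \<le> C"
    "AE w in lebesgue_on U. cmod (fderiv \<zeta> (\<phi> w) 1 * p2 w + fderiv \<zeta> (\<phi> w) \<i> * q2 w) \<le> C"
proof -
  obtain C1 where C1: "\<And>y. cmod (fderiv \<zeta> y 1) \<le> C1" "0 \<le> C1"
    using test_function_bounded[OF test_function_frechet_derivative[OF z]] by blast
  obtain C2 where C2: "\<And>y. cmod (fderiv \<zeta> y \<i>) \<le> C2" "0 \<le> C2"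
    using test_function_bounded[OF test_function_frechet_derivative[OF z]] by blast
  have le: "cmod (fderiv \<zeta> y 1 * x + fderiv \<zeta> y \<i> * x') \<le> C1 * M + C2 * M"
    if "cmod x \<le> M" "cmod x' \<le> M" for y x x'
  proof -
    have "cmod (fderiv \<zeta> y 1 * x + fderiv \<zeta> y \<i> * x') \<le> cmod (fderiv \<zeta> y 1) * cmod x + cmod (fderiv \<zeta> y \<i>) * cmod x'"
      by (rule order_trans[OF norm_triangle_ineq]) (simp add: norm_mult)
    also have "\<dots> \<le> C1 * M + C2 * M" using that C1 C2 by (intro add_mono mult_mono) auto
    finally show ?thesis .
  qed
  show ?thesis
  proof (rule that)
    show "AE w in lebesgue_on U. cmod (fderiv \<zeta> (\<phi> w) 1 * p1 w + fderiv \<zeta> (\<phi> w) \<i> * q1 w) \<le> C1 * M + C2 * M"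
      using pq_bounded(1,2) by eventually_elim (rule le)
    show "AE w in lebesgue_on U. cmod (fderiv \<zeta> (\<phi> w) 1 * p2 w + fderiv \<zeta> (\<phi> w) \<i> * q2 w) \<le> C1 * M + C2 * M"
      using pq_bounded(3,4) by eventually_elim (rule le)
  qed
qed

text \<open>The null Lagrangian identity with a = \<zeta> \<circ> \<phi> and b = q or b = p. The
  chain rule expands the gradient of \<open>a\<close>; one part cancels as the exterior product of
  dq (or dp) with itself, and the other is a partial derivative of \<zeta> at \<phi> times J,
  respectively -J. This sign is why the second formula carries no minus.\<close>

lemma integration_by_parts:
  assumes t: "test_function U \<eta>" and z: "test_function X \<zeta>"
  shows "(LINT w|lebesgue_on U. \<eta> w * fderiv \<zeta> (\<phi> w) 1)
      = - (LINT w|lebesgue_on U. \<zeta> (\<phi> w) * (fderiv \<eta> w 1 * q2 w - fderiv \<eta> w \<i> * q1 w))"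
    and "(LINT w|lebesgue_on U. \<eta> w * fderiv \<zeta> (\<phi> w) \<i>)
      = (LINT w|lebesgue_on U. \<zeta> (\<phi> w) * (fderiv \<eta> w 1 * p2 w - fderiv \<eta> w \<i> * p1 w))"
proof -
  define z1 z2 where "z1 y = fderiv \<zeta> y 1" and "z2 y = fderiv \<zeta> y \<i>" for y
  obtain C where C: "AE w in lebesgue_on U. cmod (z1 (\<phi> w) * p1 w + z2 (\<phi> w) * q1 w) \<le> C"
    "AE w in lebesgue_on U. cmod (z1 (\<phi> w) * p2 w + z2 (\<phi> w) * q2 w) \<le> C"
    using weak_compose_bounded[OF z] unfolding z1_def z2_def by blast
  have cz: "continuous_on U (\<lambda>w. \<zeta> (\<phi> w))" "continuous_on U (\<lambda>w. z1 (\<phi> w))" "continuous_on U (\<lambda>w. z2 (\<phi> w))"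
    unfolding z1_def[abs_def] z2_def[abs_def]
    by (auto intro!: continuous_on_compose2[OF test_function_continuous[OF z] cont_\<phi>]
        continuous_on_compose2[OF test_function_continuous[OF test_function_frechet_derivative[OF z]] cont_\<phi>])
  have mU: "h \<in> borel_measurable (lebesgue_on U)" if "continuous_on U h" for h :: "complex \<Rightarrow> complex"
    using U(1) by (intro continuous_imp_measurable_on_sets_lebesgue that) auto
  note [measurable] = pq_measurable mU[OF cz(1)] mU[OF cz(2)] mU[OF cz(3)]
    mU[OF continuous_on_subset[OF test_function_continuous[OF t] subset_UNIV]]
  note wc = weak_compose[OF z, folded z1_def z2_def]
  note N = null_lagrangian[OF U(1) cz(1) wc C, OF cont_pq(2) weak_pq(3,4) t]
  have "(LINT w|lebesgue_on U. \<eta> w * z1 (\<phi> w))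
      = (LINT w|lebesgue_on U. \<eta> w * ((z1 (\<phi> w) * p1 w + z2 (\<phi> w) * q1 w) * q2 w - (z1 (\<phi> w) * p2 w + z2 (\<phi> w) * q2 w) * q1 w))"
  proof (rule integral_cong_AE)
    show "AE w in lebesgue_on U. \<eta> w * z1 (\<phi> w) = \<eta> w * ((z1 (\<phi> w) * p1 w + z2 (\<phi> w) * q1 w) * q2 w - (z1 (\<phi> w) * p2 w + z2 (\<phi> w) * q2 w) * q1 w)"
      using J'
    proof eventually_elim
      case (elim w)
      have eq: "\<eta> w * ((z1 (\<phi> w) * p1 w + z2 (\<phi> w) * q1 w) * q2 w - (z1 (\<phi> w) * p2 w + z2 (\<phi> w) * q2 w) * q1 w)
        = \<eta> w * z1 (\<phi> w) * (p1 w * q2 w - p2 w * q1 w)" by (simp add: algebra_simps)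
      show ?case by (simp only: eq elim mult_1_right)
    qed
  qed measurable
  then show "(LINT w|lebesgue_on U. \<eta> w * fderiv \<zeta> (\<phi> w) 1)
      = - (LINT w|lebesgue_on U. \<zeta> (\<phi> w) * (fderiv \<eta> w 1 * q2 w - fderiv \<eta> w \<i> * q1 w))"
    using N by (simp add: z1_def)
  note N' = null_lagrangian[OF U(1) cz(1) wc C, OF cont_pq(1) weak_pq(1,2) t]
  have "(LINT w|lebesgue_on U. \<eta> w * z2 (\<phi> w))
      = (LINT w|lebesgue_on U. - (\<eta> w * ((z1 (\<phi> w) * p1 w + z2 (\<phi> w) * q1 w) * p2 w - (z1 (\<phi> w) * p2 w + z2 (\<phi> w) * q2 w) * p1 w)))"
  proof (rule integral_cong_AE)
    show "AE w in lebesgue_on U. \<eta> w * z2 (\<phi> w) = - (\<eta> w * ((z1 (\<phi> w) * p1 w + z2 (\<phi> w) * q1 w) * p2 w - (z1 (\<phi> w) * p2 w + z2 (\<phi> w) * q2 w) * p1 w))"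
      using J'
    proof eventually_elim
      case (elim w)
      have eq: "- (\<eta> w * ((z1 (\<phi> w) * p1 w + z2 (\<phi> w) * q1 w) * p2 w - (z1 (\<phi> w) * p2 w + z2 (\<phi> w) * q2 w) * p1 w))
        = \<eta> w * z2 (\<phi> w) * (p1 w * q2 w - p2 w * q1 w)" by (simp add: algebra_simps)
      show ?case by (simp only: eq elim mult_1_right)
    qed
  qed measurable
  then show "(LINT w|lebesgue_on U. \<eta> w * fderiv \<zeta> (\<phi> w) \<i>)
      = (LINT w|lebesgue_on U. \<zeta> (\<phi> w) * (fderiv \<eta> w 1 * p2 w - fderiv \<eta> w \<i> * p1 w))"
    using N' by (simp add: z2_def)
qed

lemma integral_gradient_compose:
  assumes z: "test_function V \<zeta>"
  shows "(LINT w|lebesgue_on U. fderiv \<zeta> (\<phi> w) e) = 0"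
proof -
  obtain L where L: "compact L" "L \<subseteq> V" "\<And>w. w \<notin> L \<Longrightarrow> \<zeta> w = 0" using test_functionE[OF z] by blast
  have K: "compact (\<psi> ` L)" "\<psi> ` L \<subseteq> U"
    using L \<psi>_in by (auto intro!: compact_continuous_image continuous_on_subset[OF cont_\<psi>])
  obtain \<eta> X where \<eta>: "test_function U \<eta>" "open X" "\<psi> ` L \<subseteq> X" "\<And>w. w \<in> X \<Longrightarrow> \<eta> w = 1"
    using cutoff_exists[OF U(1) K] by blast
  have zd: "\<phi> w \<notin> L \<Longrightarrow> fderiv \<zeta> (\<phi> w) d = 0" for w d
    using frechet_derivative_outside[where \<eta> = \<zeta>, OF compact_imp_closed[OF L(1)] L(3)] .
  have X: "w \<in> X" if "w \<in> U" "\<phi> w \<in> L" for w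
    using that \<eta>(3) inv_\<psi>\<phi> by force
  have a: "(LINT w|lebesgue_on U. fderiv \<zeta> (\<phi> w) d) = (LINT w|lebesgue_on U. \<eta> w * fderiv \<zeta> (\<phi> w) d)" for d
  proof (rule Bochner_Integration.integral_cong[OF refl])
    fix w assume "w \<in> space (lebesgue_on U)"
    then show "fderiv \<zeta> (\<phi> w) d = \<eta> w * fderiv \<zeta> (\<phi> w) d"
      using zd[of w d] X[of w] \<eta>(4)[of w] by (cases "\<phi> w \<in> L") auto
  qed
  have b: "(LINT w|lebesgue_on U. \<zeta> (\<phi> w) * (fderiv \<eta> w 1 * r w - fderiv \<eta> w \<i> * r' w)) = 0" for r r'
  proof -
    have "\<zeta> (\<phi> w) * (fderiv \<eta> w 1 * r w - fderiv \<eta> w \<i> * r' w) = 0" if "w \<in> U" for w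
    proof (cases "\<phi> w \<in> L")
      case True
      then show ?thesis
        using frechet_derivative_outside[of "- X" \<eta> 1 w 1] frechet_derivative_outside[of "- X" \<eta> 1 w \<i>]
          \<eta>(4) closed_Compl[OF \<eta>(2)] X[OF that] by simp
    qed (simp add: L(3))
    then have "(LINT w|lebesgue_on U. \<zeta> (\<phi> w) * (fderiv \<eta> w 1 * r w - fderiv \<eta> w \<i> * r' w)) = (LINT w|lebesgue_on U. 0)"
      by (intro Bochner_Integration.integral_cong) auto
    then show ?thesis by simp
  qed
  have c: "(LINT w|lebesgue_on U. fderiv \<zeta> (\<phi> w) 1) = 0" "(LINT w|lebesgue_on U. fderiv \<zeta> (\<phi> w) \<i>) = 0"
    unfolding a using integration_by_parts[OF \<eta>(1) z] b by simp_all
  have i: "integrable (lebesgue_on U) (\<lambda>w. fderiv \<zeta> (\<phi> w) d)" for d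
  proof -
    note z' = test_function_frechet_derivative[OF z, of d]
    obtain C where C: "\<And>y. cmod (fderiv \<zeta> y d) \<le> C"
      using test_function_bounded[OF z'] by blast
    have m: "(\<lambda>w. fderiv \<zeta> (\<phi> w) d) \<in> borel_measurable (lebesgue_on U)"
      using U(1) by (intro continuous_imp_measurable_on_sets_lebesgue continuous_on_compose2[OF test_function_continuous[OF z'] cont_\<phi>]) auto
    interpret finite_measure "lebesgue_on U" by (rule finite_measure_lebesgue_on[OF open_bounded_lmeasurable[OF U(1,2)]])
    show ?thesis by (rule integrable_const_bound[where B = C]) (use C m in auto)
  qed
  have ex: "fderiv \<zeta> (\<phi> w) e = of_real (Re e) * fderiv \<zeta> (\<phi> w) 1 + of_real (Im e) * fderiv \<zeta> (\<phi> w) \<i>" for w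
    by (rule frechet_derivative_of_real_expand[OF test_function_differentiable[OF z]])
  have "(LINT w|lebesgue_on U. fderiv \<zeta> (\<phi> w) e)
     = (LINT w|lebesgue_on U. of_real (Re e) * fderiv \<zeta> (\<phi> w) 1 + of_real (Im e) * fderiv \<zeta> (\<phi> w) \<i>)"
    by (intro Bochner_Integration.integral_cong refl ex)
  also have "\<dots> = of_real (Re e) * (LINT w|lebesgue_on U. fderiv \<zeta> (\<phi> w) 1) + of_real (Im e) * (LINT w|lebesgue_on U. fderiv \<zeta> (\<phi> w) \<i>)"
    using i by simp
  finally show ?thesis by (simp add: c)
qed

text \<open>The constant is the modulus of the degree of \<open>\<phi>\<close>, that is \<open>1\<close>, but its value is irrelevant: it cancels in the weak equation.\<close>

lemma vimage_emeasure:
  obtains c where "0 < c"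
    "\<And>A. A \<in> sets borel \<Longrightarrow> A \<subseteq> V \<Longrightarrow> emeasure lebesgue (\<phi> -` A \<inter> U) = ennreal c * emeasure lborel A"
proof -
  define m where "m = distr (lebesgue_on U) borel \<phi>"
  have \<phi>m: "\<phi> \<in> borel_measurable (lebesgue_on U)"
    using U(1) by (intro continuous_imp_measurable_on_sets_lebesgue cont_\<phi>) auto
  interpret F: finite_measure "lebesgue_on U" by (rule finite_measure_lebesgue_on[OF open_bounded_lmeasurable[OF U(1,2)]])
  have m: "finite_measure m" "sets m = sets borel"
    unfolding m_def using F.finite_measure_distr[OF \<phi>m] by auto
  have z: "(LINT y|m. fderiv \<zeta> y e) = 0" if t: "test_function V \<zeta>" for \<zeta> e
    unfolding m_def
    using integral_gradient_compose[OF t, of e] borel_measurable_continuous_onI[OF test_function_continuous[OF test_function_frechet_derivative[OF t, of e]]]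
    by (subst integral_distr[OF \<phi>m]) auto
  obtain c where c: "0 \<le> c" "\<And>A. A \<in> sets borel \<Longrightarrow> A \<subseteq> V \<Longrightarrow> emeasure m A = ennreal c * emeasure lborel A"
    using measure_const_of_zero_gradient[OF m V(1,3) z] by blast
  have mA: "emeasure m A = emeasure lebesgue (\<phi> -` A \<inter> U)" if "A \<in> sets borel" for A
    unfolding m_def using emeasure_distr[OF \<phi>m that] U(1)
    by (simp add: emeasure_restrict_space)
  have "\<phi> -` V \<inter> U = U" using \<phi>_in by auto
  \<comment> \<open>The whole of \<open>V\<close> pulls back to \<open>U\<close>, so
    \<open>c = 0\<close> would make the nonempty open set \<open>U\<close> a null set.\<close>
  then have "emeasure lebesgue U = ennreal c * emeasure lborel V"
    using mA[of V] c(2)[of V] V(1) by simp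
  moreover have "emeasure lebesgue U \<noteq> 0"
    using open_not_negligible[OF U(1,3)] by (auto simp: negligible_iff_emeasure0 U(1))
  ultimately have "c \<noteq> 0" by auto
  then have "0 < c" using c(1) by simp
  then show ?thesis using c(2) mA that by metis
qed

lemma scales:
  obtains c where "0 < c" "scales_measure U V \<phi> c" "scales_measure V U \<psi> (1 / c)"
proof -
  obtain c where c: "0 < c"
    "\<And>A. A \<in> sets borel \<Longrightarrow> A \<subseteq> V \<Longrightarrow> emeasure lebesgue (\<phi> -` A \<inter> U) = ennreal c * emeasure lborel A"
    using vimage_emeasure by blast
  have 1: "scales_measure U V \<phi> c"
    by (rule scales_measureI[OF U(1) V(1)]) (use c cont_\<phi> \<phi>_in in auto)
  have 2: "scales_measure V U \<psi> (1 / c)"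
  proof (rule scales_measureI[OF V(1) U(1) _ cont_\<psi>])
    show "0 \<le> 1 / c" using c by simp
    show "\<psi> ` V \<subseteq> U" using \<psi>_in by auto
    fix A :: "complex set" assume A: "A \<in> sets borel" "A \<subseteq> U"
    \<comment> \<open>For the inverse map the formula for \<phi> is applied to this Borel set, whose
      preimage under \<phi> is \<open>A\<close> again; dividing by \<open>c\<close> gives the factor
      \<open>1 / c\<close>.\<close>
    let ?B = "\<psi> -` A \<inter> V"
    have "\<psi> \<in> borel_measurable (restrict_space borel V)"
      by (rule borel_measurable_continuous_on_restrict[OF cont_\<psi>])
    from measurable_sets[OF this A(1)] have "?B \<in> sets (restrict_space borel V)" by (simp add: space_restrict_space)
    then have B: "?B \<in> sets borel" using V(1) by (simp add: sets_restrict_space_iff)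
    have "\<phi> -` ?B \<inter> U = A" using A(2) inv_\<psi>\<phi> \<phi>_in by auto
    then have "emeasure lborel A = ennreal c * emeasure lborel ?B" using c(2)[OF B] A by simp
    then have "ennreal (1 / c) * emeasure lborel A = (ennreal (1 / c) * ennreal c) * emeasure lborel ?B" by (simp add: mult.assoc)
    also have "ennreal (1 / c) * ennreal c = 1" using c(1) by (simp flip: ennreal_mult)
    finally show "emeasure lebesgue ?B = ennreal (1 / c) * emeasure lborel A" using B by simp
  qed
  show ?thesis using that[OF c(1) 1 2] .
qed

text \<open>The coefficients are the entries of the adjugate of \<open>D\<phi>\<close>, which is its inverse since the Jacobian is \<open>1\<close>.\<close>

lemma weak_compose_inverse:
  assumes t: "test_function U \<eta>"
  shows "has_weak_derivative V 1 (\<lambda>y. \<eta> (\<psi> y)) (\<lambda>y. fderiv \<eta> (\<psi> y) 1 * q2 (\<psi> y) + fderiv \<eta> (\<psi> y) \<i> * - q1 (\<psi> y))"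
    and "has_weak_derivative V \<i> (\<lambda>y. \<eta> (\<psi> y)) (\<lambda>y. fderiv \<eta> (\<psi> y) 1 * - p2 (\<psi> y) + fderiv \<eta> (\<psi> y) \<i> * p1 (\<psi> y))"
proof -
  obtain c where c: "0 < c" "scales_measure U V \<phi> c" "scales_measure V U \<psi> (1 / c)" using scales by blast
  define e1 e2 where "e1 w = fderiv \<eta> w 1" and "e2 w = fderiv \<eta> w \<i>" for w
  have t1: "test_function U e1" "test_function U e2"
    unfolding e1_def[abs_def] e2_def[abs_def] by (rule test_function_frechet_derivative[OF t])+
  have mU: "h \<in> borel_measurable (lebesgue_on U)" if "test_function X h" for X h
    using U(1) continuous_on_subset[OF test_function_continuous[OF that]] by (intro continuous_imp_measurable_on_sets_lebesgue) auto
  have mV: "h \<in> borel_measurable (lebesgue_on V)" if "test_function X h" for X h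
    using V(1) continuous_on_subset[OF test_function_continuous[OF that]] by (intro continuous_imp_measurable_on_sets_lebesgue) auto
  have intU: "integrable (lebesgue_on U) (\<lambda>w. r w * h w)"
    if r: "test_function U r" and h: "h \<in> borel_measurable (lebesgue_on U)" "AE w in lebesgue_on U. cmod (h w) \<le> M" for r h
  proof (rule integrable_mult_bounded[OF _ h])
    have "square_integrable U r" using W12_with_test[OF U(1,2) r] by (simp add: W12_with_def)
    then show "integrable (lebesgue_on U) r"
      by (rule square_integrable_imp_integrable[OF open_bounded_lmeasurable[OF U(1,2)]])
  qed
  have iU: "integrable (lebesgue_on U) (\<lambda>w. e1 w * q2 w + e2 w * - q1 w)"
    "integrable (lebesgue_on U) (\<lambda>w. e1 w * - p2 w + e2 w * p1 w)"
    using intU[OF t1(1) pq_measurable(4) pq_bounded(4)] intU[OF t1(2) pq_measurable(3) pq_bounded(2)]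
      intU[OF t1(1) pq_measurable(2) pq_bounded(3)] intU[OF t1(2) pq_measurable(1) pq_bounded(1)] by auto
  have iV: "integrable (lebesgue_on V) (\<lambda>y. h (\<psi> y))" if "integrable (lebesgue_on U) h" for h :: "complex \<Rightarrow> complex"
    using scales_measure_integral(2)[OF c(3) _ that] that by auto
  have lV: "locally_integrable V (\<lambda>y. h (\<psi> y))" if "integrable (lebesgue_on U) h" for h :: "complex \<Rightarrow> complex"
    by (rule integrable_imp_locally_integrable[OF V(1) iV[OF that]])
  have cv: "continuous_on V (\<lambda>y. \<eta> (\<psi> y))"
    by (rule continuous_on_compose2[OF test_function_continuous[OF t] cont_\<psi>]) auto
  have change: "(LINT y|lebesgue_on V. h y) = (1 / c) *\<^sub>R (LINT w|lebesgue_on U. h (\<phi> w))"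
    if "h \<in> borel_measurable (lebesgue_on V)" for h :: "complex \<Rightarrow> complex"
    using scales_measure_integral(1)[OF c(2) that] c(1) by simp
  \<comment> \<open>The integral over \<open>V\<close> is pulled back to \<open>U\<close>, where
    \<eta> \<circ> \<psi> \<circ> \<phi> = \<eta> and the integration by parts along \<phi> applies,
    and is then pushed forward again; the scaling factors of the two passages cancel.\<close>
  have key: "(LINT y|lebesgue_on V. \<eta> (\<psi> y) * fderiv \<zeta> y d) = - (LINT y|lebesgue_on V. k (\<psi> y) * \<zeta> y)"
    if z: "test_function V \<zeta>" and k: "k \<in> borel_measurable (lebesgue_on U)"
      and id: "(LINT w|lebesgue_on U. \<eta> w * fderiv \<zeta> (\<phi> w) d) = - (LINT w|lebesgue_on U. \<zeta> (\<phi> w) * k w)"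
    for \<zeta> d k
  proof -
    have "(LINT y|lebesgue_on V. \<eta> (\<psi> y) * fderiv \<zeta> y d)
        = (1 / c) *\<^sub>R (LINT w|lebesgue_on U. \<eta> (\<psi> (\<phi> w)) * fderiv \<zeta> (\<phi> w) d)"
      by (rule change) (intro borel_measurable_times mV[OF test_function_frechet_derivative[OF z]] scales_measure_measurable[OF c(3)] mU[OF t])
    also have "(LINT w|lebesgue_on U. \<eta> (\<psi> (\<phi> w)) * fderiv \<zeta> (\<phi> w) d) = (LINT w|lebesgue_on U. \<eta> w * fderiv \<zeta> (\<phi> w) d)"
      by (rule Bochner_Integration.integral_cong) (auto simp: inv_\<psi>\<phi>)
    also note id
    also have "(LINT w|lebesgue_on U. \<zeta> (\<phi> w) * k w) = (LINT w|lebesgue_on U. k (\<psi> (\<phi> w)) * \<zeta> (\<phi> w))"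
      by (rule Bochner_Integration.integral_cong) (auto simp: inv_\<psi>\<phi>)
    also have "(1 / c) *\<^sub>R (- (LINT w|lebesgue_on U. k (\<psi> (\<phi> w)) * \<zeta> (\<phi> w))) = - (LINT y|lebesgue_on V. k (\<psi> y) * \<zeta> y)"
      by (subst change) (auto intro!: borel_measurable_times mV[OF z] scales_measure_measurable[OF c(3) k])
    finally show ?thesis .
  qed
  have "has_weak_derivative V 1 (\<lambda>y. \<eta> (\<psi> y)) (\<lambda>y. e1 (\<psi> y) * q2 (\<psi> y) + e2 (\<psi> y) * - q1 (\<psi> y))"
    unfolding has_weak_derivative_def
  proof (intro conjI allI impI locally_integrable_continuous[OF cv] lV[OF iU(1)])
    fix \<zeta> assume z: "test_function V \<zeta>"
    show "(LINT y|lebesgue_on V. \<eta> (\<psi> y) * fderiv \<zeta> y 1) = - (LINT y|lebesgue_on V. (e1 (\<psi> y) * q2 (\<psi> y) + e2 (\<psi> y) * - q1 (\<psi> y)) * \<zeta> y)"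
      by (rule key[OF z]) (use iU(1) integration_by_parts(1)[OF t z] in \<open>auto simp: e1_def e2_def\<close>)
  qed
  then show "has_weak_derivative V 1 (\<lambda>y. \<eta> (\<psi> y)) (\<lambda>y. fderiv \<eta> (\<psi> y) 1 * q2 (\<psi> y) + fderiv \<eta> (\<psi> y) \<i> * - q1 (\<psi> y))"
    by (simp only: e1_def e2_def)
  have "has_weak_derivative V \<i> (\<lambda>y. \<eta> (\<psi> y)) (\<lambda>y. e1 (\<psi> y) * - p2 (\<psi> y) + e2 (\<psi> y) * p1 (\<psi> y))"
    unfolding has_weak_derivative_def
  proof (intro conjI allI impI locally_integrable_continuous[OF cv] lV[OF iU(2)])
    fix \<zeta> assume z: "test_function V \<zeta>"
    have neg: "\<zeta> (\<phi> w) * (e1 w * - p2 w + e2 w * p1 w) = - (\<zeta> (\<phi> w) * (e1 w * p2 w - e2 w * p1 w))" for w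
      by (simp add: algebra_simps)
    show "(LINT y|lebesgue_on V. \<eta> (\<psi> y) * fderiv \<zeta> y \<i>) = - (LINT y|lebesgue_on V. (e1 (\<psi> y) * - p2 (\<psi> y) + e2 (\<psi> y) * p1 (\<psi> y)) * \<zeta> y)"
    proof (rule key[OF z])
      show "(LINT w|lebesgue_on U. \<eta> w * fderiv \<zeta> (\<phi> w) \<i>) = - (LINT w|lebesgue_on U. \<zeta> (\<phi> w) * (e1 w * - p2 w + e2 w * p1 w))"
        unfolding neg using integration_by_parts(2)[OF t z] by (simp add: e1_def e2_def)
    qed (use iU(2) in auto)
  qed
  then show "has_weak_derivative V \<i> (\<lambda>y. \<eta> (\<psi> y)) (\<lambda>y. fderiv \<eta> (\<psi> y) 1 * - p2 (\<psi> y) + fderiv \<eta> (\<psi> y) \<i> * p1 (\<psi> y))"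
    by (simp only: e1_def e2_def)
qed

section \<open>The compositions with \<phi> and \<psi> on \<open>W12_0\<close>\<close>

lemma W12_0_compose:
  assumes g: "g \<in> W12_0 V" "W12_with V g G"
  shows "(\<lambda>w. g (\<phi> w)) \<in> W12_0 U"
    and "has_weak_derivative U 1 (\<lambda>w. g (\<phi> w)) (\<lambda>w. G 1 (\<phi> w) * p1 w + G \<i> (\<phi> w) * q1 w)"
    and "has_weak_derivative U \<i> (\<lambda>w. g (\<phi> w)) (\<lambda>w. G 1 (\<phi> w) * p2 w + G \<i> (\<phi> w) * q2 w)"
proof -
  obtain c where c: "scales_measure U V \<phi> c" using scales by blast
  \<comment> \<open>The differential of \<phi>: the row is \<open>j\<close> (1 for p, \<i> for q)
    and the column is the direction \<open>e\<close>.\<close>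
  define P where "P j e = (if j = 1 then if e = 1 then p1 else p2 else if e = 1 then q1 else q2)" for j e :: complex
  have i1: "\<i> \<noteq> 1" by (simp add: complex_eq_iff)
  have Pm: "P j e \<in> borel_measurable (lebesgue_on U)" "AE w in lebesgue_on U. cmod (P j e w) \<le> M" for j e
    using pq_measurable pq_bounded by (auto simp: P_def)
  have wd: "has_weak_derivative U e (\<lambda>w. \<zeta> (\<phi> w))
      (\<lambda>w. fderiv \<zeta> (\<phi> w) 1 * P 1 e w + fderiv \<zeta> (\<phi> w) \<i> * P \<i> e w)"
    if z: "test_function V \<zeta>" and e: "e \<in> {1, \<i>}" for \<zeta> e
    using weak_compose[OF z] e i1 by (auto simp: P_def)
  note T = W12_0_transfer[OF U(1,2) V(1,2) hom c Pm wd g]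
  show "(\<lambda>w. g (\<phi> w)) \<in> W12_0 U" by (rule T(1))
  show "has_weak_derivative U 1 (\<lambda>w. g (\<phi> w)) (\<lambda>w. G 1 (\<phi> w) * p1 w + G \<i> (\<phi> w) * q1 w)"
    "has_weak_derivative U \<i> (\<lambda>w. g (\<phi> w)) (\<lambda>w. G 1 (\<phi> w) * p2 w + G \<i> (\<phi> w) * q2 w)"
    using T(2) i1 by (auto simp: W12_with_def P_def)
qed

lemma W12_0_compose_inverse:
  assumes g: "g \<in> W12_0 U"
  shows "(\<lambda>y. g (\<psi> y)) \<in> W12_0 V"
proof -
  obtain c where c: "scales_measure V U \<psi> c" using scales by blast
  obtain G where G: "W12_with U g G" using W12_0_obtain[OF g] .
  \<comment> \<open>The adjugate of the differential of \<phi>, evaluated at \<open>\<psi> y\<close>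
    and indexed by row and direction in the same way.\<close>
  define P where "P j e y = (if j = 1 then if e = 1 then q2 (\<psi> y) else - p2 (\<psi> y) else if e = 1 then - q1 (\<psi> y) else p1 (\<psi> y))" for j e y :: complex
  have i1: "\<i> \<noteq> 1" by (simp add: complex_eq_iff)
  note m = scales_measure_measurable[OF c pq_measurable(1)] scales_measure_measurable[OF c pq_measurable(2)]
    scales_measure_measurable[OF c pq_measurable(3)] scales_measure_measurable[OF c pq_measurable(4)]
  note b = scales_measure_AE[OF c pq_bounded(1)] scales_measure_AE[OF c pq_bounded(2)]
    scales_measure_AE[OF c pq_bounded(3)] scales_measure_AE[OF c pq_bounded(4)]
  have Pm: "P j e \<in> borel_measurable (lebesgue_on V)" "AE w in lebesgue_on V. cmod (P j e w) \<le> M" for j e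
    using m b by (auto simp: P_def[abs_def])
  have wd: "has_weak_derivative V e (\<lambda>w. \<zeta> (\<psi> w))
      (\<lambda>w. fderiv \<zeta> (\<psi> w) 1 * P 1 e w + fderiv \<zeta> (\<psi> w) \<i> * P \<i> e w)"
    if z: "test_function U \<zeta>" and e: "e \<in> {1, \<i>}" for \<zeta> e
    using weak_compose_inverse[OF z] e i1 by (auto simp: P_def)
  show ?thesis
    by (rule W12_0_transfer(1)[OF V(1,2) U(1,2) homeomorphism_symD[OF hom] c Pm wd g G])
qed

end

section \<open>Eigenvalues\<close>

text \<open>The conclusions say \<open>A D\<^sup>T = D\<^sup>-\<^sup>1\<close> and \<open>det D = 1\<close> for \<open>A = (a b; b d)\<close> and \<open>D = (\<alpha> \<gamma>; \<beta> \<delta>)\<close>; the hypotheses \<open>re\<close> and \<open>im\<close> are the Beltrami equation.\<close>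

lemma beltrami_matrix_identities:
  fixes a b d \<alpha> \<beta> \<gamma> \<delta> :: real
  assumes det: "a * d - b * b = 1" and a: "0 < a"
    and re: "(2 + a + d) * (\<alpha> - \<delta>) = (d - a) * (\<alpha> + \<delta>) + 2 * b * (\<beta> - \<gamma>)"
    and im: "(2 + a + d) * (\<beta> + \<gamma>) = (d - a) * (\<beta> - \<gamma>) - 2 * b * (\<alpha> + \<delta>)"
    and J: "\<bar>\<alpha> * \<delta> - \<gamma> * \<beta>\<bar> = 1"
  shows "a * \<alpha> + b * \<gamma> = \<delta>" "b * \<alpha> + d * \<gamma> = - \<beta>" "a * \<beta> + b * \<delta> = - \<gamma>" "b * \<beta> + d * \<delta> = \<alpha>"
    "\<alpha> * \<delta> - \<gamma> * \<beta> = 1"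
proof -
  \<comment> \<open>\<open>X\<close>, \<open>Z\<close>, \<open>W\<close>, \<open>Y\<close> are the
    defects in the four equations to be shown. The Beltrami equation itself gives only two relations
    among them, Y = X and W = -Z.\<close>
  define X where "X = a * \<alpha> + b * \<gamma> - \<delta>"
  define Z where "Z = b * \<alpha> + d * \<gamma> + \<beta>"
  define Y where "Y = b * \<beta> + d * \<delta> - \<alpha>"
  define W where "W = a * \<beta> + b * \<delta> + \<gamma>"
  have "2 * (X - Y) = (2 + a + d) * (\<alpha> - \<delta>) - ((d - a) * (\<alpha> + \<delta>) + 2 * b * (\<beta> - \<gamma>))"
    by (simp add: X_def Y_def algebra_simps)
  then have XY: "Y = X" using re by simp
  have "2 * (Z + W) = (2 + a + d) * (\<beta> + \<gamma>) - ((d - a) * (\<beta> - \<gamma>) - 2 * b * (\<alpha> + \<delta>))"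
    by (simp add: Z_def W_def algebra_simps)
  then have WZ: "W = - Z" using im by simp
  have d0: "0 < d"
  proof -
    have "0 < a * d" using det zero_le_square[of b] by linarith
    then show ?thesis using a by (simp add: zero_less_mult_iff)
  qed
  \<comment> \<open>Cayley-Hamilton for the symmetric matrix with entries a, b, d, applied to the
    column of defects (W, Y); with determinant 1 the right side vanishes. This supplies the two
    missing relations.\<close>
  have "a * W + b * Y - ((a + d) * W - Z) = (1 - (a * d - b * b)) * \<beta>"
    by (simp add: W_def Y_def Z_def algebra_simps)
  then have 1: "b * X = - ((d + 1) * Z)" using det unfolding XY WZ by (simp add: algebra_simps)
  have "b * W + d * Y - ((a + d) * Y + X) = (1 - (a * d - b * b)) * \<delta>"
    by (simp add: W_def Y_def X_def algebra_simps)
  then have 2: "b * Z = - ((a + 1) * X)" using det unfolding XY WZ by (simp add: algebra_simps)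
  have "b * (b * X) = - ((d + 1) * (b * Z))" unfolding 1 by (simp add: algebra_simps)
  also have "\<dots> = (d + 1) * ((a + 1) * X)" unfolding 2 by simp
  finally have "b * (b * X) = (d + 1) * ((a + 1) * X)" .
  \<comment> \<open>Eliminating \<open>Z\<close> leaves (a + 1) (d + 1) - b^2, the determinant of I
    + A, as a factor of \<open>X\<close>. It equals 2 + a + d, which is positive.\<close>
  then have "(2 + a + d) * X = (1 - (a * d - b * b)) * X" by (simp add: algebra_simps)
  then have "(2 + a + d) * X = 0" using det by simp
  moreover have "2 + a + d \<noteq> 0" using a d0 by linarith
  ultimately have X0: "X = 0" by simp
  then have "(d + 1) * Z = 0" using 1 by simp
  then have Z0: "Z = 0" using d0 by simp
  show *: "a * \<alpha> + b * \<gamma> = \<delta>" "b * \<alpha> + d * \<gamma> = - \<beta>" "a * \<beta> + b * \<delta> = - \<gamma>" "b * \<beta> + d * \<delta> = \<alpha>"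
    using X0 Z0 XY WZ by (simp_all add: X_def Y_def Z_def W_def)
  \<comment> \<open>The first two equations write the Jacobian as the quadratic form of the matrix
    at the vector (\<alpha>, \<gamma>); completing the square shows that it is not negative, so |J|
    = 1 becomes J = 1.\<close>
  have "a * (\<alpha> * \<delta> - \<gamma> * \<beta>) = (a * \<alpha> + b * \<gamma>)\<^sup>2 + (a * d - b * b) * \<gamma>\<^sup>2"
  proof -
    have "\<alpha> * \<delta> - \<gamma> * \<beta> = \<alpha> * (a * \<alpha> + b * \<gamma>) + \<gamma> * (b * \<alpha> + d * \<gamma>)" using *(1,2) by simp
    then show ?thesis by (simp add: power2_eq_square algebra_simps)
  qed
  then have "0 \<le> a * (\<alpha> * \<delta> - \<gamma> * \<beta>)" using det by simp
  then have "0 \<le> \<alpha> * \<delta> - \<gamma> * \<beta>" using a by (simp add: zero_le_mult_iff)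
  then show "\<alpha> * \<delta> - \<gamma> * \<beta> = 1" using J by simp
qed

text \<open>The complex Beltrami equation is cleared of its denominator and split into real and
  imaginary parts. The conclusions are the entries of A D^T = adj D, where D has the columns
  \<open>f1\<close> and \<open>f2\<close>.\<close>

lemma elliptic_beltrami_identities:
  fixes A :: "real ^ 2 ^ 2" and f1 f2 :: complex
  assumes A: "transpose A = A" "det A = 1" "0 < A $ 1 $ 1"
    and bel: "(f1 + \<i> * f2) / 2 = ((of_real (A $ 2 $ 2) - of_real (A $ 1 $ 1) - 2 * \<i> * of_real (A $ 1 $ 2)) / of_real (det (mat 1 + A))) * ((f1 - \<i> * f2) / 2)"
    and J: "\<bar>Re f1 * Im f2 - Re f2 * Im f1\<bar> = 1"
  shows "A $ 2 $ 1 = A $ 1 $ 2" "A $ 1 $ 1 * Re f1 + A $ 1 $ 2 * Re f2 = Im f2"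
    "A $ 1 $ 2 * Re f1 + A $ 2 $ 2 * Re f2 = - Im f1" "A $ 1 $ 1 * Im f1 + A $ 1 $ 2 * Im f2 = - Re f2"
    "A $ 1 $ 2 * Im f1 + A $ 2 $ 2 * Im f2 = Re f1" "Re f1 * Im f2 - Re f2 * Im f1 = 1"
proof -
  let ?a = "A $ 1 $ 1" and ?b = "A $ 1 $ 2" and ?d = "A $ 2 $ 2"
  show sym: "A $ 2 $ 1 = ?b" by (subst (2) A(1)[symmetric]) (simp add: transpose_def)
  have det: "?a * ?d - ?b * ?b = 1" using A(2) sym by (simp add: det_2)
  \<comment> \<open>For a 2 by 2 matrix of determinant 1 the determinant of I + A is 2 plus the
    trace.\<close>
  have S: "det (mat 1 + A) = 2 + ?a + ?d"
    using det sym by (simp add: det_2 mat_def algebra_simps)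
  have "0 < ?a * ?d" using det zero_le_square[of ?b] by linarith
  then have "0 < ?d" using A(3) by (simp add: zero_less_mult_iff)
  then have "2 + ?a + ?d \<noteq> 0" using A(3) by linarith
  then have S0: "complex_of_real (2 + ?a + ?d) \<noteq> 0" by (simp only: of_real_eq_0_iff not_False_eq_True)
  have "of_real (2 + ?a + ?d) * (f1 + \<i> * f2) = (of_real ?d - of_real ?a - 2 * \<i> * of_real ?b) * (f1 - \<i> * f2)"
  proof -
    have "s * x = m * y" if "x / 2 = (m / s) * (y / 2)" "s \<noteq> 0" for s x m y :: complex
      using that by (simp add: field_simps)
    from this[OF bel[unfolded S] S0] show ?thesis .
  qed
  then have "Re (of_real (2 + ?a + ?d) * (f1 + \<i> * f2)) = Re ((of_real ?d - of_real ?a - 2 * \<i> * of_real ?b) * (f1 - \<i> * f2))"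
    "Im (of_real (2 + ?a + ?d) * (f1 + \<i> * f2)) = Im ((of_real ?d - of_real ?a - 2 * \<i> * of_real ?b) * (f1 - \<i> * f2))"
    by simp_all
  then have re: "(2 + ?a + ?d) * (Re f1 - Im f2) = (?d - ?a) * (Re f1 + Im f2) + 2 * ?b * (Im f1 - Re f2)"
    and im: "(2 + ?a + ?d) * (Im f1 + Re f2) = (?d - ?a) * (Im f1 - Re f2) - 2 * ?b * (Re f1 + Im f2)"
    by (simp_all add: algebra_simps)
  note I = beltrami_matrix_identities[OF det A(3) re im J]
  show "?a * Re f1 + ?b * Re f2 = Im f2" "?b * Re f1 + ?d * Re f2 = - Im f1" "?a * Im f1 + ?b * Im f2 = - Re f2"
    "?b * Im f1 + ?d * Im f2 = Re f1" "Re f1 * Im f2 - Re f2 * Im f1 = 1"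
    using I by simp_all
qed

text \<open>The identity D A D^T = I in the form in which it is integrated: the gradients of the
  composed functions are D^T G and D^T H, and A D^T = adj D turns the form into J times the product
  of \<open>G\<close> and \<open>H\<close>. The entries are complex because the gradients
  are.\<close>

lemma gradient_form_transform:
  fixes a b d p1 p2 q1 q2 G1 G2 H1 H2 :: complex
  assumes "a * p1 + b * p2 = q2" "b * p1 + d * p2 = - q1" "a * q1 + b * q2 = - p2" "b * q1 + d * q2 = p1"
    and J: "p1 * q2 - p2 * q1 = 1"
  shows "(a * (G1 * p1 + G2 * q1) + b * (G1 * p2 + G2 * q2)) * (H1 * p1 + H2 * q1)
      + (b * (G1 * p1 + G2 * q1) + d * (G1 * p2 + G2 * q2)) * (H1 * p2 + H2 * q2) = G1 * H1 + G2 * H2"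
proof -
  have "a * (G1 * p1 + G2 * q1) + b * (G1 * p2 + G2 * q2) = G1 * (a * p1 + b * p2) + G2 * (a * q1 + b * q2)"
    "b * (G1 * p1 + G2 * q1) + d * (G1 * p2 + G2 * q2) = G1 * (b * p1 + d * p2) + G2 * (b * q1 + d * q2)"
    by (simp_all add: algebra_simps)
  then have "(a * (G1 * p1 + G2 * q1) + b * (G1 * p2 + G2 * q2)) * (H1 * p1 + H2 * q1)
      + (b * (G1 * p1 + G2 * q1) + d * (G1 * p2 + G2 * q2)) * (H1 * p2 + H2 * q2)
     = (G1 * q2 + G2 * - p2) * (H1 * p1 + H2 * q1) + (G1 * - q1 + G2 * p1) * (H1 * p2 + H2 * q2)"
    unfolding assms by simp
  also have "\<dots> = (G1 * H1 + G2 * H2) * (p1 * q2 - p2 * q1)" by (simp add: algebra_simps)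
  finally show ?thesis by (simp add: J)
qed

text \<open>Replaces the representatives chosen by \<open>weak_gradient\<close> with any known weak
  derivatives. They agree almost everywhere, and measurability of \<open>A\<close> keeps the
  integrand measurable.\<close>

lemma energy_eq:
  assumes U: "open U" and A: "\<And>k l. (\<lambda>w. A w $ k $ l) \<in> borel_measurable (lebesgue_on U)"
    and g: "has_weak_derivative U 1 g g1" "has_weak_derivative U \<i> g g2"
    and h: "has_weak_derivative U 1 h h1" "has_weak_derivative U \<i> h h2"
    and K: "K \<in> borel_measurable (lebesgue_on U)"
    and eq: "AE w in lebesgue_on U. (of_real (A w $ 1 $ 1) * g1 w + of_real (A w $ 1 $ 2) * g2 w) * h1 w
      + (of_real (A w $ 2 $ 1) * g1 w + of_real (A w $ 2 $ 2) * g2 w) * h2 w = K w"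
  shows "energy A U g h = (LINT w|lebesgue_on U. K w)"
  unfolding energy_def
proof (rule integral_cong_AE)
  have m [measurable]: "weak_derivative U e f \<in> borel_measurable (lebesgue_on U)" if "has_weak_derivative U e f k" for e f k
    using weak_derivative_works[OF that] U by (auto simp: has_weak_derivative_def intro: locally_integrable_measurable)
  have Am: "(\<lambda>w. complex_of_real (A w $ k $ l)) \<in> borel_measurable (lebesgue_on U)" for k l
    using A[of k l] by measurable
  have e: "(\<Sum>k\<in>UNIV. \<Sum>l\<in>UNIV. of_real (A w $ k $ l) * weak_gradient U g w $ l * weak_gradient U h w $ k)
    = (of_real (A w $ 1 $ 1) * weak_derivative U 1 g w + of_real (A w $ 1 $ 2) * weak_derivative U \<i> g w) * weak_derivative U 1 h w
      + (of_real (A w $ 2 $ 1) * weak_derivative U 1 g w + of_real (A w $ 2 $ 2) * weak_derivative U \<i> g w) * weak_derivative U \<i> h w" for w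
    by (simp add: sum_2 weak_gradient_def distrib_right)
  show "(\<lambda>w. \<Sum>k\<in>UNIV. \<Sum>l\<in>UNIV. of_real (A w $ k $ l) * weak_gradient U g w $ l * weak_gradient U h w $ k) \<in> borel_measurable (lebesgue_on U)"
    unfolding e by (intro borel_measurable_add borel_measurable_times Am m[OF g(1)] m[OF g(2)] m[OF h(1)] m[OF h(2)])
  show "AE w in lebesgue_on U. (\<Sum>k\<in>UNIV. \<Sum>l\<in>UNIV. of_real (A w $ k $ l) * weak_gradient U g w $ l * weak_gradient U h w $ k) = K w"
    using eq weak_derivative_AE[OF U g(1)] weak_derivative_AE[OF U g(2)] weak_derivative_AE[OF U h(1)] weak_derivative_AE[OF U h(2)]
    by eventually_elim (simp only: e)
qed (rule K)

lemma energy_cong: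
  assumes "\<And>w. w \<in> U \<Longrightarrow> g w = g' w" "\<And>w. w \<in> U \<Longrightarrow> h w = h' w"
  shows "energy A U g h = energy A U g' h'"
  using weak_derivative_cong[of U g g'] weak_derivative_cong[of U h h'] assms
  by (simp add: energy_def weak_gradient_def)

text \<open>Adds the coefficient matrix. From here on the Beltrami equation is present only through
  \<open>identities\<close>, which is A D^T = adj D together with the symmetry of
  \<open>A\<close>.\<close>

locale area_preserving_quasiconformal = unit_jacobian_homeomorphism +
  fixes A :: "complex \<Rightarrow> real ^ 2 ^ 2"
  assumes Am: "\<And>k l. (\<lambda>w. A w $ k $ l) \<in> borel_measurable (lebesgue_on U)"
    and identities: "AE w in lebesgue_on U. A w $ 2 $ 1 = A w $ 1 $ 2
      \<and> A w $ 1 $ 1 * Re (f1 w) + A w $ 1 $ 2 * Re (f2 w) = Im (f2 w)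
      \<and> A w $ 1 $ 2 * Re (f1 w) + A w $ 2 $ 2 * Re (f2 w) = - Im (f1 w)
      \<and> A w $ 1 $ 1 * Im (f1 w) + A w $ 1 $ 2 * Im (f2 w) = - Re (f2 w)
      \<and> A w $ 1 $ 2 * Im (f1 w) + A w $ 2 $ 2 * Im (f2 w) = Re (f1 w)"
begin

text \<open>Almost everywhere the integrand on \<open>U\<close> is the Laplace integrand evaluated
  at \<open>\<phi> w\<close>; scaling of the measure does the rest.\<close>

lemma energy_compose:
  assumes c: "scales_measure U V \<phi> c" and g: "g \<in> W12_0 V" and h: "h \<in> W12_0 V"
  shows "energy A U (\<lambda>w. g (\<phi> w)) (\<lambda>w. cnj (h (\<phi> w))) = of_real c * energy (\<lambda>_. mat 1) V g (\<lambda>y. cnj (h y))"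
proof -
  obtain G where G: "W12_with V g G" using W12_0_obtain[OF g] .
  obtain H where H: "W12_with V h H" using W12_0_obtain[OF h] .
  define K where "K y = G 1 y * cnj (H 1 y) + G \<i> y * cnj (H \<i> y)" for y
  have wG: "has_weak_derivative V 1 g (G 1)" "has_weak_derivative V \<i> g (G \<i>)"
    and wH: "has_weak_derivative V 1 h (H 1)" "has_weak_derivative V \<i> h (H \<i>)"
    and mG [measurable]: "G 1 \<in> borel_measurable (lebesgue_on V)" "G \<i> \<in> borel_measurable (lebesgue_on V)"
      "H 1 \<in> borel_measurable (lebesgue_on V)" "H \<i> \<in> borel_measurable (lebesgue_on V)"
    using G H by (auto simp: W12_with_def square_integrable_def)
  have mK: "K \<in> borel_measurable (lebesgue_on V)"
  proof -
    have [measurable]: "cnj \<in> borel_measurable borel"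
      by (intro borel_measurable_continuous_onI continuous_intros)
    show ?thesis unfolding K_def by measurable
  qed
  have eV: "energy (\<lambda>_. mat 1) V g (\<lambda>y. cnj (h y)) = (LINT y|lebesgue_on V. K y)"
    by (rule energy_eq[OF V(1) _ wG has_weak_derivative_cnj[OF wH(1)] has_weak_derivative_cnj[OF wH(2)] mK])
      (auto simp: mat_def K_def)
  have eU: "energy A U (\<lambda>w. g (\<phi> w)) (\<lambda>w. cnj (h (\<phi> w))) = (LINT w|lebesgue_on U. K (\<phi> w))"
  proof (rule energy_eq[OF U(1) Am W12_0_compose(2,3)[OF g G] has_weak_derivative_cnj[OF W12_0_compose(2)[OF h H]]
        has_weak_derivative_cnj[OF W12_0_compose(3)[OF h H]] scales_measure_measurable[OF c mK]])
    show "AE w in lebesgue_on U.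
      (of_real (A w $ 1 $ 1) * (G 1 (\<phi> w) * p1 w + G \<i> (\<phi> w) * q1 w) + of_real (A w $ 1 $ 2) * (G 1 (\<phi> w) * p2 w + G \<i> (\<phi> w) * q2 w))
        * cnj (H 1 (\<phi> w) * p1 w + H \<i> (\<phi> w) * q1 w)
      + (of_real (A w $ 2 $ 1) * (G 1 (\<phi> w) * p1 w + G \<i> (\<phi> w) * q1 w) + of_real (A w $ 2 $ 2) * (G 1 (\<phi> w) * p2 w + G \<i> (\<phi> w) * q2 w))
        * cnj (H 1 (\<phi> w) * p2 w + H \<i> (\<phi> w) * q2 w) = K (\<phi> w)"
      using identities J'
    proof eventually_elim
      case (elim w)
      have cn: "cnj (H 1 (\<phi> w) * p1 w + H \<i> (\<phi> w) * q1 w) = cnj (H 1 (\<phi> w)) * p1 w + cnj (H \<i> (\<phi> w)) * q1 w"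
        "cnj (H 1 (\<phi> w) * p2 w + H \<i> (\<phi> w) * q2 w) = cnj (H 1 (\<phi> w)) * p2 w + cnj (H \<i> (\<phi> w)) * q2 w"
        by (simp_all add: p1_def p2_def q1_def q2_def)
      have id: "of_real (A w $ 1 $ 1) * p1 w + of_real (A w $ 1 $ 2) * p2 w = q2 w"
        "of_real (A w $ 1 $ 2) * p1 w + of_real (A w $ 2 $ 2) * p2 w = - q1 w"
        "of_real (A w $ 1 $ 1) * q1 w + of_real (A w $ 1 $ 2) * q2 w = - p2 w"
        "of_real (A w $ 1 $ 2) * q1 w + of_real (A w $ 2 $ 2) * q2 w = p1 w"
        using elim(1) by (simp_all add: p1_def p2_def q1_def q2_def flip: of_real_mult of_real_add of_real_minus)
      have s: "A w $ 2 $ 1 = A w $ 1 $ 2" using elim by simp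
      show ?case unfolding s cn K_def by (rule gradient_form_transform[OF id elim(2)])
    qed
  qed
  have "(LINT w|lebesgue_on U. K (\<phi> w)) = of_real c * (LINT y|lebesgue_on V. K y)"
    using scales_measure_integral(1)[OF c mK] by (simp add: scaleR_conv_of_real)
  then show ?thesis by (simp add: eU eV)
qed

lemma inner_compose:
  assumes c: "scales_measure U V \<phi> c" and g: "g \<in> W12_0 V" and h: "h \<in> W12_0 V"
  shows "(LINT w|lebesgue_on U. g (\<phi> w) * cnj (h (\<phi> w))) = of_real c * (LINT y|lebesgue_on V. g y * cnj (h y))"
proof -
  obtain G where G: "W12_with V g G" using W12_0_obtain[OF g] .
  obtain H where H: "W12_with V h H" using W12_0_obtain[OF h] .
  have [measurable]: "g \<in> borel_measurable (lebesgue_on V)" "h \<in> borel_measurable (lebesgue_on V)"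
    using G H by (auto simp: W12_with_def square_integrable_def)
  have [measurable]: "cnj \<in> borel_measurable borel"
    by (intro borel_measurable_continuous_onI continuous_intros)
  have "(\<lambda>y. g y * cnj (h y)) \<in> borel_measurable (lebesgue_on V)" by measurable
  from scales_measure_integral(1)[OF c this] show ?thesis by (simp add: scaleR_conv_of_real)
qed

text \<open>The weak equation must be tested with every \<open>f\<close> in \<open>W12_0 U\<close>.
  Each such \<open>f\<close> agrees on \<open>U\<close> with a function
  \<open>h \<circ> \<phi>\<close>, \<open>h\<close> in \<open>W12_0 V\<close>, so composition being
  onto is as essential as its mapping property.\<close>

lemma eigenspace_compose:
  assumes g: "g \<in> eigenspace (\<lambda>_. mat 1) V t"
  shows "(\<lambda>w. g (\<phi> w)) \<in> eigenspace A U t"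
proof -
  obtain c where c: "0 < c" "scales_measure U V \<phi> c" using scales by blast
  have gW: "g \<in> W12_0 V" and ge: "\<And>h. h \<in> W12_0 V \<Longrightarrow> energy (\<lambda>_. mat 1) V g (\<lambda>y. cnj (h y)) = of_real t * (LINT y|lebesgue_on V. g y * cnj (h y))"
    using g by (auto simp: eigenspace_def)
  obtain G where G: "W12_with V g G" using W12_0_obtain[OF gW] .
  have "energy A U (\<lambda>w. g (\<phi> w)) (\<lambda>w. cnj (f w)) = of_real t * (LINT w|lebesgue_on U. g (\<phi> w) * cnj (f w))"
    if f: "f \<in> W12_0 U" for f
  proof -
    define h where "h y = f (\<psi> y)" for y
    have h: "h \<in> W12_0 V" unfolding h_def[abs_def] by (rule W12_0_compose_inverse[OF f])
    have fh: "w \<in> U \<Longrightarrow> cnj (f w) = cnj (h (\<phi> w))" for w by (simp add: h_def inv_\<psi>\<phi>)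
    have "energy A U (\<lambda>w. g (\<phi> w)) (\<lambda>w. cnj (f w)) = energy A U (\<lambda>w. g (\<phi> w)) (\<lambda>w. cnj (h (\<phi> w)))"
      by (rule energy_cong) (use fh in auto)
    also have "\<dots> = of_real t * (of_real c * (LINT y|lebesgue_on V. g y * cnj (h y)))"
      by (simp add: energy_compose[OF c(2) gW h] ge[OF h])
    also have "of_real c * (LINT y|lebesgue_on V. g y * cnj (h y)) = (LINT w|lebesgue_on U. g (\<phi> w) * cnj (h (\<phi> w)))"
      by (rule inner_compose[OF c(2) gW h, symmetric])
    also have "\<dots> = (LINT w|lebesgue_on U. g (\<phi> w) * cnj (f w))"
      by (rule Bochner_Integration.integral_cong) (use fh in auto)
    finally show ?thesis .
  qed
  then show ?thesis using W12_0_compose(1)[OF gW G] by (simp add: eigenspace_def)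
qed

lemma eigenspace_compose_inverse:
  assumes g: "g \<in> eigenspace A U t"
  shows "(\<lambda>y. g (\<psi> y)) \<in> eigenspace (\<lambda>_. mat 1) V t"
proof -
  obtain c where c: "0 < c" "scales_measure U V \<phi> c" using scales by blast
  have gW: "g \<in> W12_0 U" and ge: "\<And>f. f \<in> W12_0 U \<Longrightarrow> energy A U g (\<lambda>w. cnj (f w)) = of_real t * (LINT w|lebesgue_on U. g w * cnj (f w))"
    using g by (auto simp: eigenspace_def)
  have gV: "(\<lambda>y. g (\<psi> y)) \<in> W12_0 V" by (rule W12_0_compose_inverse[OF gW])
  have "energy (\<lambda>_. mat 1) V (\<lambda>y. g (\<psi> y)) (\<lambda>y. cnj (h y)) = of_real t * (LINT y|lebesgue_on V. g (\<psi> y) * cnj (h y))"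
    if h: "h \<in> W12_0 V" for h
  proof -
    obtain H where H: "W12_with V h H" using W12_0_obtain[OF h] .
    have "of_real c * energy (\<lambda>_. mat 1) V (\<lambda>y. g (\<psi> y)) (\<lambda>y. cnj (h y))
        = energy A U (\<lambda>w. g (\<psi> (\<phi> w))) (\<lambda>w. cnj (h (\<phi> w)))"
      by (rule energy_compose[OF c(2) gV h, symmetric])
    also have "\<dots> = energy A U g (\<lambda>w. cnj (h (\<phi> w)))"
      by (rule energy_cong) (auto simp: inv_\<psi>\<phi>)
    also have "\<dots> = of_real t * (LINT w|lebesgue_on U. g w * cnj (h (\<phi> w)))"
      by (rule ge[OF W12_0_compose(1)[OF h H]])
    also have "(LINT w|lebesgue_on U. g w * cnj (h (\<phi> w))) = (LINT w|lebesgue_on U. g (\<psi> (\<phi> w)) * cnj (h (\<phi> w)))"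
      by (rule Bochner_Integration.integral_cong) (auto simp: inv_\<psi>\<phi>)
    also have "\<dots> = of_real c * (LINT y|lebesgue_on V. g (\<psi> y) * cnj (h y))"
      by (rule inner_compose[OF c(2) gV h])
    \<comment> \<open>Both sides carry the factor \<open>c\<close>, which is positive and can be
      cancelled.\<close>
    finally show ?thesis using c(1) by simp
  qed
  then show ?thesis using gV by (simp add: eigenspace_def)
qed

section \<open>Multiplicities and the eigenvalue sequence\<close>

lemma independent_ae_compose:
  assumes "independent_ae V m g"
  shows "independent_ae U m (\<lambda>i w. g i (\<phi> w))"
  unfolding independent_ae_def
proof (intro allI impI)
  fix c :: "nat \<Rightarrow> complex" and i assume ae: "AE w in lebesgue_on U. (\<Sum>i<m. c i * g i (\<phi> w)) = 0" and i: "i < m"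
  obtain d where d: "scales_measure V U \<psi> d" using scales by blast
  \<comment> \<open>A linear relation holding off a null set of \<open>U\<close> holds off a null
    set of \<open>V\<close> after composition with \<psi>, since null sets pull back to null
    sets.\<close>
  have "AE y in lebesgue_on V. (\<Sum>i<m. c i * g i (\<phi> (\<psi> y))) = 0"
    by (rule scales_measure_AE[OF d ae])
  then have "AE y in lebesgue_on V. (\<Sum>i<m. c i * g i y) = 0"
    by (rule lebesgue_on_mono) (simp add: inv_\<phi>\<psi>)
  then show "c i = 0" using assms i by (auto simp: independent_ae_def)
qed

lemma independent_ae_compose_inverse:
  assumes "independent_ae U m g"
  shows "independent_ae V m (\<lambda>i y. g i (\<psi> y))"
  unfolding independent_ae_def
proof (intro allI impI)
  fix c :: "nat \<Rightarrow> complex" and i assume ae: "AE y in lebesgue_on V. (\<Sum>i<m. c i * g i (\<psi> y)) = 0" and i: "i < m"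
  obtain d where d: "scales_measure U V \<phi> d" using scales by blast
  have "AE w in lebesgue_on U. (\<Sum>i<m. c i * g i (\<psi> (\<phi> w))) = 0"
    by (rule scales_measure_AE[OF d ae])
  then have "AE w in lebesgue_on U. (\<Sum>i<m. c i * g i w) = 0"
    by (rule lebesgue_on_mono) (simp add: inv_\<psi>\<phi>)
  then show "c i = 0" using assms i by (auto simp: independent_ae_def)
qed

lemma eigenvalue_mult_eq: "eigenvalue_mult A U t = eigenvalue_mult (\<lambda>_. mat 1) V t"
proof -
  have "(\<exists>g. (\<forall>i<m. g i \<in> eigenspace A U t) \<and> independent_ae U m g)
     \<longleftrightarrow> (\<exists>g. (\<forall>i<m. g i \<in> eigenspace (\<lambda>_. mat 1) V t) \<and> independent_ae V m g)" for m
  proof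
    assume "\<exists>g. (\<forall>i<m. g i \<in> eigenspace A U t) \<and> independent_ae U m g"
    then obtain g where "\<forall>i<m. g i \<in> eigenspace A U t" "independent_ae U m g" by blast
    then show "\<exists>g. (\<forall>i<m. g i \<in> eigenspace (\<lambda>_. mat 1) V t) \<and> independent_ae V m g"
      using eigenspace_compose_inverse independent_ae_compose_inverse
      by (intro exI[of _ "\<lambda>i y. g i (\<psi> y)"]) blast
  next
    assume "\<exists>g. (\<forall>i<m. g i \<in> eigenspace (\<lambda>_. mat 1) V t) \<and> independent_ae V m g"
    then obtain g where "\<forall>i<m. g i \<in> eigenspace (\<lambda>_. mat 1) V t" "independent_ae V m g" by blast
    then show "\<exists>g. (\<forall>i<m. g i \<in> eigenspace A U t) \<and> independent_ae U m g"
      using eigenspace_compose independent_ae_compose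
      by (intro exI[of _ "\<lambda>i w. g i (\<phi> w)"]) blast
  qed
  then show ?thesis by (simp add: eigenvalue_mult_def)
qed

text \<open>No spectral theorem is needed: the two definite descriptions are the same, whether or not a sequence exists.\<close>

lemma dirichlet_eigenvalue_eq_laplace: "dirichlet_eigenvalue A U n = laplace_eigenvalue V n"
proof -
  have "eigenvalue_sequence A U = eigenvalue_sequence (\<lambda>_. mat 1) V"
    by (simp add: fun_eq_iff eigenvalue_sequence_def eigenvalue_mult_eq)
  then show ?thesis by (simp add: dirichlet_eigenvalue_def laplace_eigenvalue_def)
qed

end

theorem mainTheorem2:
  fixes \<Omega>' \<Omega> :: "complex set"
    and A :: "complex \<Rightarrow> real ^ 2 ^ 2"
    and \<phi> :: "complex \<Rightarrow> complex"
  assumes "open \<Omega>'" "connected \<Omega>'" "\<Omega>' \<noteq> {}" "bounded \<Omega>'" "simply_connected \<Omega>'"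
    and "open \<Omega>" "connected \<Omega>" "\<Omega> \<noteq> {}" "bounded \<Omega>" "simply_connected \<Omega>"
    and "A \<in> elliptic_matrices \<Omega>'"
    and "A_quasiconformal A \<Omega>' \<Omega> \<phi>"
    and "AE w in lebesgue_on \<Omega>'. \<bar>weak_jacobian \<Omega>' \<phi> w\<bar> = 1"
  shows "\<forall>n\<ge>1. dirichlet_eigenvalue A \<Omega>' n = laplace_eigenvalue \<Omega> n"
proof -
  let ?f1 = "weak_du \<Omega>' \<phi>" and ?f2 = "weak_dv \<Omega>' \<phi>"
  have qc: "quasiconformal \<Omega>' \<Omega> \<phi>"
    and bel: "AE w in lebesgue_on \<Omega>'. weak_dwbar \<Omega>' \<phi> w = beltrami_coefficient A w * weak_dw \<Omega>' \<phi> w"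
    using assms(12) by (auto simp: A_quasiconformal_def)
  obtain \<psi> where hom: "homeomorphism \<Omega>' \<Omega> \<phi> \<psi>" using qc by (auto simp: quasiconformal_def)
  obtain K where K: "1 \<le> K" "AE w in lebesgue_on \<Omega>'. (differential_norm \<Omega>' \<phi> w)\<^sup>2 \<le> K * \<bar>weak_jacobian \<Omega>' \<phi> w\<bar>"
    using qc by (auto simp: quasiconformal_def)
  have "\<exists>g. has_weak_derivative \<Omega>' e \<phi> g" if "e \<in> {1, \<i>}" for e
    using qc that by (auto simp: quasiconformal_def W12_loc_def)
  then have wd: "has_weak_derivative \<Omega>' 1 \<phi> ?f1" "has_weak_derivative \<Omega>' \<i> \<phi> ?f2"
    using weak_derivative_works by blast+
  \<comment> \<open>The partial derivatives are the values of the differential at the unit vectors 1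
    and \<i>.\<close>
  have le: "cmod (?f1 w) \<le> differential_norm \<Omega>' \<phi> w" "cmod (?f2 w) \<le> differential_norm \<Omega>' \<phi> w" for w
  proof -
    have bl: "bounded_linear (\<lambda>h :: complex. of_real (Re h) * ?f1 w + of_real (Im h) * ?f2 w)"
      by (intro bounded_linear_add bounded_linear_mult_const bounded_linear_compose[OF bounded_linear_of_real]
          bounded_linear_Re bounded_linear_Im)
    show "cmod (?f1 w) \<le> differential_norm \<Omega>' \<phi> w" "cmod (?f2 w) \<le> differential_norm \<Omega>' \<phi> w"
      using onorm[OF bl, of 1] onorm[OF bl, of \<i>] by (simp_all add: differential_norm_def)
  qed
  \<comment> \<open>The distortion inequality with |J| = 1 turns the quasiconformality constant into
    the bound \<open>sqrt K\<close> for the differential.\<close>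
  have dn: "AE w in lebesgue_on \<Omega>'. differential_norm \<Omega>' \<phi> w \<le> sqrt K"
    using K(2) assms(13) by eventually_elim (simp add: real_le_rsqrt)
  have ell: "AE w in lebesgue_on \<Omega>'. transpose (A w) = A w \<and> det (A w) = 1"
    and Am: "\<And>k l. (\<lambda>w. A w $ k $ l) \<in> borel_measurable (lebesgue_on \<Omega>')"
    using assms(11) by (auto simp: elliptic_matrices_def)
  obtain K' where K': "1 \<le> K'" "AE w in lebesgue_on \<Omega>'. \<forall>\<xi> :: real ^ 2.
      (1 / K') * (norm \<xi>)\<^sup>2 \<le> (A w *v \<xi>) \<bullet> \<xi> \<and> (A w *v \<xi>) \<bullet> \<xi> \<le> K' * (norm \<xi>)\<^sup>2"
    using assms(11) by (auto simp: elliptic_matrices_def)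
  \<comment> \<open>Uniform ellipticity tested at the first basis vector bounds the upper left entry
    below by \<open>1 / K'\<close>. Together with determinant 1 this is all the positivity used in
    the matrix identities.\<close>
  have pos: "AE w in lebesgue_on \<Omega>'. 0 < A w $ 1 $ 1"
    using K'(2)
  proof eventually_elim
    case (elim w)
    have "(A w *v axis 1 1) \<bullet> axis 1 1 = A w $ 1 $ 1"
      by (simp add: inner_axis matrix_vector_mult_basis column_def)
    moreover have "(1 / K') * (norm (axis 1 1 :: real ^ 2))\<^sup>2 \<le> (A w *v axis 1 1) \<bullet> axis 1 1" using elim by blast
    ultimately have "1 / K' \<le> A w $ 1 $ 1" by simp
    moreover have "0 < 1 / K'" using K'(1) by simp
    ultimately show ?case by linarith
  qed
  have ids: "AE w in lebesgue_on \<Omega>'. Re (?f1 w) * Im (?f2 w) - Re (?f2 w) * Im (?f1 w) = 1 \<and> A w $ 2 $ 1 = A w $ 1 $ 2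
      \<and> A w $ 1 $ 1 * Re (?f1 w) + A w $ 1 $ 2 * Re (?f2 w) = Im (?f2 w)
      \<and> A w $ 1 $ 2 * Re (?f1 w) + A w $ 2 $ 2 * Re (?f2 w) = - Im (?f1 w)
      \<and> A w $ 1 $ 1 * Im (?f1 w) + A w $ 1 $ 2 * Im (?f2 w) = - Re (?f2 w)
      \<and> A w $ 1 $ 2 * Im (?f1 w) + A w $ 2 $ 2 * Im (?f2 w) = Re (?f1 w)"
    using ell pos bel assms(13)
  proof eventually_elim
    case (elim w)
    have A: "transpose (A w) = A w" "det (A w) = 1" using elim(1) by auto
    note I = elliptic_beltrami_identities[OF A elim(2) elim(3)[unfolded weak_dwbar_def weak_dw_def beltrami_coefficient_def]
        elim(4)[unfolded weak_jacobian_def]]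
    show ?case by (intro conjI I)
  qed
  interpret area_preserving_quasiconformal \<Omega>' \<Omega> \<phi> \<psi> ?f1 ?f2 "sqrt K" A
  proof
    show "AE w in lebesgue_on \<Omega>'. cmod (?f1 w) \<le> sqrt K" using dn by eventually_elim (rule order_trans[OF le(1)])
    show "AE w in lebesgue_on \<Omega>'. cmod (?f2 w) \<le> sqrt K" using dn by eventually_elim (rule order_trans[OF le(2)])
    show "AE w in lebesgue_on \<Omega>'. Re (?f1 w) * Im (?f2 w) - Re (?f2 w) * Im (?f1 w) = 1"
      using ids by eventually_elim blast
    show "AE w in lebesgue_on \<Omega>'. A w $ 2 $ 1 = A w $ 1 $ 2
      \<and> A w $ 1 $ 1 * Re (?f1 w) + A w $ 1 $ 2 * Re (?f2 w) = Im (?f2 w)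
      \<and> A w $ 1 $ 2 * Re (?f1 w) + A w $ 2 $ 2 * Re (?f2 w) = - Im (?f1 w)
      \<and> A w $ 1 $ 1 * Im (?f1 w) + A w $ 1 $ 2 * Im (?f2 w) = - Re (?f2 w)
      \<and> A w $ 1 $ 2 * Im (?f1 w) + A w $ 2 $ 2 * Im (?f2 w) = Re (?f1 w)"
      using ids by eventually_elim blast
  qed (use assms hom wd Am in auto)
  show ?thesis using dirichlet_eigenvalue_eq_laplace by blast
qed

end
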